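(* Let $G$ be an arbitrary (not necessarily finite index) subgroup of $\Gamma=\mathrm{PSL}_2(\mathbb{Z})$, let $Y'$ be a tree obtained by cutting $Y_{\mathrm{comb}}(G)$ at some of its vertices of valency 2, and let $\jmath:Y'\to\mathbf{T}$ be a lift of $Y'$. Let $P$ be the corresponding polygon, $\sigma$ the corresponding involution on the set of edges of $P$, and $g_s\in G$ ($s$ an edge of $P$) the corresponding elements, all as defined in the context. 1. The couple $(P,\sigma)$ is a special polygon. 2. Let $S$ be a subset of the set of edges of $P$ which intersects every $\sigma$-orbit exactly once. Then $\{g_s\mid s\in S\}$ is an independent set of generators of $G$.
   Context: **Graphs.** $\mathbb{H}$ is the hyperbolic upper half-plane with the action of $\Gamma=\mathrm{PSL}_2(\mathbb{Z})$. Put $\rho=e^{\pi i/3}$ and let $\triangle\subset\mathbb{H}$ be the (closed) hyperbolic triangle with vertices $\rho,0,\infty$. Let $G_0,G_1\subset\Gamma$ be the subgroups of order 2 and 3 generated by the classes of $\left(\begin{smallmatrix}0&-1\\1&0\end{smallmatrix}\right)$ and $\left(\begin{smallmatrix}0&1\\-1&1\end{smallmatrix}\right)$ (fixing $i$ and $\rho$ respectively). The graph $Y_{\mathrm{comb}}(G)$ (multiple edges allowed) has vertex set $(G\backslash\Gamma/G_0)\sqcup(G\backslash\Gamma/G_1)$ (vertices of type (0), of valency 1 or 2, and of type (1), of valency 1 or 3) and edge set $G\backslash\Gamma$; an edge $x\in G\backslash\Gamma$ joins the $G_0$-orbit of $x$ with the $G_1$-orbit of $x$. $\mathbf{T}=Y_{\mathrm{comb}}(\{\mathrm{Id}\})$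 is a tree with edge set $\Gamma$, on which $\Gamma$ acts on the left, and $G\backslash\mathbf{T}=Y_{\mathrm{comb}}(G)$. Cutting at a vertex of valency 2 means replacing it by two univalent vertices, each incident to one of the two edges. A lift $\jmath:Y'\to\mathbf{T}$ is a map of graphs whose composite with $\mathbf{T}\to Y_{\mathrm{comb}}(G)$ is the natural map $Y'\to Y_{\mathrm{comb}}(G)$; we identify $Y'$ with $\jmath(Y')$, so that edges of $Y'$ are elements of $\Gamma$. **The polygon.** $P=\bigcup_g g\cdot\triangle$ over all edges $g\in\Gamma$ of $\jmath(Y')$; it is a convex hyperbolic polygon and a fundamental domain for $G$. The edges of $P$ are obtained from the univalent vertices $V$ of $Y'$ as follows; let $g\in\Gamma$ be the edge of $\jmath(Y')$ incident to $V$. - If $V$ is of type (0) and arises from cutting a bivalent vertex of $Y_{\mathrm{comb}}(G)$, then $V$ gives one edge $g\cdot(0,\infty)$ of $P$. - If $V$ is of type (0) and comes from a univalent vertex of $Y_{\mathrm{comb}}(G)$, then $V$ gives two edges $g\cdot[i,0)$ and $g\cdot[i,\infty)$ of $P$. - If $V$ is of type (1), then $V$ gives two edges $g\cdot[\rho,0)$ and $g\cdot[\rho,\infty)$ of $P$. (Intervals are geodesic.) **The involution $\sigma$ and elements $g_s$.** - If $s$ corresponds to a vertex $V$ obtained by cutting a bivalent vertex $W$, and $\bar s$ is the edge corresponding to the other vertex $\bar V$ obtained from $W$, then $\sigma(s)=\bar s$, $\sigma(\bar s)=s$, and $g_s\in\Gamma$ is the unique element taking $s$ to $\bar s$ and reversing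 the orientations of $s,\bar s$ induced from $P$. - If $s',s''$ correspond to a univalent vertex of type (0) coming from a univalent vertex of $Y_{\mathrm{comb}}(G)$, then $\sigma(s')=s''$, $\sigma(s'')=s'$, and $g_{s'}=g_{s''}$ is the unique element of $\Gamma$ that swaps $s'$ and $s''$. - If $s',s''$ correspond to a univalent vertex of type (1), then $\sigma(s')=s''$, $\sigma(s'')=s'$; $g_{s'}$ is the unique element of $\Gamma$ taking $s'$ to $s''$, and $g_{s''}=g_{s'}^{-1}$. In all cases $g_s\in G$ and $g_s$ takes $s$ to $\sigma(s)$. **Special polygon.** A special polygon is a convex hyperbolic polygon $P\subset\mathbb{H}$ (possibly with infinitely many edges) with an involution $\sigma$ on the set of its edges such that: 1. every edge is a $\Gamma$-copy of the geodesic interval joining $\infty$ with $0$, $i$ or $\rho$; 2. every edge which is a $\Gamma$-copy of $(0,\infty)$ is paired under $\sigma$ with another such edge; 3. every edge $s$ which is a $\Gamma$-copy of $[i,\infty)$ is adjacent to another such edge $s'$, $\sigma$ interchanges $s$ and $s'$, and the angle between them is $\pi$; 4. every edge $s$ which is a $\Gamma$-copy of $[\rho,\infty)$ is adjacent to another such edge $s'$, $\sigma$ interchanges $s$ and $s'$, and the internal angle between them is $2\pi/3$. **Independent generators.** A (possibly infinite) subset of a group $H$ is an independent set of generators if $H$ is the free product of the cyclic subgroups generated by the elements of the subset. *)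

theory Defs
  imports "HOL-Analysis.Analysis" "HOL-Algebra.Coset" "HOL-Algebra.Elementary_Groups"
begin

section \<open>The modular group and its action on the upper half-plane\<close>

definition SL2Z :: "(int ^ 2 ^ 2) monoid" where
  "SL2Z = \<lparr>carrier = {A. det A = 1}, mult = (**), one = mat 1\<rparr>"

text \<open>The elements of \<open>PSL2Z\<close> are the sets \<open>{A, - A}\<close>.\<close>

definition PSL2Z :: "(int ^ 2 ^ 2) set monoid" where
  "PSL2Z = SL2Z Mod {mat 1, - mat 1}"

definition psl_class :: "int \<Rightarrow> int \<Rightarrow> int \<Rightarrow> int \<Rightarrow> (int ^ 2 ^ 2) set" where
  "psl_class a b c d =
    {mat 1, - mat 1} #>\<^bsub>SL2Z\<^esub> vector [vector [a, b], vector [c, d]]"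

definition G0 :: "(int ^ 2 ^ 2) set set" where
  "G0 = generate PSL2Z {psl_class 0 (- 1) 1 0}"

definition G1 :: "(int ^ 2 ^ 2) set set" where
  "G1 = generate PSL2Z {psl_class 0 1 (- 1) 1}"

definition HH :: "complex set" where
  "HH = {z. Im z > 0}"

definition mobius :: "int ^ 2 ^ 2 \<Rightarrow> complex \<Rightarrow> complex" where
  "mobius A z = (of_int (A $ 1 $ 1) * z + of_int (A $ 1 $ 2)) /
                (of_int (A $ 2 $ 1) * z + of_int (A $ 2 $ 2))"

text \<open>Both representatives \<open>A\<close> and \<open>- A\<close> of a class give the same transformation.\<close>

definition act :: "(int ^ 2 ^ 2) set \<Rightarrow> complex \<Rightarrow> complex" where
  "act g z = (THE w. \<exists>A\<in>g. w = mobius A z)"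


section \<open>Hyperbolic geometry\<close>

definition hyp_dist :: "complex \<Rightarrow> complex \<Rightarrow> real" where
  "hyp_dist z w = arcosh (1 + (cmod (z - w))\<^sup>2 / (2 * Im z * Im w))"

definition hyp_segment :: "complex \<Rightarrow> complex \<Rightarrow> complex set" where
  "hyp_segment z w = {p \<in> HH. hyp_dist z p + hyp_dist p w = hyp_dist z w}"

definition hyp_convex :: "complex set \<Rightarrow> bool" where
  "hyp_convex P \<longleftrightarrow> P \<subseteq> HH \<and> (\<forall>z\<in>P. \<forall>w\<in>P. hyp_segment z w \<subseteq> P)"

text \<open>
  Geodesic intervals may be bounded, or unbounded in one or both directions; ends on the
  boundary of the half-plane do not belong to the interval.
\<close>

definition geodesic_interval :: "complex set \<Rightarrow> bool" where
  "geodesic_interval s \<longleftrightarrow> s \<subseteq> HH \<and>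
    (\<exists>(I :: real set) \<gamma>. is_interval I \<and> closed I \<and> interior I \<noteq> {} \<and> s = \<gamma> ` I \<and>
       (\<forall>t\<in>I. \<forall>u\<in>I. hyp_dist (\<gamma> t) (\<gamma> u) = \<bar>t - u\<bar>))"

definition geodesic_endpoints :: "complex set \<Rightarrow> complex set" where
  "geodesic_endpoints s =
    {p \<in> s. \<not> (\<exists>a\<in>s. \<exists>b\<in>s. a \<noteq> p \<and> b \<noteq> p \<and> p \<in> hyp_segment a b)}"

text \<open>
  A polygon is given together with its set \<open>E\<close> of edges, since consecutive edges may
  meet at an angle of \<open>\<pi>\<close> and so cannot be recovered from the set \<open>P\<close>.
  There may be infinitely many edges (a locally finite family), or none, in which case
  the polygon is the whole half-plane.
\<close>

definition convex_hyp_polygon :: "complex set \<Rightarrow> complex set set \<Rightarrow> bool" where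
  "convex_hyp_polygon P E \<longleftrightarrow>
     hyp_convex P \<and> closedin (top_of_set HH) P \<and> interior P \<noteq> {} \<and>
     (\<forall>s\<in>E. geodesic_interval s) \<and>
     \<Union>E = frontier P \<inter> HH \<and>
     (\<forall>s\<in>E. \<forall>s'\<in>E. s \<noteq> s' \<longrightarrow> s \<inter> s' \<subseteq> geodesic_endpoints s \<inter> geodesic_endpoints s') \<and>
     (\<forall>z\<in>HH. \<exists>U. open U \<and> z \<in> U \<and> finite {s \<in> E. s \<inter> U \<noteq> {}})"

text \<open>
  \<open>tangent_direction s v \<alpha>\<close>: the curve \<open>s\<close> emanates from its endpoint \<open>v\<close> in the
  direction \<open>cis \<alpha>\<close>. At an inner point of a geodesic interval there is no such \<open>\<alpha>\<close>.
\<close>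

definition tangent_direction :: "complex set \<Rightarrow> complex \<Rightarrow> real \<Rightarrow> bool" where
  "tangent_direction s v \<alpha> \<longleftrightarrow> v \<in> s \<and> v islimpt s \<and>
     ((\<lambda>z. sgn (z - v)) \<longlongrightarrow> cis \<alpha>) (at v within s)"

text \<open>
  The half-plane model is conformal, so angles are Euclidean. The edges \<open>s\<close> and \<open>s'\<close> meet
  at \<open>v\<close> with internal angle \<open>\<theta>\<close> if they bound a sector of that angle at \<open>v\<close> which
  is occupied by \<open>P\<close>, the complementary sector being free of \<open>P\<close> near \<open>v\<close>.
\<close>

definition internal_angle ::
    "complex set \<Rightarrow> complex \<Rightarrow> complex set \<Rightarrow> complex set \<Rightarrow> real \<Rightarrow> bool" where
  "internal_angle P v s s' \<theta> \<longleftrightarrow> 0 < \<theta> \<and> \<theta> < 2 * pi \<and>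
     (\<exists>\<alpha>. (tangent_direction s v \<alpha> \<and> tangent_direction s' v (\<alpha> + \<theta>) \<or>
           tangent_direction s' v \<alpha> \<and> tangent_direction s v (\<alpha> + \<theta>)) \<and>
          (\<forall>\<phi>. \<alpha> < \<phi> \<and> \<phi> < \<alpha> + \<theta> \<longrightarrow>
               (\<forall>\<^sub>F r in at_right 0. v + of_real r * cis \<phi> \<in> P)) \<and>
          (\<forall>\<phi>. \<alpha> + \<theta> < \<phi> \<and> \<phi> < \<alpha> + 2 * pi \<longrightarrow>
               (\<forall>\<^sub>F r in at_right 0. v + of_real r * cis \<phi> \<notin> P)))"

text \<open>
  The orientation of a boundary edge induced from \<open>P\<close>: the parametrization \<open>\<gamma>\<close> of the
  edge (a geodesic without endpoints) has the interior of \<open>P\<close> on its left, that is,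
  in the direction of \<open>\<i>\<close> times its velocity.
\<close>

definition induced_orientation :: "complex set \<Rightarrow> complex set \<Rightarrow> (real \<Rightarrow> complex) \<Rightarrow> bool" where
  "induced_orientation P s \<gamma> \<longleftrightarrow> inj \<gamma> \<and> range \<gamma> = s \<and>
     (\<forall>t. \<exists>v. (\<gamma> has_vector_derivative v) (at t) \<and> v \<noteq> 0 \<and>
          (\<forall>\<^sub>F r in at_right 0. \<gamma> t + of_real r * (\<i> * v) \<in> interior P))"

definition reverses_orientation ::
    "complex set \<Rightarrow> complex set \<Rightarrow> complex set \<Rightarrow> (int ^ 2 ^ 2) set \<Rightarrow> bool" where
  "reverses_orientation P s s' h \<longleftrightarrow>
     (\<forall>\<gamma>. induced_orientation P s \<gamma> \<longrightarrow> induced_orientation P s' (\<lambda>t. act h (\<gamma> (- t))))"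

text \<open>
  With \<open>\<rho> = exp (\<pi> \<i> / 3)\<close>: the triangle with vertices \<open>\<rho>\<close>, \<open>0\<close>, \<open>\<infinity>\<close>, bounded by
  the geodesics \<open>Re z = 0\<close>, \<open>Re z = 1/2\<close> and \<open>\<bar>z - 1\<bar> = 1\<close>, and the geodesic intervals
  \<open>(0,\<infinity>)\<close>, \<open>[i,0)\<close>, \<open>[i,\<infinity>)\<close>, \<open>[\<rho>,0)\<close>, \<open>[\<rho>,\<infinity>)\<close>.
\<close>

definition Triangle :: "complex set" where
  "Triangle = {z \<in> HH. 0 \<le> Re z \<and> Re z \<le> 1/2 \<and> cmod (z - 1) \<ge> 1}"

definition int_0_inf :: "complex set" where
  "int_0_inf = {z \<in> HH. Re z = 0}"

definition int_i_0 :: "complex set" where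
  "int_i_0 = {z \<in> HH. Re z = 0 \<and> Im z \<le> 1}"

definition int_i_inf :: "complex set" where
  "int_i_inf = {z \<in> HH. Re z = 0 \<and> Im z \<ge> 1}"

definition int_rho_0 :: "complex set" where
  "int_rho_0 = {z \<in> HH. cmod (z - 1) = 1 \<and> Re z \<le> 1/2}"

definition int_rho_inf :: "complex set" where
  "int_rho_inf = {z \<in> HH. Re z = 1/2 \<and> Im z \<ge> sqrt 3 / 2}"


section \<open>Special polygons\<close>

definition is_copy :: "complex set \<Rightarrow> complex set \<Rightarrow> bool" where
  "is_copy I s \<longleftrightarrow> (\<exists>g\<in>carrier PSL2Z. s = act g ` I)"

definition special_polygon ::
    "complex set \<Rightarrow> complex set set \<Rightarrow> (complex set \<Rightarrow> complex set) \<Rightarrow> bool" where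
  "special_polygon P E \<sigma> \<longleftrightarrow>
     convex_hyp_polygon P E \<and>
     (\<forall>s\<in>E. \<sigma> s \<in> E \<and> \<sigma> (\<sigma> s) = s) \<and>
     (\<forall>s\<in>E. is_copy int_0_inf s \<or> is_copy int_i_inf s \<or> is_copy int_rho_inf s) \<and>
     (\<forall>s\<in>E. is_copy int_0_inf s \<longrightarrow> \<sigma> s \<noteq> s \<and> is_copy int_0_inf (\<sigma> s)) \<and>
     (\<forall>s\<in>E. is_copy int_i_inf s \<longrightarrow>
        (\<exists>s'\<in>E. s' \<noteq> s \<and> is_copy int_i_inf s' \<and> \<sigma> s = s' \<and> \<sigma> s' = s \<and>
           (\<exists>v \<in> s \<inter> s'. internal_angle P v s s' pi))) \<and>
     (\<forall>s\<in>E. is_copy int_rho_inf s \<longrightarrow>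
        (\<exists>s'\<in>E. s' \<noteq> s \<and> is_copy int_rho_inf s' \<and> \<sigma> s = s' \<and> \<sigma> s' = s \<and>
           (\<exists>v \<in> s \<inter> s'. internal_angle P v s s' (2 * pi / 3))))"


section \<open>Free products and independent generators\<close>

text \<open>
  The free product of the groups \<open>K i\<close>, \<open>i \<in> I\<close>: words in the disjoint union of the
  groups, modulo the congruence generated by deleting neutral elements and multiplying
  neighbouring letters from the same group.
\<close>

definition fp_words :: "'i set \<Rightarrow> ('i \<Rightarrow> ('a, 'b) monoid_scheme) \<Rightarrow> ('i \<times> 'a) list set" where
  "fp_words I K = lists (SIGMA i : I. carrier (K i))"

inductive fp_step ::
    "'i set \<Rightarrow> ('i \<Rightarrow> ('a, 'b) monoid_scheme) \<Rightarrow> ('i \<times> 'a) list \<Rightarrow> ('i \<times> 'a) list \<Rightarrow> bool"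
  for I K where
  delete: "\<lbrakk>u \<in> fp_words I K; w \<in> fp_words I K; i \<in> I\<rbrakk> \<Longrightarrow>
     fp_step I K (u @ [(i, \<one>\<^bsub>K i\<^esub>)] @ w) (u @ w)"
| merge: "\<lbrakk>u \<in> fp_words I K; w \<in> fp_words I K; i \<in> I; x \<in> carrier (K i); y \<in> carrier (K i)\<rbrakk> \<Longrightarrow>
     fp_step I K (u @ [(i, x), (i, y)] @ w) (u @ [(i, x \<otimes>\<^bsub>K i\<^esub> y)] @ w)"

definition fp_rel ::
    "'i set \<Rightarrow> ('i \<Rightarrow> ('a, 'b) monoid_scheme) \<Rightarrow> (('i \<times> 'a) list \<times> ('i \<times> 'a) list) set" where
  "fp_rel I K = {(u, w). u \<in> fp_words I K \<and> w \<in> fp_words I K \<and> equivclp (fp_step I K) u w}"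

definition free_product ::
    "'i set \<Rightarrow> ('i \<Rightarrow> ('a, 'b) monoid_scheme) \<Rightarrow> ('i \<times> 'a) list set monoid" where
  "free_product I K =
    \<lparr>carrier = fp_words I K // fp_rel I K,
     mult = (\<lambda>X Y. \<Union>u\<in>X. \<Union>w\<in>Y. fp_rel I K `` {u @ w}),
     one = fp_rel I K `` {[]}\<rparr>"

text \<open>The natural homomorphism to \<open>H\<close> when all \<open>K i\<close> are subgroups of \<open>H\<close>.\<close>

definition fp_map :: "('a, 'b) monoid_scheme \<Rightarrow> ('i \<times> 'a) list set \<Rightarrow> 'a" where
  "fp_map H X = (THE h. \<exists>w\<in>X. h = foldr (\<lambda>(i, x) y. x \<otimes>\<^bsub>H\<^esub> y) w \<one>\<^bsub>H\<^esub>)"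

definition independent_generators :: "('a, 'b) monoid_scheme \<Rightarrow> 'a set \<Rightarrow> bool" where
  "independent_generators H S \<longleftrightarrow> S \<subseteq> carrier H \<and>
     fp_map H \<in> iso (free_product S (\<lambda>s. subgroup_generated H {s})) H"


section \<open>Graphs\<close>

text \<open>Undirected graphs with multiple edges; \<open>ends\<close> gives the set of endpoints of an edge.\<close>

record ('v, 'e) ugraph =
  verts :: "'v set"
  edges :: "'e set"
  ends :: "'e \<Rightarrow> 'v set"

definition valency :: "('v, 'e) ugraph \<Rightarrow> 'v \<Rightarrow> nat" where
  "valency Y v = card {e \<in> edges Y. v \<in> ends Y e}"

fun walk :: "('v, 'e) ugraph \<Rightarrow> 'v \<Rightarrow> 'e list \<Rightarrow> 'v \<Rightarrow> bool" where
  "walk Y u [] v \<longleftrightarrow> u \<in> verts Y \<and> u = v"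
| "walk Y u (e # es) v \<longleftrightarrow>
     u \<in> verts Y \<and> e \<in> edges Y \<and> (\<exists>w. ends Y e = {u, w} \<and> walk Y w es v)"

text \<open>Connected, and without nonempty closed walks that use every edge at most once.\<close>

definition is_tree :: "('v, 'e) ugraph \<Rightarrow> bool" where
  "is_tree Y \<longleftrightarrow> verts Y \<noteq> {} \<and>
     (\<forall>u\<in>verts Y. \<forall>v\<in>verts Y. \<exists>es. walk Y u es v) \<and>
     (\<forall>u\<in>verts Y. \<forall>es. walk Y u es u \<and> distinct es \<longrightarrow> es = [])"

definition graph_map ::
    "('v, 'e) ugraph \<Rightarrow> ('w, 'f) ugraph \<Rightarrow> ('v \<Rightarrow> 'w) \<Rightarrow> ('e \<Rightarrow> 'f) \<Rightarrow> bool" where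
  "graph_map Y Z fv fe \<longleftrightarrow> fv ` verts Y \<subseteq> verts Z \<and> fe ` edges Y \<subseteq> edges Z \<and>
     (\<forall>e\<in>edges Y. ends Z (fe e) = fv ` ends Y e)"

text \<open>\<open>Cut v e\<close> is the copy, incident to the edge \<open>e\<close>, of the vertex \<open>v\<close> that is cut.\<close>

datatype ('v, 'e) cut_vertex = Uncut 'v | Cut 'v 'e

definition cut_graph :: "('v, 'e) ugraph \<Rightarrow> 'v set \<Rightarrow> (('v, 'e) cut_vertex, 'e) ugraph" where
  "cut_graph Y C =
    \<lparr>verts = Uncut ` (verts Y - C) \<union> {Cut v e |v e. v \<in> C \<and> e \<in> edges Y \<and> v \<in> ends Y e},
     edges = edges Y,
     ends = (\<lambda>e. (\<lambda>v. if v \<in> C then Cut v e else Uncut v) ` ends Y e)\<rparr>"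

primrec uncut :: "('v, 'e) cut_vertex \<Rightarrow> 'v" where
  "uncut (Uncut v) = v"
| "uncut (Cut v e) = v"


section \<open>The graphs attached to a subgroup, and lifts\<close>

type_synonym psl = "(int ^ 2 ^ 2) set"
type_synonym comb_vertex = "psl set + psl set"

text \<open>\<open>Inl\<close> marks the vertices of type (0), \<open>Inr\<close> those of type (1).\<close>

definition Y_comb :: "psl set \<Rightarrow> (comb_vertex, psl set) ugraph" where
  "Y_comb G =
    \<lparr>verts = (\<lambda>x. Inl (x <#>\<^bsub>PSL2Z\<^esub> G0)) ` (rcosets\<^bsub>PSL2Z\<^esub> G) \<union>
             (\<lambda>x. Inr (x <#>\<^bsub>PSL2Z\<^esub> G1)) ` (rcosets\<^bsub>PSL2Z\<^esub> G),
     edges = rcosets\<^bsub>PSL2Z\<^esub> G,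
     ends = (\<lambda>x. {Inl (x <#>\<^bsub>PSL2Z\<^esub> G0), Inr (x <#>\<^bsub>PSL2Z\<^esub> G1)})\<rparr>"

text \<open>The edges of \<open>TT\<close> are the singletons \<open>{g}\<close> with \<open>g \<in> carrier PSL2Z\<close>.\<close>

definition TT :: "(comb_vertex, psl set) ugraph" where
  "TT = Y_comb {\<one>\<^bsub>PSL2Z\<^esub>}"

definition proj_vert :: "psl set \<Rightarrow> comb_vertex \<Rightarrow> comb_vertex" where
  "proj_vert G = map_sum (\<lambda>D. G <#>\<^bsub>PSL2Z\<^esub> D) (\<lambda>D. G <#>\<^bsub>PSL2Z\<^esub> D)"

definition proj_edge :: "psl set \<Rightarrow> psl set \<Rightarrow> psl set" where
  "proj_edge G x = G <#>\<^bsub>PSL2Z\<^esub> x"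

text \<open>
  In what follows \<open>G\<close> is a subgroup, \<open>C\<close> the set of vertices of \<open>Y_comb G\<close> that are cut,
  and \<open>(jv, je)\<close> the lift of the resulting graph to \<open>TT\<close>.
\<close>

abbreviation Y_cut :: "psl set \<Rightarrow> comb_vertex set \<Rightarrow>
    ((comb_vertex, psl set) cut_vertex, psl set) ugraph" where
  "Y_cut G C \<equiv> cut_graph (Y_comb G) C"

definition is_lift :: "psl set \<Rightarrow> comb_vertex set \<Rightarrow>
    ((comb_vertex, psl set) cut_vertex \<Rightarrow> comb_vertex) \<Rightarrow> (psl set \<Rightarrow> psl set) \<Rightarrow> bool" where
  "is_lift G C jv je \<longleftrightarrow> graph_map (Y_cut G C) TT jv je \<and>
     (\<forall>V\<in>verts (Y_cut G C). proj_vert G (jv V) = uncut V) \<and>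
     (\<forall>e\<in>edges (Y_cut G C). proj_edge G (je e) = e)"


section \<open>The polygon, the involution and the side pairings\<close>

definition polygon :: "psl set \<Rightarrow> comb_vertex set \<Rightarrow> (psl set \<Rightarrow> psl set) \<Rightarrow> complex set" where
  "polygon G C je = (\<Union>g \<in> \<Union> (je ` edges (Y_cut G C)). act g ` Triangle)"

definition univalent_verts ::
    "psl set \<Rightarrow> comb_vertex set \<Rightarrow> (comb_vertex, psl set) cut_vertex set" where
  "univalent_verts G C = {V \<in> verts (Y_cut G C). valency (Y_cut G C) V = 1}"

definition elt_at :: "psl set \<Rightarrow> comb_vertex set \<Rightarrow> (psl set \<Rightarrow> psl set) \<Rightarrow>
    (comb_vertex, psl set) cut_vertex \<Rightarrow> psl" where
  "elt_at G C je V =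
    the_elem (je (THE e. e \<in> edges (Y_cut G C) \<and> V \<in> ends (Y_cut G C) e))"

text \<open>The sides attached to a univalent vertex; only vertices of type (0) are ever cut.\<close>

definition sides :: "psl set \<Rightarrow> comb_vertex set \<Rightarrow> (psl set \<Rightarrow> psl set) \<Rightarrow>
    (comb_vertex, psl set) cut_vertex \<Rightarrow> complex set set" where
  "sides G C je V = (let g = elt_at G C je V in
     case V of
       Cut W e \<Rightarrow> {act g ` int_0_inf}
     | Uncut (Inl D) \<Rightarrow> {act g ` int_i_0, act g ` int_i_inf}
     | Uncut (Inr D) \<Rightarrow> {act g ` int_rho_0, act g ` int_rho_inf})"

definition polygon_edges ::
    "psl set \<Rightarrow> comb_vertex set \<Rightarrow> (psl set \<Rightarrow> psl set) \<Rightarrow> complex set set" where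
  "polygon_edges G C je = (\<Union>V \<in> univalent_verts G C. sides G C je V)"

definition paired_sides :: "psl set \<Rightarrow> comb_vertex set \<Rightarrow> (psl set \<Rightarrow> psl set) \<Rightarrow>
    complex set \<Rightarrow> complex set \<Rightarrow> bool" where
  "paired_sides G C je s s' \<longleftrightarrow>
     (\<exists>W e e'. e \<noteq> e' \<and> Cut W e \<in> univalent_verts G C \<and> Cut W e' \<in> univalent_verts G C \<and>
        s \<in> sides G C je (Cut W e) \<and> s' \<in> sides G C je (Cut W e')) \<or>
     (\<exists>v. Uncut v \<in> univalent_verts G C \<and> s \<noteq> s' \<and>
        s \<in> sides G C je (Uncut v) \<and> s' \<in> sides G C je (Uncut v))"

definition side_inv :: "psl set \<Rightarrow> comb_vertex set \<Rightarrow> (psl set \<Rightarrow> psl set) \<Rightarrow>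
    complex set \<Rightarrow> complex set" where
  "side_inv G C je s = (THE s'. paired_sides G C je s s')"

text \<open>
  For the two sides \<open>s'\<close>, \<open>s''\<close> at a vertex of type (1), the unique element taking
  \<open>s''\<close> to \<open>s'\<close> is the inverse of the unique element taking \<open>s'\<close> to \<open>s''\<close>, so
  one clause covers both sides.
\<close>

definition side_elt :: "psl set \<Rightarrow> comb_vertex set \<Rightarrow> (psl set \<Rightarrow> psl set) \<Rightarrow>
    complex set \<Rightarrow> psl" where
  "side_elt G C je s = (THE h. h \<in> carrier PSL2Z \<and>
     ((\<exists>W e. Cut W e \<in> univalent_verts G C \<and> s \<in> sides G C je (Cut W e) \<and>
         act h ` s = side_inv G C je s \<and>
         reverses_orientation (polygon G C je) s (side_inv G C je s) h) \<or>
      (\<exists>D. Uncut (Inl D) \<in> univalent_verts G C \<and> s \<in> sides G C je (Uncut (Inl D)) \<and>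
         act h ` s = side_inv G C je s \<and> act h ` side_inv G C je s = s) \<or>
      (\<exists>D. Uncut (Inr D) \<in> univalent_verts G C \<and> s \<in> sides G C je (Uncut (Inr D)) \<and>
         act h ` s = side_inv G C je s)))"

end

theory Submission
  imports Defs
begin

text \<open>
  The lift identifies the edges of the cut graph with a right transversal \<open>D\<close> of \<open>G\<close> in the
  modular group. An edge \<open>g\<close> of the tree \<open>TT\<close> and an endpoint of \<open>g\<close> divide the other edges into
  those beyond the endpoint and those on the side of \<open>g\<close>; the triangles of \<open>g\<close> and of its side fill
  a half-plane (endpoint of type (0)) or a sector of angle \<open>2\<pi>/3\<close> (endpoint of type (1)). As \<open>D\<close> is
  connected through the uncut vertices, a group element outside \<open>D\<close> lies beyond exactly one
  univalent vertex, so the polygon is the intersection of the regions attached to the univalent vertices.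
  This gives its convexity and its boundary, and the local shape of these regions gives the angles.
  The element \<open>g\<^sub>s\<close> maps everything on the inner side of \<open>s\<close> beyond
  \<open>\<sigma> s\<close>. The parts beyond different vertices are disjoint, whence the ping-pong argument yields
  freeness, and pushing an edge that leaves \<open>D\<close> back by the \<open>g\<^sub>s\<close> yields generation.
\<close>

section \<open>The modular group\<close>

text \<open>Neither the free product structure of the modular group nor a normal form of words is
  assumed: that a reduced word is nontrivial and that the type of its first letter is determined are
  read off from where it carries the triangle. The polygon may have infinitely many sides.
  Closedness and convexity survive arbitrary intersections, but local finiteness of the sides has to
  come from the tessellation of the whole half-plane, that is, from reduction theory.
  \<open>side_inv\<close> and \<open>side_elt\<close> are definite descriptions, so each needs a
  uniqueness proof. An element carrying a side to a side moves a point of the triangle into the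
  triangle, which leaves, after translation, the identity and the letters. At a cut vertex both the
  identity and \<open>Sg\<close> remain, and only the orientation decides between them. Ping-pong is
  played on the group under left multiplication and not on the half-plane, so that no common
  boundaries of regions have to be discussed.\<close>

abbreviation mat2 :: "int \<Rightarrow> int \<Rightarrow> int \<Rightarrow> int \<Rightarrow> int ^ 2 ^ 2" where
  "mat2 a b c d \<equiv> vector [vector [a, b], vector [c, d]]"

lemma mat2_mult: "mat2 a b c d ** mat2 a' b' c' d' =
    mat2 (a * a' + b * c') (a * b' + b * d') (c * a' + d * c') (c * b' + d * d')"
  by (simp add: vec_eq_iff forall_2 matrix_matrix_mult_def sum_2)

lemma mat2_one: "mat 1 = mat2 1 0 0 1"
  by (simp add: vec_eq_iff forall_2 mat_def)

lemma mat2_minus: "- mat2 a b c d = mat2 (- a) (- b) (- c) (- d)"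
  by (simp add: vec_eq_iff forall_2)

lemma mat2_eta: "A = mat2 (A $ 1 $ 1) (A $ 1 $ 2) (A $ 2 $ 1) (A $ 2 $ 2)"
  by (simp add: vec_eq_iff forall_2)

lemma mat2_cases: obtains a b c d where "A = mat2 a b c d"
  using mat2_eta by blast

lemma det_mat2: "det (mat2 a b c d) = a * d - b * c"
  by (simp add: det_2)

lemma group_SL2Z: "group SL2Z"
proof (rule groupI)
  show "\<And>x y. x \<in> carrier SL2Z \<Longrightarrow> y \<in> carrier SL2Z \<Longrightarrow> x \<otimes>\<^bsub>SL2Z\<^esub> y \<in> carrier SL2Z"
    by (simp add: SL2Z_def det_mul)
  show "\<one>\<^bsub>SL2Z\<^esub> \<in> carrier SL2Z" by (simp add: SL2Z_def)
  show "\<And>x y z. x \<in> carrier SL2Z \<Longrightarrow> y \<in> carrier SL2Z \<Longrightarrow> z \<in> carrier SL2Z \<Longrightarrow>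
      x \<otimes>\<^bsub>SL2Z\<^esub> y \<otimes>\<^bsub>SL2Z\<^esub> z = x \<otimes>\<^bsub>SL2Z\<^esub> (y \<otimes>\<^bsub>SL2Z\<^esub> z)"
    by (simp add: SL2Z_def matrix_mul_assoc)
  show "\<And>x. x \<in> carrier SL2Z \<Longrightarrow> \<one>\<^bsub>SL2Z\<^esub> \<otimes>\<^bsub>SL2Z\<^esub> x = x" by (simp add: SL2Z_def)
  fix A assume "A \<in> carrier SL2Z"
  moreover obtain a b c d where "A = mat2 a b c d" by (rule mat2_cases)
  ultimately have A: "A = mat2 a b c d" "a * d - b * c = 1" by (auto simp: SL2Z_def det_mat2)
  show "\<exists>B\<in>carrier SL2Z. B \<otimes>\<^bsub>SL2Z\<^esub> A = \<one>\<^bsub>SL2Z\<^esub>"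
    using A(2) by (intro bexI[of _ "mat2 d (- b) (- c) a"])
      (simp_all add: SL2Z_def A(1) mat2_mult mat2_one det_mat2 algebra_simps)
qed

interpretation SL2Z: group SL2Z by (rule group_SL2Z)

lemma minus_mat_mult:
  fixes A B :: "int ^ 2 ^ 2"
  shows "(- A) ** B = - (A ** B)" "A ** (- B) = - (A ** B)"
  by (simp_all add: vec_eq_iff matrix_matrix_mult_def sum_negf)

lemma normal_center: "{mat 1, - mat 1} \<lhd> SL2Z"
proof (rule SL2Z.normalI)
  have sq: "(- mat 1) ** (- mat 1) = (mat 1 :: int ^ 2 ^ 2)" by (simp add: minus_mat_mult)
  have det: "det (- mat 1 :: int ^ 2 ^ 2) = 1" by (simp add: det_2 mat_def)
  show "subgroup {mat 1, - mat 1} SL2Z"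
  proof (rule SL2Z.subgroupI)
    show "{mat 1, - mat 1} \<subseteq> carrier SL2Z" using det by (simp add: SL2Z_def)
    fix x assume x: "x \<in> {mat 1, - mat 1 :: int ^ 2 ^ 2}"
    have "inv\<^bsub>SL2Z\<^esub> x = x"
      using x sq det by (intro SL2Z.inv_equality) (auto simp: SL2Z_def)
    then show "inv\<^bsub>SL2Z\<^esub> x \<in> {mat 1, - mat 1}" using x by simp
    fix y assume "y \<in> {mat 1, - mat 1 :: int ^ 2 ^ 2}"
    then show "x \<otimes>\<^bsub>SL2Z\<^esub> y \<in> {mat 1, - mat 1}"
      using x sq by (auto simp: SL2Z_def minus_mat_mult)
  qed auto
  show "\<forall>x\<in>carrier SL2Z. {mat 1, - mat 1} #>\<^bsub>SL2Z\<^esub> x = x <#\<^bsub>SL2Z\<^esub> {mat 1, - mat 1}"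
    by (simp add: r_coset_def l_coset_def SL2Z_def minus_mat_mult)
qed

lemma group_PSL2Z: "group PSL2Z"
  unfolding PSL2Z_def using normal.factorgroup_is_group[OF normal_center] .

interpretation PSL: group PSL2Z by (rule group_PSL2Z)

abbreviation "\<Gamma> \<equiv> carrier PSL2Z"
abbreviation "one_psl \<equiv> \<one>\<^bsub>PSL2Z\<^esub>"
abbreviation pinv :: "psl \<Rightarrow> psl" where "pinv x \<equiv> inv\<^bsub>PSL2Z\<^esub> x"
abbreviation mult_psl :: "psl \<Rightarrow> psl \<Rightarrow> psl" (infixl \<open>\<cdot>\<close> 70)
  where "x \<cdot> y \<equiv> x \<otimes>\<^bsub>PSL2Z\<^esub> y"

lemma psl_class_eq: "psl_class a b c d = {mat2 a b c d, mat2 (- a) (- b) (- c) (- d)}"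
  by (auto simp: psl_class_def r_coset_def SL2Z_def minus_mat_mult mat2_minus)

lemma psl_class_in_carrier: "a * d - b * c = 1 \<Longrightarrow> psl_class a b c d \<in> \<Gamma>"
  by (auto simp: PSL2Z_def carrier_FactGroup psl_class_def SL2Z_def det_mat2)

lemma PSL_cases:
  assumes "g \<in> \<Gamma>"
  obtains a b c d where "g = psl_class a b c d" "a * d - b * c = 1"
proof -
  obtain A where A: "A \<in> carrier SL2Z" "g = {mat 1, - mat 1} #>\<^bsub>SL2Z\<^esub> A"
    using assms by (auto simp: PSL2Z_def carrier_FactGroup)
  moreover obtain a b c d where "A = mat2 a b c d" by (rule mat2_cases)
  ultimately show ?thesis using that[of a b c d] by (auto simp: psl_class_def SL2Z_def det_mat2)
qed

lemma psl_class_mult: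
  assumes "a * d - b * c = 1" "a' * d' - b' * c' = 1"
  shows "psl_class a b c d \<cdot> psl_class a' b' c' d' =
    psl_class (a * a' + b * c') (a * b' + b * d') (c * a' + d * c') (c * b' + d * d')"
proof -
  have "mat2 a b c d \<in> carrier SL2Z" "mat2 a' b' c' d' \<in> carrier SL2Z"
    using assms by (auto simp: SL2Z_def det_mat2)
  then show ?thesis
    unfolding psl_class_def PSL2Z_def mult_FactGroup
    by (simp add: normal.rcos_sum[OF normal_center] flip: mat2_mult) (simp add: SL2Z_def)
qed

lemma psl_one: "one_psl = psl_class 1 0 0 1"
  by (auto simp: PSL2Z_def psl_class_eq mat2_one mat2_minus)

section \<open>The action by fractional linear maps\<close>

lemma act_psl_class:
  "act (psl_class a b c d) z = (of_int a * z + of_int b) / (of_int c * z + of_int d)"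
proof -
  have neg: "(- x) / (- y) = x / y" for x y :: complex by simp
  have "mobius (mat2 (- a) (- b) (- c) (- d)) z = mobius (mat2 a b c d) z"
    unfolding mobius_def using neg[of "of_int a * z + of_int b" "of_int c * z + of_int d"]
    by (simp add: algebra_simps)
  then have "act (psl_class a b c d) z = mobius (mat2 a b c d) z"
    unfolding act_def psl_class_eq by (intro the_equality) auto
  then show ?thesis by (simp add: mobius_def)
qed

lemma denom_nonzero:
  assumes "a * d - b * c = (1 :: int)" "z \<in> HH"
  shows "of_int c * z + of_int d \<noteq> 0"
proof
  assume 0: "of_int c * z + of_int d = 0"
  have "Im (of_int c * z + of_int d) = of_int c * Im z" by simp
  then have c: "c = 0" using 0 assms(2) by (auto simp: HH_def)
  then have "d = 0" using 0 by simp
  with c assms(1) show False by simp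
qed

lemma Im_act:
  assumes "a * d - b * c = (1 :: int)" "z \<in> HH"
  shows "Im (act (psl_class a b c d) z) = Im z / (cmod (of_int c * z + of_int d))\<^sup>2"
proof -
  have d: "real_of_int a * real_of_int d - real_of_int b * real_of_int c = 1"
    using assms(1) by (metis of_int_1 of_int_diff of_int_mult)
  have "Im (act (psl_class a b c d) z) =
     (real_of_int a * real_of_int d - real_of_int b * real_of_int c) * Im z /
       (cmod (of_int c * z + of_int d))\<^sup>2"
    unfolding act_psl_class Im_divide cmod_power2 by (simp add: algebra_simps)
  then show ?thesis using d by simp
qed

lemma act_in_HH: assumes "g \<in> \<Gamma>" "z \<in> HH" shows "act g z \<in> HH"
proof -
  obtain a b c d where g: "g = psl_class a b c d" "a * d - b * c = 1"
    using PSL_cases[OF assms(1)] by blast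
  show ?thesis
    using Im_act[OF g(2) assms(2)] denom_nonzero[OF g(2) assms(2)] assms(2)
    by (simp add: HH_def g)
qed

lemma act_mult:
  assumes "g \<in> \<Gamma>" "h \<in> \<Gamma>" "z \<in> HH"
  shows "act (g \<cdot> h) z = act g (act h z)"
proof -
  obtain a b c d where g: "g = psl_class a b c d" "a * d - b * c = 1"
    using PSL_cases[OF assms(1)] by blast
  obtain a' b' c' d' where h: "h = psl_class a' b' c' d'" "a' * d' - b' * c' = 1"
    using PSL_cases[OF assms(2)] by blast
  have nz: "of_int c' * z + of_int d' \<noteq> 0" by (rule denom_nonzero[OF h(2) assms(3)])
  have "(of_int a * (of_int a' * z + of_int b') + of_int b * (of_int c' * z + of_int d')) /
     (of_int c * (of_int a' * z + of_int b') + of_int d * (of_int c' * z + of_int d')) =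
     (of_int a * ((of_int a' * z + of_int b') / (of_int c' * z + of_int d')) + of_int b) /
     (of_int c * ((of_int a' * z + of_int b') / (of_int c' * z + of_int d')) + of_int d)"
    (is "?l1 / ?l2 = ?r1 / ?r2")
  proof -
    have "?l1 = ?r1 * (of_int c' * z + of_int d')" "?l2 = ?r2 * (of_int c' * z + of_int d')"
      using nz by (simp_all add: field_simps)
    then show ?thesis using nz by simp
  qed
  moreover have "of_int a * (of_int a' * z + of_int b') + of_int b * (of_int c' * z + of_int d')
      = of_int (a * a' + b * c') * z + of_int (a * b' + b * d')"
    "of_int c * (of_int a' * z + of_int b') + of_int d * (of_int c' * z + of_int d')
      = of_int (c * a' + d * c') * z + of_int (c * b' + d * d')"
    by (simp_all add: algebra_simps)
  ultimately show ?thesis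
    unfolding g h psl_class_mult[OF g(2) h(2)] act_psl_class by simp
qed

lemma act_one: "act one_psl z = z"
  by (simp add: psl_one act_psl_class)

lemma act_inv_act:
  assumes "g \<in> \<Gamma>" "z \<in> HH"
  shows "act (pinv g) (act g z) = z" "act g (act (pinv g) z) = z"
  using assms by (simp_all add: act_one flip: act_mult)

lemma act_inj:
  assumes "g \<in> \<Gamma>" "z \<in> HH" "w \<in> HH"
  shows "act g z = act g w \<longleftrightarrow> z = w"
  using act_inv_act(1) assms by metis

lemma act_image_mult:
  assumes "g \<in> \<Gamma>" "h \<in> \<Gamma>" "X \<subseteq> HH"
  shows "act (g \<cdot> h) ` X = act g ` act h ` X"
  using assms act_mult by (force simp: image_image intro!: image_cong)

lemma act_image_subset: "g \<in> \<Gamma> \<Longrightarrow> X \<subseteq> HH \<Longrightarrow> act g ` X \<subseteq> HH"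
  using act_in_HH by blast

lemma act_image_one: "act one_psl ` X = X"
  by (simp add: act_one)

lemma act_image_iff:
  assumes "g \<in> \<Gamma>" "X \<subseteq> HH" "z \<in> HH"
  shows "z \<in> act g ` X \<longleftrightarrow> act (pinv g) z \<in> X"
proof
  assume "z \<in> act g ` X"
  then show "act (pinv g) z \<in> X" using assms act_inv_act(1) by fastforce
next
  assume "act (pinv g) z \<in> X"
  then show "z \<in> act g ` X" using act_inv_act(2)[OF assms(1,3)] by (metis image_eqI)
qed

section \<open>The elements of order 2 and 3 as generators\<close>

abbreviation Sg :: psl where "Sg \<equiv> psl_class 0 (- 1) 1 0"
abbreviation Rg :: psl where "Rg \<equiv> psl_class 0 1 (- 1) 1"
abbreviation R2g :: psl where "R2g \<equiv> psl_class (- 1) 1 (- 1) 0"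

lemma psl_class_uminus: "psl_class (- a) (- b) (- c) (- d) = psl_class a b c d"
  by (auto simp: psl_class_eq)

lemma gens_in_carrier [simp]: "Sg \<in> \<Gamma>" "Rg \<in> \<Gamma>" "R2g \<in> \<Gamma>"
  by (auto intro!: psl_class_in_carrier)

lemma gens_mult [simp]:
  "Sg \<cdot> Sg = one_psl"
  "Rg \<cdot> Rg = R2g" "Rg \<cdot> R2g = one_psl"
  "R2g \<cdot> Rg = one_psl" "R2g \<cdot> R2g = Rg"
  using psl_class_uminus[of 1 0 0 1] psl_class_uminus[of 0 1 "- 1" 1]
  by (simp_all add: psl_class_mult psl_one)

lemma gens_inv [simp]:
  "pinv Sg = Sg" "pinv Rg = R2g" "pinv R2g = Rg"
  by (simp_all add: PSL.inv_equality)

lemma act_gens: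
  "act Sg z = - 1 / z" "act Rg z = 1 / (1 - z)" "act R2g z = 1 - 1 / z" if "z \<noteq> 0"
  using that by (simp_all add: act_psl_class field_simps)

text \<open>The Euclidean algorithm on the lower row: right multiplication by \<open>Sg\<close>
  exchanges the columns up to sign, and the translations by 1 and -1 are
  \<open>R2g \<cdot> Sg\<close> and \<open>Sg \<cdot> Rg\<close>. Letters are appended on the right
  because the edges \<open>x\<close> and \<open>x \<cdot> l\<close> of the tree share a vertex, so
  that this is induction along paths.\<close>

lemma PSL_right_induct [consumes 1, case_names one S R]:
  assumes "g \<in> \<Gamma>" "P one_psl"
    and S: "\<And>x. x \<in> \<Gamma> \<Longrightarrow> P x \<Longrightarrow> P (x \<cdot> Sg)"
    and R: "\<And>x. x \<in> \<Gamma> \<Longrightarrow> P x \<Longrightarrow> P (x \<cdot> Rg)"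
  shows "P g"
proof -
  have up: "P (psl_class a (b + a) c (d + c))"
    if "a * d - b * c = 1" "P (psl_class a b c d)" for a b c d
  proof -
    have "P (psl_class a b c d \<cdot> Rg \<cdot> Rg \<cdot> Sg)"
      using that by (intro S R) (auto simp: psl_class_in_carrier)
    moreover have "psl_class a b c d \<cdot> Rg \<cdot> Rg \<cdot> Sg
        = psl_class a b c d \<cdot> (R2g \<cdot> Sg)"
      using that(1) by (simp add: PSL.m_assoc psl_class_in_carrier)
    ultimately show ?thesis using that(1) by (simp add: psl_class_mult add.commute)
  qed
  have down: "P (psl_class a (b - a) c (d - c))"
    if "a * d - b * c = 1" "P (psl_class a b c d)" for a b c d
  proof -
    have "P (psl_class a b c d \<cdot> Sg \<cdot> Rg)"
      using that by (intro S R) (auto simp: psl_class_in_carrier)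
    moreover have "psl_class a b c d \<cdot> Sg \<cdot> Rg
        = psl_class a (b - a) c (d - c)"
      using that(1) by (simp add: PSL.m_assoc psl_class_in_carrier psl_class_mult)
    ultimately show ?thesis by simp
  qed
  have shift: "P (psl_class a (b + n * a) c (d + n * c))"
    if "a * d - b * c = 1" "P (psl_class a b c d)" for a b c d n
  proof (induction n rule: int_induct[where k = 0])
    case (step1 i)
    then show ?case using up[of a "d + i * c" "b + i * a" c] that(1) by (simp add: algebra_simps)
  next
    case (step2 i)
    then show ?case using down[of a "d + i * c" "b + i * a" c] that(1) by (simp add: algebra_simps)
  qed (use that in simp)
  have "\<forall>a b c d. nat \<bar>c\<bar> = n \<longrightarrow> a * d - b * c = 1 \<longrightarrow> P (psl_class a b c d)" for n
  proof (induction n rule: less_induct)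
    case (less n)
    show ?case
    proof (intro allI impI)
      fix a b c d :: int assume n: "nat \<bar>c\<bar> = n" and det: "a * d - b * c = 1"
      show "P (psl_class a b c d)"
      proof (cases "c = 0")
        case True
        \<comment> \<open>With lower left entry 0 the element is a translation.\<close>
        with det have "a * d = 1" by simp
        then have ad: "a = 1 \<and> d = 1 \<or> a = - 1 \<and> d = - 1" by (rule zmult_eq_1_iff[THEN iffD1])
        have "P (psl_class 1 (0 + n * 1) 0 (1 + n * 0))" for n
          using assms(2) by (intro shift) (simp_all add: psl_one)
        from this[of b] this[of "- b"] show ?thesis
          using ad True psl_class_uminus[of 1 "- b" 0 1] by auto
      next
        case False
        \<comment> \<open>Subtracting \<open>q\<close> times the first column from the second makes
          the lower right entry \<open>d mod c\<close>; after the exchange of the columns it is the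
          lower left entry, smaller than \<open>c\<close> in absolute value.\<close>
        define q where "q = d div c"
        have d': "d - q * c = d mod c" by (simp add: q_def minus_div_mult_eq_mod)
        have "nat \<bar>d mod c\<bar> < n"
          using False n by (metis abs_mod_less nat_less_eq_zless abs_ge_zero)
        moreover have "(b - q * a) * (- c) - (- a) * (d - q * c) = 1"
          using det by (simp add: algebra_simps)
        ultimately have "P (psl_class (b - q * a) (- a) (d - q * c) (- c))"
          using less[rule_format, of "nat \<bar>d - q * c\<bar>" "d - q * c" "b - q * a" "- c" "- a"] d' by simp
        then have "P (psl_class (b - q * a) (- a) (d - q * c) (- c) \<cdot> Sg)"
          using det by (intro S psl_class_in_carrier) (simp_all add: algebra_simps)
        also have "psl_class (b - q * a) (- a) (d - q * c) (- c) \<cdot> Sg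
            = psl_class (- a) (- (b - q * a)) (- c) (- (d - q * c))"
          using det by (subst psl_class_mult) (simp_all add: algebra_simps)
        finally have "P (psl_class a (b - q * a) c (d - q * c))" by (simp only: psl_class_uminus)
        then show ?thesis
          using shift[of a "d - q * c" "b - q * a" c q] det by (simp add: algebra_simps)
      qed
    qed
  qed
  moreover obtain a b c d where "g = psl_class a b c d" "a * d - b * c = 1"
    using PSL_cases[OF assms(1)] .
  ultimately show ?thesis by simp
qed


section \<open>Branches of the tree and the tessellation\<close>

text \<open>
  The types (0) and (1) of vertices are encoded as \<open>False\<close> and \<open>True\<close>. The letters of type
  \<open>t\<close> are the nontrivial elements of \<open>G0\<close> and \<open>G1\<close>, respectively, and \<open>branch t x\<close> says that the
  reduced word of \<open>x\<close> begins with a letter of type \<open>t\<close>, that is, the path in the tree from the edge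
  \<open>\<one>\<close> to the edge \<open>x\<close> leaves through the vertex of type \<open>t\<close>.
\<close>

primrec letters :: "bool \<Rightarrow> psl set" where
  "letters False = {Sg}"
| "letters True = {Rg, R2g}"

inductive branch :: "bool \<Rightarrow> psl \<Rightarrow> bool" where
  letter: "l \<in> letters t \<Longrightarrow> branch t l"
| step: "l \<in> letters t \<Longrightarrow> branch (\<not> t) x \<Longrightarrow> branch t (l \<cdot> x)"

lemma letters_carrier: "l \<in> letters t \<Longrightarrow> l \<in> \<Gamma>"
  by (cases t) auto

lemma letters_inv: "l \<in> letters t \<Longrightarrow> pinv l \<in> letters t"
  by (cases t) auto

lemma letters_mult:
  "l \<in> letters t \<Longrightarrow> m \<in> letters t \<Longrightarrow> l \<cdot> m = one_psl \<or> l \<cdot> m \<in> letters t"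
  by (cases t) auto

lemma branch_carrier: "branch t x \<Longrightarrow> x \<in> \<Gamma>"
  by (induction rule: branch.induct) (auto simp: letters_carrier)

text \<open>Appending a letter only affects the end of a reduced word, so the type of the first
  letter is lost only when the word is a single letter and this letter is cancelled.\<close>

lemma branch_mult_letter:
  "branch t x \<Longrightarrow> l \<in> letters u \<Longrightarrow>
    branch t (x \<cdot> l) \<or> u = t \<and> x \<cdot> l = one_psl"
proof (induction rule: branch.induct)
  case (letter m t)
  then show ?case
    by (cases "u = t") (auto intro: branch.intros dest: letters_mult)
next
  case (step m t x)
  note c = letters_carrier[OF step.hyps(1)] letters_carrier[OF step.prems]
    branch_carrier[OF step.hyps(2)]
  from step.IH[OF step.prems] show ?case
  proof (elim disjE conjE)
    assume "branch (\<not> t) (x \<cdot> l)"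
    then show ?thesis using branch.step[OF step.hyps(1)] c by (simp add: PSL.m_assoc)
  next
    assume "x \<cdot> l = one_psl"
    then show ?thesis using branch.letter[OF step.hyps(1)] c by (simp add: PSL.m_assoc)
  qed
qed

lemma branch_cover:
  "x \<in> \<Gamma> \<Longrightarrow> x = one_psl \<or> branch False x \<or> branch True x"
proof (induction rule: PSL_right_induct)
  case (S x)
  have "Sg \<in> letters False" by simp
  from branch_mult_letter[OF _ this] branch.letter[OF this] S show ?case by auto
next
  case (R x)
  have "Rg \<in> letters True" by simp
  from branch_mult_letter[OF _ this] branch.letter[OF this] R show ?case by auto
qed simp

text \<open>The regions on the near side of the two vertices of the edge \<open>one_psl\<close>: the
  half-plane to the right of the geodesic from 0 to infinity, and the region with corner rho bounded
  by \<open>int_rho_0\<close> and \<open>int_rho_inf\<close>. The images of \<open>sector t\<close>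
  under the letters of type \<open>t\<close> fill the rest of \<open>HH\<close>.\<close>

primrec sector :: "bool \<Rightarrow> complex set" where
  "sector False = {z \<in> HH. 0 \<le> Re z}"
| "sector True = {z \<in> HH. Re z \<le> 1/2 \<and> cmod (z - 1) \<ge> 1}"

primrec side_at :: "bool \<Rightarrow> complex set" where
  "side_at False = int_0_inf"
| "side_at True = int_rho_0 \<union> int_rho_inf"

section \<open>Images of the sectors under the letters\<close>

lemma cmod_le_1_iff: "cmod z \<le> 1 \<longleftrightarrow> (Re z)\<^sup>2 + (Im z)\<^sup>2 \<le> 1"
  by (simp add: cmod_def)

lemma cmod_ge_1_iff: "1 \<le> cmod z \<longleftrightarrow> 1 \<le> (Re z)\<^sup>2 + (Im z)\<^sup>2"
  by (simp add: cmod_def)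

lemma cmod_minus_1_ge_iff: "1 \<le> cmod (z - 1) \<longleftrightarrow> 2 * Re z \<le> (Re z)\<^sup>2 + (Im z)\<^sup>2"
  by (simp add: cmod_ge_1_iff power2_eq_square algebra_simps)

lemma cmod_minus_1_le_iff: "cmod (z - 1) \<le> 1 \<longleftrightarrow> (Re z)\<^sup>2 + (Im z)\<^sup>2 \<le> 2 * Re z"
  by (simp add: cmod_le_1_iff power2_eq_square algebra_simps)

lemma Triangle_eq: "Triangle = sector False \<inter> sector True"
  by (auto simp: Triangle_def)

lemma sector_subset_HH: "sector t \<subseteq> HH" by (cases t) auto
lemma Triangle_subset_HH: "Triangle \<subseteq> HH" by (auto simp: Triangle_def)
lemma Triangle_subset_sector: "Triangle \<subseteq> sector t" by (cases t) (auto simp: Triangle_eq)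

lemma HH_nonzero: "z \<in> HH \<Longrightarrow> z \<noteq> 0" "z \<in> HH \<Longrightarrow> 1 - z \<noteq> 0" "z \<in> HH \<Longrightarrow> 0 < (Re z)\<^sup>2 + (Im z)\<^sup>2"
  "z \<in> HH \<Longrightarrow> 0 < (1 - Re z)\<^sup>2 + (Im z)\<^sup>2"
  by (auto simp: HH_def complex_eq_iff sum_power2_gt_zero_iff)

lemma Re_act_gens:
  assumes "z \<in> HH"
  shows "Re (act Sg z) = - Re z / ((Re z)\<^sup>2 + (Im z)\<^sup>2)"
    "Re (act Rg z) = (1 - Re z) / ((1 - Re z)\<^sup>2 + (Im z)\<^sup>2)"
    "Re (act R2g z) = 1 - Re z / ((Re z)\<^sup>2 + (Im z)\<^sup>2)"
  using HH_nonzero[OF assms] by (simp_all add: act_gens Re_divide)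

lemma Im_act_gens:
  assumes "z \<in> HH"
  shows "Im (act Sg z) = Im z / ((Re z)\<^sup>2 + (Im z)\<^sup>2)"
    "Im (act Rg z) = Im z / ((1 - Re z)\<^sup>2 + (Im z)\<^sup>2)"
    "Im (act R2g z) = Im z / ((Re z)\<^sup>2 + (Im z)\<^sup>2)"
  using HH_nonzero[OF assms] by (simp_all add: act_gens Im_divide)

text \<open>The circle of radius 1 around 1 is the only curved boundary of a sector. Its preimages
  under the three letters are two vertical lines and the unit circle, which gives the images of the
  sectors once membership is tested with the inverse letter.\<close>

lemma cmod_act_minus_1:
  assumes "z \<in> HH"
  shows "1 \<le> cmod (act Sg z - 1) \<longleftrightarrow> - 1 / 2 \<le> Re z"
    "1 \<le> cmod (act Rg z - 1) \<longleftrightarrow> 1 / 2 \<le> Re z"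
    "1 \<le> cmod (act R2g z - 1) \<longleftrightarrow> cmod z \<le> 1"
proof -
  note nz = HH_nonzero[OF assms]
  have "act Sg z - 1 = - ((z + 1) / z)" using nz by (simp add: act_gens field_simps)
  then have "cmod (act Sg z - 1) = cmod (z + 1) / cmod z"
    by (simp only: norm_minus_cancel norm_divide)
  moreover have "act Rg z - 1 = z / (1 - z)" "act R2g z - 1 = - 1 / z"
    using nz by (simp_all add: act_gens field_simps)
  moreover have "1 \<le> cmod (z + 1) / cmod z \<longleftrightarrow> - 1 / 2 \<le> Re z"
  proof -
    have "1 \<le> cmod (z + 1) / cmod z \<longleftrightarrow> cmod z \<le> cmod (z + 1)" using nz by (simp add: field_simps)
    also have "\<dots> \<longleftrightarrow> (cmod z)\<^sup>2 \<le> (cmod (z + 1))\<^sup>2" by simp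
    also have "\<dots> \<longleftrightarrow> - 1 / 2 \<le> Re z" unfolding cmod_power2 by (simp add: power2_eq_square algebra_simps) linarith
    finally show ?thesis .
  qed
  moreover have "1 \<le> cmod z / cmod (1 - z) \<longleftrightarrow> 1 / 2 \<le> Re z"
  proof -
    have "1 \<le> cmod z / cmod (1 - z) \<longleftrightarrow> cmod (1 - z) \<le> cmod z" using nz by (simp add: field_simps)
    also have "\<dots> \<longleftrightarrow> (cmod (1 - z))\<^sup>2 \<le> (cmod z)\<^sup>2" by simp
    also have "\<dots> \<longleftrightarrow> 1 / 2 \<le> Re z" unfolding cmod_power2 by (simp add: power2_eq_square algebra_simps)
    finally show ?thesis .
  qed
  ultimately show "1 \<le> cmod (act Sg z - 1) \<longleftrightarrow> - 1 / 2 \<le> Re z"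
    "1 \<le> cmod (act Rg z - 1) \<longleftrightarrow> 1 / 2 \<le> Re z"
    "1 \<le> cmod (act R2g z - 1) \<longleftrightarrow> cmod z \<le> 1"
    using nz by (simp_all add: norm_divide norm_mult)
qed

lemma image_gens:
  assumes "X \<subseteq> HH" "z \<in> HH"
  shows "z \<in> act Sg ` X \<longleftrightarrow> act Sg z \<in> X" "z \<in> act Rg ` X \<longleftrightarrow> act R2g z \<in> X"
    "z \<in> act R2g ` X \<longleftrightarrow> act Rg z \<in> X"
  using act_image_iff[OF _ assms] by auto

lemma Sg_sector: "act Sg ` sector False = {z \<in> HH. Re z \<le> 0}"
proof -
  have "z \<in> act Sg ` sector False \<longleftrightarrow> Re z \<le> 0" if "z \<in> HH" for z
    using that HH_nonzero[OF that] act_in_HH[of Sg z]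
    by (simp add: image_gens Re_act_gens zero_le_divide_iff divide_le_0_iff
         sector_subset_HH[of False, simplified])
  then show ?thesis using act_image_subset[OF gens_in_carrier(1) sector_subset_HH] by blast
qed

lemma Rg_sector: "act Rg ` sector True = {z \<in> HH. cmod (z - 1) \<le> 1 \<and> cmod z \<le> 1}"
proof -
  have "z \<in> act Rg ` sector True \<longleftrightarrow> cmod (z - 1) \<le> 1 \<and> cmod z \<le> 1" if "z \<in> HH" for z
    using that HH_nonzero[OF that] act_in_HH[of R2g z]
    by (simp add: image_gens Re_act_gens cmod_act_minus_1 sector_subset_HH[of True, simplified]
        cmod_minus_1_le_iff) (simp add: field_simps)
  then show ?thesis using act_image_subset[OF gens_in_carrier(2) sector_subset_HH] by blast
qed

lemma R2g_sector: "act R2g ` sector True = {z \<in> HH. 1 / 2 \<le> Re z \<and> 1 \<le> cmod z}"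
proof -
  have "z \<in> act R2g ` sector True \<longleftrightarrow> 1 / 2 \<le> Re z \<and> 1 \<le> cmod z" if "z \<in> HH" for z
    using that HH_nonzero[OF that] act_in_HH[of Rg z]
    by (simp add: image_gens Re_act_gens cmod_act_minus_1 sector_subset_HH[of True, simplified])
        (auto simp add: cmod_ge_1_iff[of z] field_simps power2_eq_square)
  then show ?thesis using act_image_subset[OF gens_in_carrier(3) sector_subset_HH] by blast
qed

text \<open>The nesting that drives the induction over words: letters of alternating types keep the
  triangle inside a sector, so that the first letter alone decides where it ends up.\<close>

lemma letter_sector_subset:
  assumes "l \<in> letters (\<not> t)" shows "act l ` sector (\<not> t) \<subseteq> sector t"
proof (cases t)
  case True
  have "2 * Re z \<le> (Re z)\<^sup>2 + (Im z)\<^sup>2" if "Re z \<le> 0" for z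
    using that sum_power2_ge_zero[of "Re z" "Im z"] by linarith
  then show ?thesis using assms True by (auto simp: Sg_sector cmod_minus_1_ge_iff simp del: sector.simps(1))
next
  case False
  have "0 \<le> Re z" if "cmod (z - 1) \<le> 1" for z
    using that abs_Re_le_cmod[of "z - 1"] by simp
  then have "act Rg ` sector True \<subseteq> sector False" "act R2g ` sector True \<subseteq> sector False"
    unfolding Rg_sector R2g_sector by auto
  then show ?thesis using assms False by (auto simp del: sector.simps)
qed

lemma letter_sector_Int:
  assumes "l \<in> letters t" shows "act l ` sector t \<inter> sector t \<subseteq> side_at t"
proof (cases t)
  case False
  then show ?thesis using assms by (auto simp: Sg_sector int_0_inf_def simp del: sector.simps(1)) simp
next
  case True
  have 1: "act Rg ` sector True \<inter> sector True \<subseteq> int_rho_0"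
    unfolding Rg_sector by (auto simp: int_rho_0_def)
  have 2: "act R2g ` sector True \<inter> sector True \<subseteq> int_rho_inf"
  proof
    fix z assume "z \<in> act R2g ` sector True \<inter> sector True"
    then have z: "z \<in> HH" "Re z = 1 / 2" "1 \<le> cmod z" unfolding R2g_sector by auto
    \<comment> \<open>On the line Re z = 1/2 the condition \<open>1 \<le> cmod z\<close> cuts off
      exactly the part below rho.\<close>
    then have "3 / 4 \<le> (Im z)\<^sup>2" using z(3) unfolding cmod_ge_1_iff z(2) by (simp add: power2_eq_square)
    then have "sqrt (3 / 4) \<le> Im z" using z(1) real_le_lsqrt[of "Im z" "3/4"]
      by (simp add: HH_def real_le_lsqrt)
    then show "z \<in> int_rho_inf" using z by (simp add: int_rho_inf_def real_sqrt_divide)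
  qed
  show ?thesis using assms True 1 2 by (auto simp del: sector.simps)
qed

text \<open>The closed regions come together only at the ideal points 0 and infinity, which do not
  belong to \<open>HH\<close>.\<close>

lemma letter_sectors_disjoint:
  assumes "l \<in> letters t" "m \<in> letters (\<not> t)"
  shows "act l ` sector t \<inter> act m ` sector (\<not> t) = {}"
proof -
  have "False" if "z \<in> HH" "Re z \<le> 0" "cmod (z - 1) \<le> 1" for z
  proof -
    have "0 < (Re z)\<^sup>2 + (Im z)\<^sup>2" using HH_nonzero[OF that(1)] by simp
    then show False using that by (simp add: cmod_minus_1_le_iff)
  qed
  then have "act Sg ` sector False \<inter> act Rg ` sector True = {}"
    "act Sg ` sector False \<inter> act R2g ` sector True = {}"
    unfolding Sg_sector Rg_sector R2g_sector by fastforce+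
  then show ?thesis using assms by (cases t) (auto simp del: sector.simps)
qed

lemma side_at_subset: "side_at t \<subseteq> Triangle"
proof (cases t)
  case False
  then show ?thesis by (auto simp: int_0_inf_def Triangle_def cmod_minus_1_ge_iff)
next
  case True
  have "int_rho_0 \<subseteq> Triangle"
  proof
    fix z assume "z \<in> int_rho_0"
    then show "z \<in> Triangle"
      using abs_Re_le_cmod[of "z - 1"] by (auto simp: int_rho_0_def Triangle_def)
  qed
  moreover have "int_rho_inf \<subseteq> Triangle"
  proof
    fix z assume z: "z \<in> int_rho_inf"
    then have "3 / 4 \<le> (Im z)\<^sup>2"
      using power_mono[of "sqrt 3 / 2" "Im z" 2] by (simp add: int_rho_inf_def power_divide)
    moreover have half: "Re z = 1 / 2" using z by (simp add: int_rho_inf_def)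
    moreover have "(Re z)\<^sup>2 = 1 / 4" unfolding half by (simp add: power2_eq_square)
    ultimately show "z \<in> Triangle"
      using z by (simp add: int_rho_inf_def Triangle_def cmod_minus_1_ge_iff)
  qed
  ultimately show ?thesis using True by simp
qed

text \<open>This turns statements about first letters into statements about regions; the region does
  not depend on the rest of the word.\<close>

lemma branch_Triangle: "branch t x \<Longrightarrow> \<exists>l\<in>letters t. act x ` Triangle \<subseteq> act l ` sector t"
proof (induction rule: branch.induct)
  case (letter l t)
  then show ?case using Triangle_subset_sector[of t] by blast
next
  case (step l t x)
  then obtain m where m: "m \<in> letters (\<not> t)" "act x ` Triangle \<subseteq> act m ` sector (\<not> t)" by blast
  then have "act x ` Triangle \<subseteq> sector t" using letter_sector_subset by blast
  then have "act (l \<cdot> x) ` Triangle \<subseteq> act l ` sector t"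
    using step.hyps by (simp add: act_image_mult letters_carrier branch_carrier Triangle_subset_HH image_mono)
  then show ?case using step.hyps(1) by blast
qed

text \<open>A point of the triangle off all its sides, to witness that two regions overlap in more
  than a common side.\<close>

definition Triangle_pt :: complex where "Triangle_pt = Complex (1/4) 1"

lemma Triangle_pt: "Triangle_pt \<in> Triangle" "Triangle_pt \<notin> side_at t"
proof -
  have n: "(cmod (Triangle_pt - 1))\<^sup>2 = 25 / 16"
    unfolding cmod_power2 by (simp add: Triangle_pt_def power2_eq_square)
  then have "cmod (Triangle_pt - 1) \<noteq> 1" by auto
  then show "Triangle_pt \<notin> side_at t"
    by (cases t) (auto simp: Triangle_pt_def int_rho_0_def int_rho_inf_def int_0_inf_def)
  show "Triangle_pt \<in> Triangle"
    by (auto simp: Triangle_def HH_def cmod_minus_1_ge_iff) (auto simp: Triangle_pt_def power2_eq_square)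
qed

text \<open>Otherwise the triangle would lie in an image of its own sector and hence in
  \<open>side_at t\<close>. Together with \<open>branch_disjoint\<close> this does the work of the
  uniqueness of reduced words.\<close>

lemma not_branch_one: "\<not> branch t one_psl"
proof
  assume "branch t one_psl"
  then obtain l where "l \<in> letters t" "Triangle \<subseteq> act l ` sector t"
    using branch_Triangle[of t "one_psl"] by (auto simp: act_image_one)
  then have "Triangle_pt \<in> side_at t"
    using Triangle_pt(1) Triangle_subset_sector[of t] letter_sector_Int[of l t] by blast
  then show False using Triangle_pt(2) by blast
qed

lemma branch_disjoint: "branch t x \<Longrightarrow> \<not> branch (\<not> t) x"
proof
  assume "branch t x" "branch (\<not> t) x"
  then obtain l m where "l \<in> letters t" "m \<in> letters (\<not> t)"
    "act x ` Triangle \<subseteq> act l ` sector t" "act x ` Triangle \<subseteq> act m ` sector (\<not> t)"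
    using branch_Triangle by metis
  then show False using letter_sectors_disjoint[of l t m] Triangle_pt(1) by blast
qed

lemma not_branch_cases:
  "x \<in> \<Gamma> \<Longrightarrow> \<not> branch t x \<longleftrightarrow> x = one_psl \<or> branch (\<not> t) x"
  using branch_cover[of x] not_branch_one[of t] branch_disjoint[of True x] branch_disjoint[of False x]
  by (cases t) auto

lemma branch_letter_iff: "l \<in> letters u \<Longrightarrow> branch t l \<longleftrightarrow> t = u"
  using branch.letter[of l u] branch_disjoint[of u l] by (cases "t = u") auto

text \<open>In terms of the tree: the only way into the branch at a vertex leads through that vertex.\<close>

lemma branch_enter:
  assumes "x \<in> \<Gamma>" "\<not> branch t x" "branch t (x \<cdot> l)" "l \<in> letters u"
  shows "x = one_psl \<and> u = t"
proof -
  have "x = one_psl"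
    using assms not_branch_cases[of x t] branch_mult_letter[of "\<not> t" x l u]
      branch_disjoint not_branch_one by metis
  then show ?thesis using assms branch_letter_iff letters_carrier by auto
qed

text \<open>For \<open>x = pinv g \<cdot> h\<close> this says that the part beyond the vertex
  \<open>t\<close> of \<open>g\<close> and the part beyond the vertex \<open>u\<close> of
  \<open>h\<close> are disjoint, if neither edge lies beyond the vertex of the other. A path inside
  the second part could enter the first one only from the edge \<open>g\<close> itself, which is
  \<open>y = pinv x\<close> seen from \<open>h\<close> and is not beyond \<open>u\<close>; and a
  path entering both parts at once would force \<open>x = one_psl\<close> and
  \<open>t = u\<close>.\<close>

lemma branch_mult:
  assumes x: "x \<in> \<Gamma>" "\<not> branch t x" "\<not> branch u (pinv x)"
    and "x \<noteq> one_psl \<or> t \<noteq> u" "branch u y"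
  shows "\<not> branch t (x \<cdot> y)"
proof -
  have step: "branch u (y \<cdot> l) \<longrightarrow> \<not> branch t (x \<cdot> (y \<cdot> l))"
    if y: "y \<in> \<Gamma>" "branch u y \<longrightarrow> \<not> branch t (x \<cdot> y)" and l: "l \<in> letters v" for y l v
  proof (intro impI notI)
    assume b: "branch u (y \<cdot> l)" "branch t (x \<cdot> (y \<cdot> l))"
    have b2: "branch t (x \<cdot> y \<cdot> l)"
      using b(2) x(1) y(1) letters_carrier[OF l] by (simp add: PSL.m_assoc)
    show False
    proof (cases "branch u y")
      case True
      then have "x \<cdot> y = one_psl"
        using branch_enter[OF _ _ b2 l] x y by simp
      then have "pinv x = y" using x(1) y(1) PSL.inv_equality PSL.inv_comm by metis
      then show False using True x(3) by simp
    next
      case False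
      then have "y = one_psl" "v = u" using branch_enter[OF y(1) _ b(1) l] by simp_all
      then show False using branch_enter[OF x(1,2) _ l] b2 x(1) assms(4) by auto
    qed
  qed
  have "y \<in> \<Gamma>" using assms(5) by (rule branch_carrier)
  then have "branch u y \<longrightarrow> \<not> branch t (x \<cdot> y)"
  proof (induction rule: PSL_right_induct)
    case (S y)
    then show ?case using step[of y Sg False] by simp
  next
    case (R y)
    then show ?case using step[of y Rg True] by simp
  qed (simp add: not_branch_one)
  then show ?thesis using assms(5) by simp
qed

text \<open>If \<open>x\<close> begins with \<open>l\<close> and has a second letter, applying
  \<open>pinv l\<close> to the common point puts it into images of sectors under letters of
  different types, which are disjoint. So \<open>x\<close> is a single letter, and the sectors of
  \<open>l\<close> and of the identity meet only in the sides.\<close>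

lemma Triangle_meets:
  assumes x: "x \<in> \<Gamma>" and z: "z \<in> act x ` Triangle" "z \<in> Triangle"
  shows "x = one_psl \<or> (\<exists>t. x \<in> letters t \<and> z \<in> side_at t)"
proof (cases "x = one_psl")
  case False
  then obtain t where b: "branch t x" using branch_cover[OF x] by blast
  then have "x \<in> letters t"
  proof cases
    case (step l y)
    note c = letters_carrier[OF step(2)]
    obtain m where m: "m \<in> letters (\<not> t)" "act y ` Triangle \<subseteq> act m ` sector (\<not> t)"
      using branch_Triangle[OF step(3)] by blast
    obtain w where w: "w \<in> act y ` Triangle" "z = act l w"
      using z(1) step c by (auto simp: act_image_mult branch_carrier Triangle_subset_HH)
    moreover have "act y ` Triangle \<subseteq> HH"
      using step(3) by (intro act_image_subset Triangle_subset_HH branch_carrier)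
    ultimately have "w = act (pinv l) z" using c act_inv_act(1)[of l w] by auto
    then have "w \<in> act (pinv l) ` sector t" using z(2) Triangle_subset_sector[of t] by blast
    then show ?thesis using w(1) m letter_sectors_disjoint[OF letters_inv[OF step(2)] m(1)] by blast
  qed
  moreover have "z \<in> side_at t"
    using letter_sector_Int[OF \<open>x \<in> letters t\<close>] z Triangle_subset_sector[of t] by blast
  ultimately show ?thesis by blast
qed simp

section \<open>Reduction theory: the triangles cover the half-plane\<close>

lemma finite_small_denominators:
  assumes "0 < Im z"
  shows "finite {(c, d). cmod (of_int c * z + of_int d) \<le> 1}"
proof -
  \<comment> \<open>The imaginary part \<open>c * Im z\<close> of the denominator bounds
    \<open>c\<close>; after that \<open>d\<close>, which differs from the denominator by
    \<open>c * z\<close>, is bounded too.\<close>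
  define B where "B = \<lceil>1 / Im z\<rceil>"
  define N where "N = \<lceil>1 + of_int B * cmod z\<rceil>"
  have "\<bar>c\<bar> \<le> B \<and> \<bar>d\<bar> \<le> N" if "cmod (of_int c * z + of_int d) \<le> 1" for c d
  proof
    have "\<bar>of_int c\<bar> * Im z = \<bar>Im (of_int c * z + of_int d)\<bar>" using assms by (simp add: abs_mult)
    also have "\<dots> \<le> 1" using that abs_Im_le_cmod order_trans by blast
    finally have "\<bar>real_of_int c\<bar> \<le> 1 / Im z" using assms by (simp add: field_simps)
    then show c: "\<bar>c\<bar> \<le> B" unfolding B_def by linarith
    have "\<bar>real_of_int d\<bar> = cmod (of_int c * z + of_int d - of_int c * z)" by simp
    also have "\<dots> \<le> 1 + \<bar>of_int c\<bar> * cmod z" using norm_triangle_ineq4[of "of_int c * z + of_int d" "of_int c * z"] that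
      by (simp add: norm_mult)
    also have "\<dots> \<le> 1 + of_int B * cmod z" using c by (intro add_left_mono mult_right_mono) (auto simp flip: of_int_abs)
    finally show "\<bar>d\<bar> \<le> N" unfolding N_def by linarith
  qed
  then have "{(c, d). cmod (of_int c * z + of_int d) \<le> 1} \<subseteq> {-B..B} \<times> {-N..N}" by force
  then show ?thesis by (rule finite_subset) simp
qed

text \<open>The translate of \<open>z\<close> of maximal imaginary part, shifted into the strip of
  width 1 about the imaginary axis, lies in the classical fundamental domain with |Re w| \<le> 1/2
  and |w| \<ge> 1. The right half of this domain lies in \<open>Triangle\<close>, and
  \<open>Sg\<close> brings the left half there.\<close>

lemma tessellation:
  assumes "z \<in> HH"
  obtains g w where "g \<in> \<Gamma>" "w \<in> Triangle" "z = act g w"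
proof -
  \<comment> \<open>The lower rows of matrices of determinant 1, whose smallest denominator gives
    the largest imaginary part. As (0, 1) has denominator 1, it suffices to compare the finitely
    many rows with denominator at most 1.\<close>
  define F where "F = {(c, d). cmod (of_int c * z + of_int d) \<le> 1 \<and> (\<exists>a b. a * d - b * c = 1)}"
  define f where "f = (\<lambda>(c, d). cmod (of_int c * z + of_int d))"
  have "finite F" using finite_small_denominators[of z] assms
    by (rule_tac finite_subset[rotated]) (auto simp: F_def HH_def)
  moreover have 01: "(0, 1) \<in> F" unfolding F_def using exI[of _ 1] by auto
  ultimately obtain c d where cd: "(c, d) \<in> F" "\<And>p. p \<in> F \<Longrightarrow> f (c, d) \<le> f p"
    using ex_min_if_finite[of "f ` F"]
    by (metis (no_types, lifting) arg_min_if_finite(1) arg_min_least emptyE prod.exhaust)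
  then obtain a b where det: "a * d - b * c = 1" by (auto simp: F_def)
  have min: "cmod (of_int c * z + of_int d) \<le> cmod (of_int c' * z + of_int d')"
    if "a' * d' - b' * c' = 1" for a' b' c' d' :: int
  proof (cases "(c', d') \<in> F")
    case False
    then have "1 < cmod (of_int c' * z + of_int d')" using that by (auto simp: F_def)
    moreover have "cmod (of_int c * z + of_int d) \<le> 1" using cd(1) by (simp add: F_def)
    ultimately show ?thesis by simp
  qed (use cd(2)[of "(c', d')"] in \<open>simp add: f_def\<close>)
  define g where "g = psl_class a b c d"
  have g: "g \<in> \<Gamma>" unfolding g_def by (rule psl_class_in_carrier[OF det])
  have max: "Im (act h z) \<le> Im (act g z)" if h: "h \<in> \<Gamma>" for h
  proof -
    obtain a' b' c' d' where h: "h = psl_class a' b' c' d'" "a' * d' - b' * c' = 1"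
      using PSL_cases[OF h] .
    have "0 < cmod (of_int c * z + of_int d)" using denom_nonzero[OF det assms] by simp
    then have "Im z / (cmod (of_int c' * z + of_int d'))\<^sup>2 \<le> Im z / (cmod (of_int c * z + of_int d))\<^sup>2"
      using min[OF h(2)] assms
      by (intro divide_left_mono power_mono mult_pos_pos zero_less_power) (auto simp: HH_def)
    then show ?thesis by (simp add: h(1) g_def Im_act[OF h(2) assms] Im_act[OF det assms])
  qed
  define n where "n = - round (Re (act g z))"
  define w where "w = act (psl_class 1 n 0 1) (act g z)"
  have T: "psl_class 1 n 0 1 \<in> \<Gamma>" by (simp add: psl_class_in_carrier)
  define h where "h = psl_class 1 n 0 1 \<cdot> g"
  have h: "h \<in> \<Gamma>" using T g by (simp add: h_def)
  have wh: "w = act h z" using T g assms by (simp add: h_def w_def act_mult)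
  then have w: "w \<in> HH" using h assms by (simp add: act_in_HH)
  have w_eq: "w = act g z + of_int n" by (simp add: w_def act_psl_class)
  have Re_w: "\<bar>Re w\<bar> \<le> 1 / 2"
    using of_int_round_abs_le[of "Re (act g z)"] unfolding w_eq n_def by (simp add: abs_minus_commute)
  \<comment> \<open>Maximality is tested against \<open>Sg\<close>: it forbids that \<open>w\<close>
    lies inside the unit circle.\<close>
  have "Im (act (Sg \<cdot> h) z) \<le> Im w" using max[of "Sg \<cdot> h"] h by (simp add: w_eq)
  then have "Im w / ((Re w)\<^sup>2 + (Im w)\<^sup>2) \<le> Im w"
    using h w assms by (simp add: act_mult Im_act_gens flip: wh)
  then have ge1: "1 \<le> (Re w)\<^sup>2 + (Im w)\<^sup>2"
    using w unfolding pos_divide_le_eq[OF HH_nonzero(3)[OF w]]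
    by (metis HH_def mem_Collect_eq mult.right_neutral mult_le_cancel_left_pos)
  show ?thesis
  proof (cases "0 \<le> Re w")
    case True
    have "w \<in> Triangle" using True Re_w ge1 w by (auto simp: Triangle_def cmod_minus_1_ge_iff)
    moreover have "z = act (pinv h) w" using wh h assms by (simp add: act_inv_act)
    ultimately show ?thesis using that[of "pinv h" w] h by simp
  next
    case False
    have "act Sg w \<in> Triangle"
      using False Re_w ge1 w HH_nonzero(3)[OF w] act_in_HH[OF gens_in_carrier(1) w]
      by (auto simp: Triangle_def cmod_act_minus_1 Re_act_gens field_simps)
    moreover have "z = act (pinv h \<cdot> Sg) (act Sg w)"
    proof -
      have "act Sg (act Sg w) = w" using act_inv_act(1)[OF gens_in_carrier(1) w] by simp
      then have "act (pinv h \<cdot> Sg) (act Sg w) = act (pinv h) w"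
        using h w by (simp add: act_mult act_in_HH)
      then show ?thesis using wh h assms by (simp add: act_inv_act)
    qed
    ultimately show ?thesis
      using that[of "pinv h \<cdot> Sg" "act Sg w"] h by simp
  qed
qed


section \<open>Hyperbolic convexity and geodesic intervals\<close>

text \<open>Comes from \<open>cosh (2 * x) = 1 + 2 * (sinh x)^2\<close> with \<open>x\<close> half
  the distance. Half the distance is preferred because its hyperbolic sine and cosine are quotients
  without squares, to which the addition theorem can be applied.\<close>

lemma hyp_dist_arsinh:
  assumes "z \<in> HH" "w \<in> HH"
  shows "hyp_dist z w = 2 * arsinh (cmod (z - w) / (2 * sqrt (Im z * Im w)))"
proof -
  define x where "x = cmod (z - w) / (2 * sqrt (Im z * Im w))"
  have pos: "0 < Im z * Im w" using assms by (simp add: HH_def)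
  have "0 \<le> x" using pos by (simp add: x_def)
  have "1 + (cmod (z - w))\<^sup>2 / (2 * Im z * Im w) = 1 + 2 * x\<^sup>2"
    using pos by (simp add: x_def power_divide power_mult_distrib)
  also have "\<dots> = cosh (2 * arsinh x)"
    by (simp only: cosh_double cosh_square_eq) simp
  finally have "hyp_dist z w = arcosh (cosh (2 * arsinh x))"
    by (simp add: hyp_dist_def)
  also have "0 \<le> sinh (arsinh x)" using \<open>0 \<le> x\<close> by (simp only: sinh_arsinh_real)
  then have "0 \<le> arsinh x" by (rule sinh_real_nonneg_iff[THEN iffD1])
  then have "arcosh (cosh (2 * arsinh x)) = 2 * arsinh x" by (intro arcosh_cosh_real) simp
  finally show ?thesis by (simp add: x_def)
qed

lemma sinh_half_hyp_dist:
  assumes "z \<in> HH" "w \<in> HH"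
  shows "sinh (hyp_dist z w / 2) = cmod (z - w) / (2 * sqrt (Im z * Im w))"
  by (simp add: hyp_dist_arsinh[OF assms])

lemma cosh_half_hyp_dist:
  assumes "z \<in> HH" "w \<in> HH"
  shows "cosh (hyp_dist z w / 2) = cmod (z - cnj w) / (2 * sqrt (Im z * Im w))"
proof -
  have pos: "0 < Im z * Im w" using assms by (simp add: HH_def)
  have "(cosh (hyp_dist z w / 2))\<^sup>2 = 1 + (cmod (z - w))\<^sup>2 / (4 * (Im z * Im w))"
    using pos by (simp add: cosh_square_eq sinh_half_hyp_dist[OF assms] power_divide power_mult_distrib)
  also have "\<dots> = (4 * (Im z * Im w) + (cmod (z - w))\<^sup>2) / (4 * (Im z * Im w))"
    using pos assms by (simp add: add_divide_distrib HH_def)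
  also have "4 * (Im z * Im w) + (cmod (z - w))\<^sup>2 = (cmod (z - cnj w))\<^sup>2"
    unfolding cmod_power2 by (simp add: power2_eq_square algebra_simps)
  also have "(cmod (z - cnj w))\<^sup>2 / (4 * (Im z * Im w)) = (cmod (z - cnj w) / (2 * sqrt (Im z * Im w)))\<^sup>2"
    using pos by (simp add: power_divide power_mult_distrib)
  finally show ?thesis using pos by (simp add: power2_eq_iff_nonneg)
qed

lemma hyp_dist_commute: "hyp_dist z w = hyp_dist w z"
  by (simp add: hyp_dist_def norm_minus_commute mult_ac)

text \<open>The triangle inequality is Ptolemy's inequality for the points \<open>z\<close>, \<open>p\<close>, \<open>w\<close>, \<open>cnj p\<close>.\<close>

lemma hyp_dist_triangle:
  assumes "z \<in> HH" "p \<in> HH" "w \<in> HH"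
  shows "hyp_dist z w \<le> hyp_dist z p + hyp_dist p w"
proof -
  have pos: "0 < Im z" "0 < Im p" "0 < Im w" using assms by (simp_all add: HH_def)
  have "(z - w) * (p - cnj p) = (z - cnj p) * (p - w) - (z - p) * (cnj p - w)"
    by (simp add: algebra_simps)
  then have "cmod (z - w) * cmod (p - cnj p) \<le> cmod (z - cnj p) * cmod (p - w) + cmod (z - p) * cmod (cnj p - w)"
    by (metis norm_mult norm_triangle_ineq4)
  moreover have "cmod (p - cnj p) = 2 * Im p" using pos by (simp add: complex_diff_cnj norm_mult)
  moreover have "cmod (cnj p - w) = cmod (p - cnj w)"
    by (metis complex_cnj_cnj complex_cnj_diff complex_mod_cnj)
  ultimately have *: "cmod (z - w) * (2 * Im p) \<le> cmod (z - p) * cmod (p - cnj w) + cmod (z - cnj p) * cmod (p - w)"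
    by (simp add: mult.commute)
  let ?q = "4 * Im p * sqrt (Im z * Im w)"
  have q: "2 * sqrt (Im z * Im p) * (2 * sqrt (Im p * Im w)) = ?q"
    using pos by (simp add: real_sqrt_mult mult_ac)
  have "sinh (hyp_dist z w / 2) = cmod (z - w) * (2 * Im p) / ?q"
    using pos by (simp add: sinh_half_hyp_dist assms)
  also have "\<dots> \<le> (cmod (z - p) * cmod (p - cnj w) + cmod (z - cnj p) * cmod (p - w)) / ?q"
    using * pos by (intro divide_right_mono) auto
  also have "\<dots> = sinh (hyp_dist z p / 2) * cosh (hyp_dist p w / 2) + cosh (hyp_dist z p / 2) * sinh (hyp_dist p w / 2)"
    unfolding sinh_half_hyp_dist[OF assms(1,2)] sinh_half_hyp_dist[OF assms(2,3)]
      cosh_half_hyp_dist[OF assms(1,2)] cosh_half_hyp_dist[OF assms(2,3)] q[symmetric]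
    by (simp add: add_divide_distrib)
  also have "\<dots> = sinh ((hyp_dist z p + hyp_dist p w) / 2)"
    by (simp add: sinh_add add_divide_distrib)
  finally show ?thesis by simp
qed

lemma hyp_dist_less:
  assumes "z \<in> HH" "p \<in> HH" "q \<in> HH" "Im p = Im q" "cmod (z - p) < cmod (z - q)"
  shows "hyp_dist z p < hyp_dist z q"
proof -
  have "0 < Im z * Im q" using assms by (simp add: HH_def)
  then have "sinh (hyp_dist z p / 2) < sinh (hyp_dist z q / 2)"
    unfolding sinh_half_hyp_dist[OF assms(1,2)] sinh_half_hyp_dist[OF assms(1,3)] assms(4)
    using assms(5) by (intro divide_strict_right_mono) auto
  then show ?thesis by simp
qed

lemma hyp_dist_act:
  assumes "g \<in> \<Gamma>" "z \<in> HH" "w \<in> HH"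
  shows "hyp_dist (act g z) (act g w) = hyp_dist z w"
proof -
  obtain a b c d where g: "g = psl_class a b c d" "a * d - b * c = 1"
    using PSL_cases[OF assms(1)] .
  let ?z = "of_int c * z + of_int d" and ?w = "of_int c * w + of_int d"
  have nz: "?z \<noteq> 0" "?w \<noteq> 0" using denom_nonzero[OF g(2)] assms by auto
  have det: "complex_of_int a * of_int d - of_int b * of_int c = 1"
    using g(2) by (metis of_int_1 of_int_diff of_int_mult)
  have "act g z - act g w = ((of_int a * z + of_int b) * ?w - (of_int a * w + of_int b) * ?z) / (?z * ?w)"
    using nz by (simp add: g act_psl_class diff_frac_eq)
  also have "(of_int a * z + of_int b) * ?w - (of_int a * w + of_int b) * ?z =
      (complex_of_int a * of_int d - of_int b * of_int c) * (z - w)"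
    by (simp add: algebra_simps)
  finally have "act g z - act g w = (z - w) / (?z * ?w)" by (simp add: det)
  then have "(cmod (act g z - act g w))\<^sup>2 = (cmod (z - w))\<^sup>2 / ((cmod ?z)\<^sup>2 * (cmod ?w)\<^sup>2)"
    by (simp add: norm_divide norm_mult power_divide power_mult_distrib)
  moreover have "2 * Im (act g z) * Im (act g w) = 2 * Im z * Im w / ((cmod ?z)\<^sup>2 * (cmod ?w)\<^sup>2)"
    unfolding g(1) Im_act[OF g(2) assms(2)] Im_act[OF g(2) assms(3)] by simp
  ultimately show ?thesis unfolding hyp_dist_def using nz by simp
qed

lemma hyp_segment_act:
  assumes "g \<in> \<Gamma>" "z \<in> HH" "w \<in> HH"
  shows "hyp_segment (act g z) (act g w) = act g ` hyp_segment z w"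
proof -
  have "p \<in> hyp_segment (act g z) (act g w) \<longleftrightarrow> act (pinv g) p \<in> hyp_segment z w" if "p \<in> HH" for p
    using hyp_dist_act[OF assms(1), of z "act (pinv g) p"]
      hyp_dist_act[OF assms(1), of "act (pinv g) p" w] assms that
    by (simp add: hyp_segment_def act_in_HH act_inv_act hyp_dist_act)
  note * = this
  have sub: "hyp_segment z w \<subseteq> HH" "hyp_segment (act g z) (act g w) \<subseteq> HH"
    by (auto simp: hyp_segment_def)
  have "p \<in> hyp_segment (act g z) (act g w) \<longleftrightarrow> p \<in> act g ` hyp_segment z w" for p
  proof (cases "p \<in> HH")
    case True
    then show ?thesis using * act_image_iff[OF assms(1) sub(1)] by simp
  next
    case False
    then show ?thesis using sub act_image_subset[OF assms(1) sub(1)] by auto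
  qed
  then show ?thesis by blast
qed

lemma hyp_convex_act:
  assumes "g \<in> \<Gamma>" "hyp_convex X"
  shows "hyp_convex (act g ` X)"
  unfolding hyp_convex_def
proof (intro conjI ballI)
  have X: "X \<subseteq> HH" using assms(2) by (simp add: hyp_convex_def)
  then show "act g ` X \<subseteq> HH" by (rule act_image_subset[OF assms(1)])
  fix z w assume "z \<in> act g ` X" "w \<in> act g ` X"
  then obtain z' w' where zw: "z' \<in> X" "z = act g z'" "w' \<in> X" "w = act g w'" by blast
  then have "z' \<in> HH" "w' \<in> HH" using X by auto
  then have "hyp_segment z w = act g ` hyp_segment z' w'" using hyp_segment_act assms(1) zw by simp
  moreover have "hyp_segment z' w' \<subseteq> X" using assms(2) zw by (simp add: hyp_convex_def)
  ultimately show "hyp_segment z w \<subseteq> act g ` X" by (simp add: image_mono)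
qed

lemma hyp_convex_Int: "hyp_convex X \<Longrightarrow> hyp_convex Y \<Longrightarrow> hyp_convex (X \<inter> Y)"
  unfolding hyp_convex_def by blast

text \<open>The factor \<open>HH\<close> covers the empty family as well, which occurs when the
  polygon has no edges.\<close>

lemma hyp_convex_Inter: "(\<And>X. X \<in> \<X> \<Longrightarrow> hyp_convex X) \<Longrightarrow> hyp_convex (HH \<inter> \<Inter>\<X>)"
  unfolding hyp_convex_def
proof (intro conjI ballI Int_greatest Inter_greatest)
  fix z w X assume "\<And>X. X \<in> \<X> \<Longrightarrow> X \<subseteq> HH \<and> (\<forall>z\<in>X. \<forall>w\<in>X. hyp_segment z w \<subseteq> X)"
    "z \<in> HH \<inter> \<Inter>\<X>" "w \<in> HH \<inter> \<Inter>\<X>" "X \<in> \<X>"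
  then show "hyp_segment z w \<subseteq> X" by (meson IntE InterD)
qed (auto simp: hyp_segment_def)

text \<open>Projecting a point \<open>p\<close> beyond the boundary line horizontally onto that line strictly decreases
  its distance to both ends, so \<open>p\<close> cannot lie on the segment.\<close>

lemma hyp_convex_halfplane:
  assumes "\<bar>s\<bar> = (1 :: real)"
  shows "hyp_convex {z \<in> HH. 0 \<le> s * (Re z - c)}"
  unfolding hyp_convex_def
proof (intro conjI ballI subsetI)
  fix z w p assume z: "z \<in> {z \<in> HH. 0 \<le> s * (Re z - c)}" and w: "w \<in> {z \<in> HH. 0 \<le> s * (Re z - c)}"
    and "p \<in> hyp_segment z w"
  then have p: "p \<in> HH" "hyp_dist z p + hyp_dist p w = hyp_dist z w" by (auto simp: hyp_segment_def)
  have "0 \<le> s * (Re p - c)"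
  proof (rule ccontr)
    assume neg: "\<not> 0 \<le> s * (Re p - c)"
    define q where "q = Complex c (Im p)"
    have q: "q \<in> HH" "Im q = Im p" using p(1) by (simp_all add: q_def HH_def)
    have "cmod (x - q) < cmod (x - p)" if "0 \<le> s * (Re x - c)" for x
    proof -
      have "\<bar>Re x - c\<bar> < \<bar>Re x - Re p\<bar>" using that neg assms by (cases "0 \<le> s") (auto simp: abs_if split: if_splits)
      then have "(Re x - c)\<^sup>2 < (Re x - Re p)\<^sup>2"
        using power_strict_mono[of "\<bar>Re x - c\<bar>" "\<bar>Re x - Re p\<bar>" 2] by simp
      then show ?thesis by (simp add: cmod_def q_def)
    qed
    then have "hyp_dist z q < hyp_dist z p" "hyp_dist w q < hyp_dist w p"
      using z w p(1) q by (auto intro!: hyp_dist_less)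
    then have "hyp_dist z q + hyp_dist q w < hyp_dist z w" using p(2) by (simp add: hyp_dist_commute)
    then show False using hyp_dist_triangle[of z q w] z w q by simp
  qed
  then show "p \<in> {z \<in> HH. 0 \<le> s * (Re z - c)}" using p(1) by simp
qed auto

text \<open>The circular boundary is moved to a vertical one by an isometry, so that convexity has
  to be proved by hand for vertical boundaries only.\<close>

lemma outside_unit_circle_eq: "{z \<in> HH. 1 \<le> cmod (z - 1)} = act Rg ` {z \<in> HH. 1 / 2 \<le> Re z}"
proof -
  have "1 \<le> cmod (z - 1) \<longleftrightarrow> z \<in> act Rg ` {z \<in> HH. 1 / 2 \<le> Re z}" if "z \<in> HH" for z
    using that HH_nonzero(3)[OF that]
    by (subst image_gens) (auto simp: Re_act_gens cmod_minus_1_ge_iff act_in_HH field_simps)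
  then show ?thesis using act_image_subset[OF gens_in_carrier(2), of "{z \<in> HH. 1 / 2 \<le> Re z}"] by blast
qed

lemma hyp_convex_sector: "hyp_convex (sector t)"
proof (cases t)
  case False
  then show ?thesis using hyp_convex_halfplane[of 1 0] by simp
next
  case True
  have "sector True = {z \<in> HH. 0 \<le> (- 1) * (Re z - 1 / 2)} \<inter> {z \<in> HH. 1 \<le> cmod (z - 1)}"
    by auto
  also have "hyp_convex \<dots>"
    unfolding outside_unit_circle_eq
    using hyp_convex_halfplane[of 1 "1 / 2"] hyp_convex_halfplane[of "- 1" "1 / 2"]
    by (intro hyp_convex_Int hyp_convex_act) auto
  finally show ?thesis using True by simp
qed

section \<open>The base intervals as geodesics\<close>

abbreviation rho :: complex where "rho \<equiv> Complex (1 / 2) (sqrt 3 / 2)"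

lemma HH_points [simp]: "\<i> \<in> HH" "rho \<in> HH" by (simp_all add: HH_def)

text \<open>The exponential function parametrises vertical lines by arc length.\<close>

lemma hyp_dist_vertical: "hyp_dist (Complex x (exp t)) (Complex x (exp u)) = \<bar>t - u\<bar>"
proof -
  have "1 + (exp t - exp u)\<^sup>2 / (2 * exp t * exp u) = cosh \<bar>t - u\<bar>"
    by (simp add: cosh_field_def exp_diff exp_minus field_simps power2_eq_square abs_if)
  moreover have "(cmod (Complex x (exp t) - Complex x (exp u)))\<^sup>2 = (exp t - exp u)\<^sup>2"
    by (simp add: cmod_power2)
  ultimately show ?thesis unfolding hyp_dist_def using arcosh_cosh_real[of "\<bar>t - u\<bar>"] by simp
qed

lemma geodesic_interval_act:
  assumes g: "g \<in> \<Gamma>" and s: "geodesic_interval s"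
  shows "geodesic_interval (act g ` s)"
proof -
  obtain I \<gamma> where I: "s \<subseteq> HH" "is_interval I" "closed I" "interior I \<noteq> {}" "s = \<gamma> ` I"
    "\<forall>t\<in>I. \<forall>u\<in>I. hyp_dist (\<gamma> t) (\<gamma> u) = \<bar>t - u\<bar>"
    using s by (auto simp: geodesic_interval_def)
  have "\<forall>t\<in>I. \<forall>u\<in>I. hyp_dist (act g (\<gamma> t)) (act g (\<gamma> u)) = \<bar>t - u\<bar>"
    using I hyp_dist_act[OF g] by (metis image_subset_iff)
  then show ?thesis unfolding geodesic_interval_def
    using I act_image_subset[OF g I(1)]
    by (intro conjI exI[of _ I] exI[of _ "act g \<circ> \<gamma>"]) (auto simp: image_comp)
qed

lemma geodesic_endpoints_act:
  assumes g: "g \<in> \<Gamma>" and s: "s \<subseteq> HH" and p: "p \<in> geodesic_endpoints s"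
  shows "act g p \<in> geodesic_endpoints (act g ` s)"
proof -
  have False if "a \<in> s" "b \<in> s" "act g a \<noteq> act g p" "act g b \<noteq> act g p"
      "act g p \<in> hyp_segment (act g a) (act g b)" for a b
  proof -
    have "p \<in> HH" "a \<in> HH" "b \<in> HH" using p s that by (auto simp: geodesic_endpoints_def)
    then have "p \<in> hyp_segment a b"
      using that(5) g by (simp add: hyp_segment_def hyp_dist_act)
    then show False using p that by (auto simp: geodesic_endpoints_def)
  qed
  then show ?thesis using p unfolding geodesic_endpoints_def by blast
qed

lemma vertical_eq: "{z \<in> HH. Re z = x \<and> Im z \<ge> exp t0} = (\<lambda>t. Complex x (exp t)) ` {t0..}"
proof
  show "{z \<in> HH. Re z = x \<and> Im z \<ge> exp t0} \<subseteq> (\<lambda>t. Complex x (exp t)) ` {t0..}"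
  proof
    fix z assume z: "z \<in> {z \<in> HH. Re z = x \<and> Im z \<ge> exp t0}"
    then have "z = Complex x (exp (ln (Im z)))" by (simp add: HH_def complex_eq_iff)
    moreover have "t0 \<le> ln (Im z)" using z by (simp add: HH_def ln_ge_iff)
    ultimately show "z \<in> (\<lambda>t. Complex x (exp t)) ` {t0..}" by blast
  qed
qed (auto simp: HH_def)

lemma geodesic_vertical_ray:
  "geodesic_interval {z \<in> HH. Re z = x \<and> Im z \<ge> exp t0}" (is "geodesic_interval ?s")
  "Complex x (exp t0) \<in> geodesic_endpoints {z \<in> HH. Re z = x \<and> Im z \<ge> exp t0}"
proof -
  show "geodesic_interval ?s"
    unfolding geodesic_interval_def using vertical_eq[of x t0]
    by (intro conjI exI[of _ "{t0..}"] exI[of _ "\<lambda>t. Complex x (exp t)"])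
      (auto simp: hyp_dist_vertical interior_Ici[of "t0 - 1"])
  have "\<not> (\<exists>a\<in>?s. \<exists>b\<in>?s. a \<noteq> Complex x (exp t0) \<and> b \<noteq> Complex x (exp t0) \<and>
      Complex x (exp t0) \<in> hyp_segment a b)"
    unfolding vertical_eq by (auto simp: hyp_segment_def hyp_dist_vertical)
  then show "Complex x (exp t0) \<in> geodesic_endpoints ?s"
    by (simp add: geodesic_endpoints_def HH_def)
qed

lemma int_i_inf_props: "geodesic_interval int_i_inf" "\<i> \<in> geodesic_endpoints int_i_inf"
proof -
  have *: "int_i_inf = {z \<in> HH. Re z = 0 \<and> Im z \<ge> exp 0}" "\<i> = Complex 0 (exp 0)"
    by (auto simp: int_i_inf_def complex_eq_iff)
  show "geodesic_interval int_i_inf" unfolding * by (rule geodesic_vertical_ray)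
  show "\<i> \<in> geodesic_endpoints int_i_inf" unfolding * by (rule geodesic_vertical_ray)
qed

lemma int_rho_inf_props: "geodesic_interval int_rho_inf" "rho \<in> geodesic_endpoints int_rho_inf"
proof -
  have *: "int_rho_inf = {z \<in> HH. Re z = 1 / 2 \<and> Im z \<ge> exp (ln (sqrt 3 / 2))}"
    "rho = Complex (1 / 2) (exp (ln (sqrt 3 / 2)))"
    by (auto simp: int_rho_inf_def complex_eq_iff)
  show "geodesic_interval int_rho_inf" unfolding *(1) by (rule geodesic_vertical_ray)
  show "rho \<in> geodesic_endpoints int_rho_inf" unfolding * by (rule geodesic_vertical_ray)
qed

lemma geodesic_int_0_inf: "geodesic_interval int_0_inf"
proof -
  have "int_0_inf = range (\<lambda>t. Complex 0 (exp t))"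
  proof
    show "int_0_inf \<subseteq> range (\<lambda>t. Complex 0 (exp t))"
    proof
      fix z assume "z \<in> int_0_inf"
      then have "z = Complex 0 (exp (ln (Im z)))" by (simp add: HH_def int_0_inf_def complex_eq_iff)
      then show "z \<in> range (\<lambda>t. Complex 0 (exp t))" by blast
    qed
  qed (auto simp: HH_def int_0_inf_def)
  moreover have "int_0_inf \<subseteq> HH" by (auto simp: int_0_inf_def)
  ultimately show ?thesis
    unfolding geodesic_interval_def
    by (intro conjI exI[of _ UNIV] exI[of _ "\<lambda>t. Complex 0 (exp t)"])
      (simp_all add: hyp_dist_vertical is_interval_univ)
qed

lemma int_subset_HH: "int_0_inf \<subseteq> HH" "int_i_0 \<subseteq> HH" "int_i_inf \<subseteq> HH" "int_rho_0 \<subseteq> HH" "int_rho_inf \<subseteq> HH"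
  by (auto simp: int_0_inf_def int_i_0_def int_i_inf_def int_rho_0_def int_rho_inf_def)

lemma act_Sg_int_0_inf: "act Sg ` int_0_inf = int_0_inf"
proof -
  have "z \<in> act Sg ` int_0_inf \<longleftrightarrow> z \<in> int_0_inf" if "z \<in> HH" for z
    using that HH_nonzero[OF that]
    by (subst image_gens) (auto simp: int_0_inf_def Re_act_gens act_in_HH)
  then show ?thesis using act_image_subset[OF gens_in_carrier(1) int_subset_HH(1)] int_subset_HH by blast
qed

lemma act_Sg_int_i_inf: "act Sg ` int_i_inf = int_i_0"
proof -
  have "z \<in> act Sg ` int_i_inf \<longleftrightarrow> z \<in> int_i_0" if "z \<in> HH" for z
  proof -
    have "1 \<le> Im z / (Im z)\<^sup>2 \<longleftrightarrow> Im z \<le> 1" using that by (simp add: HH_def power2_eq_square)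
    then show ?thesis using that HH_nonzero[OF that]
      by (subst image_gens) (auto simp: int_i_inf_def int_i_0_def Re_act_gens Im_act_gens act_in_HH)
  qed
  then show ?thesis using act_image_subset[OF gens_in_carrier(1) int_subset_HH(3)] int_subset_HH by blast
qed

lemma act_Sg_int_i_0: "act Sg ` int_i_0 = int_i_inf"
  using act_image_mult[of Sg Sg int_i_inf] int_subset_HH by (simp add: act_image_one flip: act_Sg_int_i_inf)

lemma act_Rg_int_rho_inf: "act Rg ` int_rho_inf = int_rho_0"
proof -
  have "z \<in> act Rg ` int_rho_inf \<longleftrightarrow> z \<in> int_rho_0" if z: "z \<in> HH" for z
  proof -
    define N where "N = (Re z)\<^sup>2 + (Im z)\<^sup>2"
    have N: "0 < N" using HH_nonzero[OF z] by (simp add: N_def)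
    have "z \<in> act Rg ` int_rho_inf \<longleftrightarrow> 1 - Re z / N = 1 / 2 \<and> sqrt 3 / 2 \<le> Im z / N"
      using z by (subst image_gens) (auto simp: int_rho_inf_def int_subset_HH Re_act_gens Im_act_gens act_in_HH N_def)
    also have "1 - Re z / N = 1 / 2 \<longleftrightarrow> N = 2 * Re z" using N by (auto simp: field_simps)
    also have "N = 2 * Re z \<longleftrightarrow> cmod (z - 1) = 1"
      using cmod_minus_1_ge_iff[of z] cmod_minus_1_le_iff[of z] unfolding N_def by linarith
    finally have 1: "z \<in> act Rg ` int_rho_inf \<longleftrightarrow> cmod (z - 1) = 1 \<and> sqrt 3 / 2 \<le> Im z / N" .
    \<comment> \<open>On the circle \<open>N\<close> equals 2 Re z, so after squaring the bound on
      the height turns into the linear condition that \<open>z\<close> is not to the right of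
      rho.\<close>
    have "sqrt 3 / 2 \<le> Im z / N \<longleftrightarrow> Re z \<le> 1 / 2" if "cmod (z - 1) = 1"
    proof -
      have N2: "N = 2 * Re z" using that cmod_minus_1_ge_iff[of z] cmod_minus_1_le_iff[of z]
        unfolding N_def by linarith
      then have Re: "0 < Re z" using N by simp
      have Im2: "(Im z)\<^sup>2 = 2 * Re z - (Re z)\<^sup>2" using N2 unfolding N_def by linarith
      have "sqrt 3 / 2 \<le> Im z / N \<longleftrightarrow> sqrt 3 * Re z \<le> Im z" using Re N2 by (simp add: field_simps)
      also have "\<dots> \<longleftrightarrow> (sqrt 3 * Re z)\<^sup>2 \<le> (Im z)\<^sup>2"
        using Re z by (simp add: HH_def flip: abs_le_square_iff)
      also have "\<dots> \<longleftrightarrow> Re z * (2 * Re z) \<le> Re z * 1" unfolding Im2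
        by (simp only: power_mult_distrib real_sqrt_pow2 zero_le_numeral) (simp only: power2_eq_square, linarith)
      also have "\<dots> \<longleftrightarrow> Re z \<le> 1 / 2" unfolding mult_le_cancel_left_pos[OF Re] by linarith
      finally show ?thesis .
    qed
    then show ?thesis unfolding 1 using z by (auto simp: int_rho_0_def)
  qed
  then show ?thesis using act_image_subset[OF gens_in_carrier(2) int_subset_HH(5)] int_subset_HH by blast
qed

lemma act_R2g_int_rho_0: "act R2g ` int_rho_0 = int_rho_inf"
  using act_image_mult[of R2g Rg int_rho_inf] int_subset_HH by (simp add: act_image_one flip: act_Rg_int_rho_inf)

lemma act_Sg_i: "act Sg \<i> = \<i>"
  by (simp add: act_gens)

lemma act_Rg_rho: "act Rg rho = rho"
  using act_in_HH[OF gens_in_carrier(2) HH_points(2)]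
  by (intro complex_eqI) (simp_all add: Re_act_gens Im_act_gens power_divide field_simps)

lemma int_i_0_props: "geodesic_interval int_i_0" "\<i> \<in> geodesic_endpoints int_i_0"
  using geodesic_interval_act[OF gens_in_carrier(1) int_i_inf_props(1)]
    geodesic_endpoints_act[OF gens_in_carrier(1) int_subset_HH(3) int_i_inf_props(2)]
  by (simp_all add: act_Sg_int_i_inf act_Sg_i)

lemma int_rho_0_props: "geodesic_interval int_rho_0" "rho \<in> geodesic_endpoints int_rho_0"
  using geodesic_interval_act[OF gens_in_carrier(2) int_rho_inf_props(1)]
    geodesic_endpoints_act[OF gens_in_carrier(2) int_subset_HH(5) int_rho_inf_props(2)]
  by (simp_all add: act_Rg_int_rho_inf act_Rg_rho)

lemma int_i_Int: "int_i_0 \<inter> int_i_inf = {\<i>}"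
  by (auto simp: int_i_0_def int_i_inf_def complex_eq_iff HH_def)

lemma int_rho_Int: "int_rho_0 \<inter> int_rho_inf = {rho}"
proof
  show "int_rho_0 \<inter> int_rho_inf \<subseteq> {rho}"
  proof
    fix z assume "z \<in> int_rho_0 \<inter> int_rho_inf"
    then have z: "z \<in> HH" "cmod (z - 1) = 1" "Re z = 1 / 2" by (auto simp: int_rho_0_def int_rho_inf_def)
    then have "(Re z)\<^sup>2 + (Im z)\<^sup>2 = 2 * Re z"
      using cmod_minus_1_ge_iff[of z] cmod_minus_1_le_iff[of z] by linarith
    then have "(Im z)\<^sup>2 = 3 / 4" unfolding z(3) by (simp add: power2_eq_square)
    then have "Im z = sqrt (3 / 4)" using z(1) by (simp add: HH_def real_sqrt_unique[symmetric])
    then show "z \<in> {rho}" using z by (simp add: complex_eq_iff real_sqrt_divide)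
  qed
  show "{rho} \<subseteq> int_rho_0 \<inter> int_rho_inf"
    using int_rho_0_props(2) int_rho_inf_props(2) by (simp add: geodesic_endpoints_def)
qed

section \<open>Derivatives and openness of the action\<close>

lemma open_HH: "open HH" unfolding HH_def by (rule open_halfspace_Im_gt)

lemma act_deriv:
  assumes "g \<in> \<Gamma>" "z \<in> HH"
  obtains c where "c \<noteq> 0" "(act g has_field_derivative c) (at z)"
proof -
  obtain a b c d where g: "g = psl_class a b c d" "a * d - b * c = 1"
    using PSL_cases[OF assms(1)] .
  have nz: "of_int c * z + of_int d \<noteq> 0" using denom_nonzero[OF g(2) assms(2)] .
  have det: "complex_of_int a * of_int d - of_int b * of_int c = 1"
    using g(2) by (metis of_int_1 of_int_diff of_int_mult)
  have "act g = (\<lambda>z. (of_int a * z + of_int b) / (of_int c * z + of_int d))"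
    by (simp add: fun_eq_iff g act_psl_class)
  moreover have "((\<lambda>z. (of_int a * z + of_int b) / (of_int c * z + of_int d)) has_field_derivative
     (of_int a * (of_int c * z + of_int d) - (of_int a * z + of_int b) * of_int c) /
       ((of_int c * z + of_int d) * (of_int c * z + of_int d))) (at z)"
    using nz by (auto intro!: derivative_eq_intros)
  moreover have "of_int a * (of_int c * z + of_int d) - (of_int a * z + of_int b) * of_int c = 1"
    using det by (simp add: algebra_simps)
  ultimately have "(act g has_field_derivative
      1 / ((of_int c * z + of_int d) * (of_int c * z + of_int d))) (at z)"
    by simp
  then show ?thesis using nz by (intro that) simp_all
qed

lemma act_Sg_deriv: "z \<in> HH \<Longrightarrow> (act Sg has_field_derivative 1 / z\<^sup>2) (at z)"
  unfolding act_psl_class[abs_def]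
  by (auto intro!: derivative_eq_intros simp: HH_def power2_eq_square)

lemma act_Rg_deriv: "z \<in> HH \<Longrightarrow> (act Rg has_field_derivative 1 / (1 - z)\<^sup>2) (at z)"
  unfolding act_psl_class[abs_def]
  by (auto intro!: derivative_eq_intros simp: HH_def power2_eq_square)

lemma continuous_on_act: "g \<in> \<Gamma> \<Longrightarrow> continuous_on HH (act g)"
  by (metis act_deriv DERIV_isCont continuous_at_imp_continuous_on)

lemma open_act_image:
  assumes "g \<in> \<Gamma>" "open U" "U \<subseteq> HH"
  shows "open (act g ` U)"
proof -
  have "act g ` U = act (pinv g) -` U \<inter> HH"
    using act_image_iff[OF assms(1,3)] act_image_subset[OF assms(1,3)] by blast
  then show ?thesis
    using continuous_on_act[of "pinv g"] assms open_HH
    by (simp add: continuous_on_open_vimage)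
qed


section \<open>Ping-pong for free products of cyclic groups\<close>

text \<open>One set \<open>A k\<close> absorbs all nontrivial powers of \<open>k\<close>, positive
  and negative. The base point \<open>d\<close> outside of all these sets allows a word to be tested
  on a single point, also when the factors have order 2. The factors are indexed by the generators
  themselves, so a letter is a pair of a generator and an element of its cyclic group.\<close>

locale ping_pong = group H for H (structure) +
  fixes K :: "'a set" and \<Omega> :: "'c set" and f :: "'a \<Rightarrow> 'c \<Rightarrow> 'c" and A :: "'a \<Rightarrow> 'c set" and d :: 'c
  assumes K_subset: "K \<subseteq> carrier H" and K_generates: "generate H K = carrier H"
    and f_mult: "\<And>x y p. x \<in> carrier H \<Longrightarrow> y \<in> carrier H \<Longrightarrow> p \<in> \<Omega> \<Longrightarrow> f (x \<otimes> y) p = f x (f y p)"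
    and f_one: "\<And>p. p \<in> \<Omega> \<Longrightarrow> f \<one> p = p"
    and f_closed: "\<And>x p. x \<in> carrier H \<Longrightarrow> p \<in> \<Omega> \<Longrightarrow> f x p \<in> \<Omega>"
    and d: "d \<in> \<Omega>" "\<And>k. k \<in> K \<Longrightarrow> d \<notin> A k"
    and A_disjoint: "\<And>k k'. k \<in> K \<Longrightarrow> k' \<in> K \<Longrightarrow> k \<noteq> k' \<Longrightarrow> A k \<inter> A k' = {}"
    and pong: "\<And>k x p. k \<in> K \<Longrightarrow> x \<in> generate H {k} \<Longrightarrow> x \<noteq> \<one> \<Longrightarrow> p \<in> \<Omega> \<Longrightarrow> p \<notin> A k \<Longrightarrow> f x p \<in> A k"
begin

abbreviation cyc :: "'a \<Rightarrow> ('a, 'b) monoid_scheme" where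
  "cyc k \<equiv> subgroup_generated H {k}"

abbreviation words :: "('a \<times> 'a) list set" where
  "words \<equiv> fp_words K cyc"

abbreviation fstep :: "('a \<times> 'a) list \<Rightarrow> ('a \<times> 'a) list \<Rightarrow> bool" where
  "fstep \<equiv> fp_step K cyc"

definition val :: "('a \<times> 'a) list \<Rightarrow> 'a" where
  "val w = foldr (\<lambda>(i, x) y. x \<otimes> y) w \<one>"

lemma carrier_cyc: "k \<in> K \<Longrightarrow> carrier (cyc k) = generate H {k}"
  using K_subset by (auto simp: carrier_subgroup_generated Int_absorb1)

lemma generate_carrier: "k \<in> K \<Longrightarrow> x \<in> generate H {k} \<Longrightarrow> x \<in> carrier H"
  using K_subset generate_in_carrier[of "{k}"] by auto

lemma words_Nil: "[] \<in> words" by (simp add: fp_words_def)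

lemma words_Cons: "(k, x) # w \<in> words \<longleftrightarrow> k \<in> K \<and> x \<in> generate H {k} \<and> w \<in> words"
  by (auto simp: fp_words_def carrier_cyc)

lemma words_append: "u @ w \<in> words \<longleftrightarrow> u \<in> words \<and> w \<in> words"
  by (auto simp: fp_words_def)

lemma val_simps [simp]: "val [] = \<one>" "val ((k, x) # w) = x \<otimes> val w"
  by (simp_all add: val_def)

lemma val_carrier [simp]: "w \<in> words \<Longrightarrow> val w \<in> carrier H"
  by (induction w) (auto simp: words_Cons generate_carrier)

lemma val_append: "u \<in> words \<Longrightarrow> w \<in> words \<Longrightarrow> val (u @ w) = val u \<otimes> val w"
  by (induction u) (auto simp: words_Cons generate_carrier m_assoc)

lemma generate_mult: "k \<in> K \<Longrightarrow> x \<in> generate H {k} \<Longrightarrow> y \<in> generate H {k} \<Longrightarrow> x \<otimes> y \<in> generate H {k}"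
  by (rule generate.eng)

lemma fstep_words: "fstep u w \<Longrightarrow> u \<in> words \<and> w \<in> words"
  by (induction rule: fp_step.induct)
    (auto simp: words_append words_Cons words_Nil carrier_cyc generate.one generate_mult)

lemma fstep_val: "fstep u w \<Longrightarrow> val u = val w"
proof (induction rule: fp_step.induct)
  case (delete u w i)
  moreover have "[(i, \<one>)] @ w \<in> words"
    using delete by (simp add: words_Cons generate.one)
  ultimately show ?case using val_append[of u "[(i, \<one>)] @ w"] by (simp add: val_append)
next
  case (merge u w i x y)
  then have xy: "x \<in> generate H {i}" "y \<in> generate H {i}" by (simp_all add: carrier_cyc)
  then have "[(i, x), (i, y)] @ w \<in> words" "[(i, x \<otimes> y)] @ w \<in> words"
    using merge by (simp_all add: words_Cons generate_mult)
  then show ?case using merge xy val_append[of u "[(i, x), (i, y)] @ w"]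
      val_append[of u "[(i, x \<otimes> y)] @ w"]
    by (simp add: m_assoc generate_carrier)
qed

lemma fstep_append: "fstep u w \<Longrightarrow> v \<in> words \<Longrightarrow> v' \<in> words \<Longrightarrow> fstep (v @ u @ v') (v @ w @ v')"
proof (induction rule: fp_step.induct)
  case (delete u w i)
  then show ?case using fp_step.delete[of "v @ u" K cyc "w @ v'" i] by (simp add: words_append)
next
  case (merge u w i x y)
  then show ?case using fp_step.merge[of "v @ u" K cyc "w @ v'" i x y] by (simp add: words_append)
qed

lemma equiv_val: "equivclp fstep u w \<Longrightarrow> val u = val w"
  by (induction rule: equivclp_induct) (auto dest: fstep_val)

lemma equiv_words: "equivclp fstep u w \<Longrightarrow> u \<in> words \<Longrightarrow> w \<in> words"
  by (induction rule: equivclp_induct) (auto dest: fstep_words)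

lemma equiv_append:
  "equivclp fstep u w \<Longrightarrow> v \<in> words \<Longrightarrow> v' \<in> words \<Longrightarrow> equivclp fstep (v @ u @ v') (v @ w @ v')"
proof (induction rule: equivclp_induct)
  case (step y z)
  then have "equivclp fstep (v @ y @ v') (v @ z @ v')"
    using fstep_append by (meson equivclp_sym r_into_equivclp)
  then show ?case using step by (meson equivclp_trans)
qed simp

lemma equiv_append2:
  assumes "equivclp fstep u u'" "equivclp fstep w w'" "u \<in> words" "w \<in> words"
  shows "equivclp fstep (u @ w) (u' @ w')"
proof -
  have "u' \<in> words" using assms equiv_words by blast
  then have "equivclp fstep (u @ w) (u' @ w)" "equivclp fstep (u' @ w) (u' @ w')"
    using equiv_append[OF assms(1) words_Nil assms(4)] equiv_append[OF assms(2) _ words_Nil]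
    by simp_all
  then show ?thesis by (rule equivclp_trans)
qed

lemma equiv_fp_rel: "equiv words (fp_rel K cyc)"
proof (rule equivI)
  show "fp_rel K cyc \<subseteq> words \<times> words" by (auto simp: fp_rel_def)
  show "refl_on words (fp_rel K cyc)" by (auto simp: refl_on_def fp_rel_def)
  show "sym (fp_rel K cyc)" by (auto simp: sym_def fp_rel_def intro: equivclp_sym)
  show "trans (fp_rel K cyc)" by (auto simp: trans_def fp_rel_def intro: equivclp_trans)
qed

text \<open>By \<open>equiv_val\<close> the value is constant on a class, which makes the definite
  description in \<open>fp_map\<close> well defined.\<close>

lemma fp_map_class: "u \<in> words \<Longrightarrow> fp_map H (fp_rel K cyc `` {u}) = val u"
  unfolding fp_map_def val_def[symmetric]
proof (rule the_equality)
  assume u: "u \<in> words"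
  then show "\<exists>w\<in>fp_rel K cyc `` {u}. val u = val w" by (auto simp: fp_rel_def)
  fix h assume "\<exists>w\<in>fp_rel K cyc `` {u}. h = val w"
  then show "h = val u" by (auto simp: fp_rel_def dest: equiv_val)
qed

lemma mult_class:
  assumes "u \<in> words" "w \<in> words"
  shows "fp_rel K cyc `` {u} \<otimes>\<^bsub>free_product K cyc\<^esub> fp_rel K cyc `` {w} = fp_rel K cyc `` {u @ w}"
proof -
  \<comment> \<open>All choices of representatives give the same class, so the union in the
    definition of the multiplication collapses.\<close>
  have *: "fp_rel K cyc `` {u' @ w'} = fp_rel K cyc `` {u @ w}"
    if "u' \<in> fp_rel K cyc `` {u}" "w' \<in> fp_rel K cyc `` {w}" for u' w'
  proof (rule equiv_class_eq[OF equiv_fp_rel])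
    show "(u' @ w', u @ w) \<in> fp_rel K cyc"
      using that equiv_append2[of u u' w w'] by (auto simp: fp_rel_def words_append intro: equivclp_sym)
  qed
  have "fp_rel K cyc `` {u} \<noteq> {}" "fp_rel K cyc `` {w} \<noteq> {}"
    using assms by (auto simp: fp_rel_def)
  then show ?thesis unfolding free_product_def by (simp add: * cong: SUP_cong_simp)
qed

primrec reduced :: "('a \<times> 'a) list \<Rightarrow> bool" where
  "reduced [] = True"
| "reduced (p # w) \<longleftrightarrow> snd p \<noteq> \<one> \<and> reduced w \<and> (w = [] \<or> fst (hd w) \<noteq> fst p)"

lemma ex_reduced: "w \<in> words \<Longrightarrow> \<exists>w'\<in>words. reduced w' \<and> equivclp fstep w w'"
proof (induction w)
  case (Cons p w)
  obtain k x where p: "p = (k, x)" by fastforce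
  with Cons have k: "k \<in> K" "x \<in> generate H {k}" "w \<in> words" by (auto simp: words_Cons)
  then obtain w' where w': "w' \<in> words" "reduced w'" "equivclp fstep w w'" using Cons.IH by blast
  have kx: "[(k, x)] \<in> words" using k by (simp add: words_Cons words_Nil)
  have e: "equivclp fstep (p # w) ((k, x) # w')"
    using equiv_append[OF w'(3) kx words_Nil] p by simp
  have del: "equivclp fstep ((k, \<one>) # v) v" if "v \<in> words" for v
    using fp_step.delete[OF words_Nil that k(1)] by auto
  show ?case
  proof (cases "x = \<one>")
    case True
    then show ?thesis using e del[OF w'(1)] w' by (metis equivclp_trans)
  next
    case x: False
    show ?thesis
    proof (cases "w' = [] \<or> fst (hd w') \<noteq> k")
      case True
      then have "reduced ((k, x) # w')" "(k, x) # w' \<in> words" using x w' k by (auto simp: words_Cons)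
      then show ?thesis using e by blast
    next
      case False
      then obtain y v where w'v: "w' = (k, y) # v" by (cases w') auto
      then have y: "y \<in> generate H {k}" "v \<in> words" "reduced v" "v = [] \<or> fst (hd v) \<noteq> k"
        using w' by (auto simp: words_Cons)
      have "fstep ((k, x) # w') ((k, x \<otimes> y) # v)"
        using fp_step.merge[OF words_Nil y(2) k(1), of x y] k y w'v by (simp add: carrier_cyc)
      then have e2: "equivclp fstep (p # w) ((k, x \<otimes> y) # v)" using e by (meson equivclp_trans r_into_equivclp)
      \<comment> \<open>No further merging can occur: the letter after the merged one belongs to
        another factor, so \<open>v\<close> is reduced both alone and behind a nontrivial merged
        letter.\<close>
      show ?thesis
      proof (cases "x \<otimes> y = \<one>")
        case True
        then show ?thesis using e2 del[OF y(2)] y by (metis equivclp_trans)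
      next
        case False
        then have "reduced ((k, x \<otimes> y) # v)" "(k, x \<otimes> y) # v \<in> words"
          using y k by (auto simp: words_Cons generate_mult)
        then show ?thesis using e2 by blast
      qed
    qed
  qed
qed (use words_Nil in \<open>auto intro: bexI[of _ "[]"]\<close>)

text \<open>The letters act on \<open>d\<close> from the last to the first. Before each letter acts
  the point is outside the set of that letter, at the start because \<open>d\<close> is outside all
  sets, later because the sets of neighbouring letters are disjoint.\<close>

lemma reduced_val: "w \<in> words \<Longrightarrow> reduced w \<Longrightarrow> w \<noteq> [] \<Longrightarrow> f (val w) d \<in> A (fst (hd w))"
proof (induction w)
  case (Cons p w)
  obtain k x where p: "p = (k, x)" by fastforce
  with Cons have k: "k \<in> K" "x \<in> generate H {k}" "w \<in> words" "x \<noteq> \<one>" by (auto simp: words_Cons)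
  have "f (val w) d \<notin> A k"
  proof (cases w)
    case Nil
    then show ?thesis using d k by (simp add: f_one)
  next
    case (Cons q v)
    then have "f (val w) d \<in> A (fst (hd w))" "fst (hd w) \<noteq> k" "fst (hd w) \<in> K"
      using Cons.IH Cons.prems k p by (auto simp: words_Cons fp_words_def)
    then show ?thesis using A_disjoint k by blast
  qed
  then have "f x (f (val w) d) \<in> A k" using k d by (intro pong f_closed) auto
  then show ?case using k p d by (simp add: f_mult generate_carrier)
qed simp

lemma reduced_val_notin: "w \<in> words \<Longrightarrow> reduced w \<Longrightarrow> k \<in> K \<Longrightarrow> w = [] \<or> fst (hd w) \<noteq> k \<Longrightarrow> f (val w) d \<notin> A k"
proof (cases w)
  case (Cons p v)
  assume *: "w \<in> words" "reduced w" "k \<in> K" "w = [] \<or> fst (hd w) \<noteq> k"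
  then have "fst (hd w) \<in> K" using Cons by (auto simp: fp_words_def)
  then show ?thesis using reduced_val[of w] A_disjoint[of "fst (hd w)" k] * Cons by auto
qed (simp add: d f_one)

text \<open>The set containing the image of \<open>d\<close> reveals the factor of the first letter.
  If \<open>x\<close> and \<open>y\<close> are first letters in the same factor, then
  \<open>inv y \<otimes> x\<close> moves a point outside \<open>A k\<close> to a point outside
  \<open>A k\<close>, so it is trivial by \<open>pong\<close>, and the letters can be
  cancelled.\<close>

lemma reduced_unique:
  "u \<in> words \<Longrightarrow> w \<in> words \<Longrightarrow> reduced u \<Longrightarrow> reduced w \<Longrightarrow> val u = val w \<Longrightarrow> u = w"
proof (induction u arbitrary: w)
  case Nil
  show ?case
  proof (rule ccontr)
    assume "[] \<noteq> w"
    then have "w \<noteq> []" by simp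
    then have "f (val w) d \<in> A (fst (hd w))" "fst (hd w) \<in> K"
      using reduced_val[of w] Nil.prems(2,4) by (auto simp: fp_words_def neq_Nil_conv)
    moreover have "f (val w) d = d" using Nil.prems(5)[symmetric] d(1) by (simp add: f_one)
    ultimately show False using d(2) by simp
  qed
next
  case (Cons p u)
  obtain k x where p: "p = (k, x)" by fastforce
  with Cons have k: "k \<in> K" "x \<in> generate H {k}" "u \<in> words" "reduced u" "u = [] \<or> fst (hd u) \<noteq> k"
    by (auto simp: words_Cons)
  have hd: "f (val w) d \<in> A k" using reduced_val[of "p # u"] Cons.prems p by simp
  then have "\<not> (w = [] \<or> fst (hd w) \<noteq> k)" using reduced_val_notin[of w k] Cons.prems k by blast
  then obtain y v where w: "w = (k, y) # v" by (cases w) auto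
  then have y: "y \<in> generate H {k}" "v \<in> words" "reduced v" "v = [] \<or> fst (hd v) \<noteq> k"
    using Cons.prems by (auto simp: words_Cons)
  have c: "x \<in> carrier H" "y \<in> carrier H" "val u \<in> carrier H" "val v \<in> carrier H"
    using k y generate_carrier by auto
  have eq: "x \<otimes> val u = y \<otimes> val v" using Cons.prems(5) p w by simp
  then have "inv y \<otimes> x \<otimes> val u = val v"
    using c by (simp add: m_assoc inv_solve_left')
  then have "f (inv y \<otimes> x) (f (val u) d) = f (val v) d" using c d by (simp flip: f_mult)
  moreover have "f (val u) d \<notin> A k" "f (val v) d \<notin> A k"
    using reduced_val_notin[OF k(3,4,1,5)] reduced_val_notin[OF y(2,3) k(1) y(4)] by auto
  moreover have "inv y \<otimes> x \<in> generate H {k}"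
    using k y K_subset by (intro generate.eng generate_m_inv_closed) auto
  ultimately have "inv y \<otimes> x = \<one>" using pong[OF k(1)] f_closed c d by metis
  moreover have "y \<otimes> (inv y \<otimes> x) = x" using c by (simp flip: m_assoc)
  ultimately have xy: "x = y" using c by simp
  then have "val u = val v" using eq c by simp
  then show ?case using Cons.IH[OF k(3) y(2) k(4) y(3)] p w xy by simp
qed

lemma ex_val: "h \<in> generate H K \<Longrightarrow> \<exists>w\<in>words. val w = h"
proof (induction rule: generate.induct)
  case one
  then show ?case using words_Nil by (intro bexI[of _ "[]"]) auto
next
  case (incl h)
  then show ?case using K_subset by (intro bexI[of _ "[(h, h)]"]) (auto simp: words_Cons words_Nil generate.incl)
next
  case (inv h)
  then show ?case using K_subset
    by (intro bexI[of _ "[(h, inv h)]"]) (auto simp: words_Cons words_Nil generate.inv)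
next
  case (eng h1 h2)
  then show ?case using val_append words_append by metis
qed

theorem independent: "independent_generators H K"
proof -
  let ?F = "free_product K cyc"
  have carr: "carrier ?F = words // fp_rel K cyc" by (simp add: free_product_def)
  have cls: "\<exists>u\<in>words. X = fp_rel K cyc `` {u} \<and> fp_map H X = val u" if "X \<in> carrier ?F" for X
    using that by (auto simp: carr quotient_def fp_map_class)
  have "fp_map H \<in> hom ?F H"
  proof (rule homI)
    show "fp_map H X \<in> carrier H" if "X \<in> carrier ?F" for X using cls[OF that] by auto
    fix X Y assume "X \<in> carrier ?F" "Y \<in> carrier ?F"
    then obtain u w where "u \<in> words" "X = fp_rel K cyc `` {u}" "w \<in> words" "Y = fp_rel K cyc `` {w}"
      using cls by metis
    then show "fp_map H (X \<otimes>\<^bsub>?F\<^esub> Y) = fp_map H X \<otimes> fp_map H Y"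
      by (simp add: mult_class fp_map_class val_append words_append)
  qed
  moreover have "bij_betw (fp_map H) (carrier ?F) (carrier H)"
    unfolding bij_betw_def
  proof
    show "inj_on (fp_map H) (carrier ?F)"
    proof (rule inj_onI)
      fix X Y assume XY: "X \<in> carrier ?F" "Y \<in> carrier ?F" "fp_map H X = fp_map H Y"
      obtain u where u: "u \<in> words" "X = fp_rel K cyc `` {u}" "fp_map H X = val u"
        using cls XY(1) by metis
      obtain w where w: "w \<in> words" "Y = fp_rel K cyc `` {w}" "fp_map H Y = val w"
        using cls XY(2) by metis
      obtain u' where u': "u' \<in> words" "reduced u'" "equivclp fstep u u'" using ex_reduced[OF u(1)] by blast
      obtain w' where w': "w' \<in> words" "reduced w'" "equivclp fstep w w'" using ex_reduced[OF w(1)] by blast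
      have "u' = w'"
        using reduced_unique[OF u'(1) w'(1) u'(2) w'(2)] equiv_val[OF u'(3)] equiv_val[OF w'(3)] XY(3) u w
        by simp
      then have "equivclp fstep u w" using u'(3) w'(3) by (metis equivclp_sym equivclp_trans)
      then show "X = Y" using u w by (simp add: eq_equiv_class_iff[OF equiv_fp_rel]) (simp add: fp_rel_def)
    qed
    show "fp_map H ` carrier ?F = carrier H"
    proof
      show "fp_map H ` carrier ?F \<subseteq> carrier H" using cls by force
      show "carrier H \<subseteq> fp_map H ` carrier ?F"
      proof
        fix h assume "h \<in> carrier H"
        then obtain w where "w \<in> words" "val w = h" using ex_val K_generates by blast
        then show "h \<in> fp_map H ` carrier ?F"
          by (intro image_eqI[of _ _ "fp_rel K cyc `` {w}"]) (auto simp: fp_map_class carr intro: quotientI)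
      qed
    qed
  qed
  ultimately show ?thesis unfolding independent_generators_def iso_def using K_subset by blast
qed

end


section \<open>Polygons bounded by branches\<close>

definition open_triangle :: "complex set" where
  "open_triangle = {z \<in> HH. 0 < Re z \<and> Re z < 1 / 2 \<and> 1 < cmod (z - 1)}"

lemma open_triangle: "open open_triangle" "open_triangle \<subseteq> Triangle" "open_triangle \<noteq> {}"
proof -
  have "open_triangle = HH \<inter> {z. 0 < Re z} \<inter> {z. Re z < 1 / 2} \<inter> {z. 1 < cmod (z - 1)}"
    by (auto simp: open_triangle_def)
  also have "open \<dots>" by (intro open_Int open_HH open_Collect_less continuous_intros)
  finally show "open open_triangle" .
  show "open_triangle \<subseteq> Triangle" by (auto simp: open_triangle_def Triangle_def)
  have "1 < cmod (Complex (1 / 4) 2 - 1)" by (simp add: cmod_def power2_eq_square)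
  then have "Complex (1 / 4) 2 \<in> open_triangle" by (simp add: open_triangle_def HH_def)
  then show "open_triangle \<noteq> {}" by blast
qed

lemma Triangle_cases:
  assumes "w \<in> Triangle"
  shows "w \<in> open_triangle \<or> (\<exists>t. w \<in> side_at t)"
proof (cases "w \<in> open_triangle")
  case False
  then consider "Re w = 0" | "Re w = 1 / 2" | "cmod (w - 1) = 1"
    using assms by (auto simp: open_triangle_def Triangle_def)
  then show ?thesis
  proof cases
    case 2
    have w: "w \<in> HH" "1 \<le> cmod (w - 1)" using assms by (simp_all add: Triangle_def)
    then have "1 \<le> (Re w)\<^sup>2 + (Im w)\<^sup>2" using 2 unfolding cmod_minus_1_ge_iff by linarith
    then have "1 \<le> cmod w" by (simp only: cmod_ge_1_iff)
    \<comment> \<open>A boundary point on Re w = 1/2 lies also in the image of the sector under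
      \<open>R2g\<close>; the two meet only in the sides.\<close>
    then have "w \<in> act R2g ` sector True" using 2 w unfolding R2g_sector by simp
    moreover have "w \<in> sector True" using assms Triangle_subset_sector by blast
    moreover have "R2g \<in> letters True" by simp
    ultimately have "w \<in> side_at True" using letter_sector_Int by blast
    then show ?thesis by blast
  next
    case 3
    then have "w \<in> int_rho_0" using assms by (auto simp: int_rho_0_def Triangle_def)
    then show ?thesis by (metis UnI1 side_at.simps(2))
  qed (use assms in \<open>auto simp: Triangle_def int_0_inf_def intro!: exI[of _ False]\<close>)
qed simp

lemma side_at_HH: "side_at t \<subseteq> HH" using side_at_subset Triangle_subset_HH by blast

lemma side_at_disjoint: "w \<in> side_at t \<Longrightarrow> w \<in> side_at u \<Longrightarrow> t = u"
proof (rule ccontr)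
  assume "w \<in> side_at t" "w \<in> side_at u" "t \<noteq> u"
  then have "w \<in> int_0_inf" "w \<in> int_rho_0 \<union> int_rho_inf" by (cases t; cases u; auto)+
  then show False
    using HH_nonzero(3)[of w] cmod_minus_1_ge_iff[of w] cmod_minus_1_le_iff[of w]
    by (auto simp: int_0_inf_def int_rho_0_def int_rho_inf_def)
qed

section \<open>Neighbourhoods of points on the sides\<close>

lemma side_at_nbhd_False:
  assumes "w \<in> int_0_inf"
  obtains N where "open N" "w \<in> N" "N \<subseteq> HH" "N \<subseteq> Triangle \<union> act Sg ` Triangle"
proof -
  \<comment> \<open>The interior of the union of \<open>Triangle\<close> and its image under
    \<open>Sg\<close>, which is its reflection in the imaginary axis.\<close>
  define N where "N = {z \<in> HH. - 1 / 2 < Re z \<and> Re z < 1 / 2 \<and> 1 < cmod (z - 1) \<and> 1 < cmod (z + 1)}"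
  have "N = HH \<inter> {z. - 1 / 2 < Re z} \<inter> {z. Re z < 1 / 2} \<inter> {z. 1 < cmod (z - 1)} \<inter> {z. 1 < cmod (z + 1)}"
    by (auto simp: N_def)
  also have "open \<dots>" by (intro open_Int open_HH open_Collect_less continuous_intros)
  finally have "open N" .
  moreover have "w \<in> N"
    using assms by (auto simp: N_def int_0_inf_def cmod_def HH_def)
  moreover have "N \<subseteq> Triangle \<union> act Sg ` Triangle"
  proof
    fix z assume z: "z \<in> N"
    then have H: "z \<in> HH" by (simp add: N_def)
    show "z \<in> Triangle \<union> act Sg ` Triangle"
    proof (cases "0 \<le> Re z")
      case True
      then show ?thesis using z by (auto simp: N_def Triangle_def)
    next
      case False
      have "1 \<le> cmod (z + 1)" using z by (simp add: N_def)
      then have "0 \<le> 2 * Re z + ((Re z)\<^sup>2 + (Im z)\<^sup>2)"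
        by (simp add: cmod_ge_1_iff power2_eq_square algebra_simps)
      then have "act Sg z \<in> Triangle"
        using z False H HH_nonzero(3)[OF H] act_in_HH[OF gens_in_carrier(1) H]
        by (auto simp: N_def Triangle_def cmod_act_minus_1 Re_act_gens field_simps)
      then show ?thesis using image_gens(1)[OF Triangle_subset_HH H] by simp
    qed
  qed
  moreover have "N \<subseteq> HH" by (auto simp: N_def)
  ultimately show ?thesis by (intro that)
qed

lemma side_at_nbhd_True:
  assumes "w \<in> int_rho_0 \<union> int_rho_inf"
  obtains N where "open N" "w \<in> N" "N \<subseteq> HH"
    "N \<subseteq> Triangle \<union> (act Rg ` Triangle \<union> act R2g ` Triangle)"
proof -
  \<comment> \<open>The open ideal triangle with vertices 0, 1 and infinity, made up of the three
    images of \<open>Triangle\<close> under the rotations about rho. The last inequality describes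
    the outside of the circle with diameter from 0 to 1.\<close>
  define N where "N = {z \<in> HH. 0 < Re z \<and> Re z < 1 \<and> Re z < (Re z)\<^sup>2 + (Im z)\<^sup>2}"
  have "N = HH \<inter> {z. 0 < Re z} \<inter> {z. Re z < 1} \<inter> {z. Re z < (Re z)\<^sup>2 + (Im z)\<^sup>2}"
    by (auto simp: N_def)
  also have "open \<dots>" by (intro open_Int open_HH open_Collect_less continuous_intros)
  finally have "open N" .
  moreover have "w \<in> N"
  proof (cases "w \<in> int_rho_0")
    case True
    then have w: "w \<in> HH" "(Re w)\<^sup>2 + (Im w)\<^sup>2 = 2 * Re w" "Re w \<le> 1 / 2"
      using cmod_minus_1_ge_iff[of w] cmod_minus_1_le_iff[of w] by (auto simp: int_rho_0_def)
    then show ?thesis using HH_nonzero(3)[OF w(1)] by (simp add: N_def)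
  next
    case False
    then have w: "w \<in> HH" "Re w = 1 / 2" "sqrt 3 / 2 \<le> Im w" using assms by (auto simp: int_rho_inf_def)
    then have "3 / 4 \<le> (Im w)\<^sup>2"
      using power_mono[of "sqrt 3 / 2" "Im w" 2] by (simp add: power_divide)
    moreover have "0 \<le> (Re w)\<^sup>2" by simp
    ultimately have "Re w < (Re w)\<^sup>2 + (Im w)\<^sup>2" using w(2) by linarith
    moreover have "0 < Re w" "Re w < 1" using w(2) by simp_all
    ultimately show ?thesis using w(1) unfolding N_def by blast
  qed
  moreover have "N \<subseteq> Triangle \<union> (act Rg ` Triangle \<union> act R2g ` Triangle)"
  proof
    fix z assume z: "z \<in> N"
    then have H: "z \<in> HH" by (simp add: N_def)
    have *: "cmod (z - 1) \<le> cmod z \<longleftrightarrow> 1 / 2 \<le> Re z"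
    proof -
      have "cmod (z - 1) \<le> cmod z \<longleftrightarrow> (cmod (z - 1))\<^sup>2 \<le> (cmod z)\<^sup>2" by simp
      also have "\<dots> \<longleftrightarrow> 1 / 2 \<le> Re z"
        unfolding cmod_power2 by (auto simp: power2_eq_square algebra_simps)
      finally show ?thesis .
    qed
    consider "Re z \<le> 1 / 2" "1 \<le> cmod (z - 1)" | "cmod (z - 1) \<le> 1" "cmod z \<le> 1"
      | "1 / 2 \<le> Re z" "1 \<le> cmod z"
      using * by linarith
    then show "z \<in> Triangle \<union> (act Rg ` Triangle \<union> act R2g ` Triangle)"
    proof cases
      case 1
      then show ?thesis using z by (simp add: Triangle_def N_def)
    next
      case 2
      then have "z \<in> act Rg ` sector True" using H unfolding Rg_sector by simp
      then have "act R2g z \<in> sector True" using image_gens(2)[OF sector_subset_HH H] by blast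
      moreover have "act R2g z \<in> sector False"
        using z act_in_HH[OF gens_in_carrier(3) H] HH_nonzero(3)[OF H]
        by (simp add: Re_act_gens H N_def)
      ultimately have "act R2g z \<in> Triangle" by (simp only: Triangle_eq IntI)
      then show ?thesis using image_gens(2)[OF Triangle_subset_HH H] by simp
    next
      case 3
      then have "z \<in> act R2g ` sector True" using H unfolding R2g_sector by simp
      then have "act Rg z \<in> sector True" using image_gens(3)[OF sector_subset_HH H] by blast
      moreover have "act Rg z \<in> sector False"
        using z act_in_HH[OF gens_in_carrier(2) H] HH_nonzero(4)[OF H]
        by (simp add: Re_act_gens H N_def)
      ultimately have "act Rg z \<in> Triangle" by (simp only: Triangle_eq IntI)
      then show ?thesis using image_gens(3)[OF Triangle_subset_HH H] by simp
    qed
  qed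
  moreover have "N \<subseteq> HH" by (auto simp: N_def)
  ultimately show ?thesis by (intro that)
qed

lemma side_at_nbhd:
  assumes "w \<in> side_at t"
  obtains N where "open N" "w \<in> N" "N \<subseteq> HH" "N \<subseteq> Triangle \<union> (\<Union>l\<in>letters t. act l ` Triangle)"
proof (cases t)
  case False
  then obtain N where "open N" "w \<in> N" "N \<subseteq> HH" "N \<subseteq> Triangle \<union> act Sg ` Triangle"
    using side_at_nbhd_False[of w] assms by auto
  then show ?thesis using that[of N] False by simp
next
  case True
  then obtain N where "open N" "w \<in> N" "N \<subseteq> HH" "N \<subseteq> Triangle \<union> (act Rg ` Triangle \<union> act R2g ` Triangle)"
    using side_at_nbhd_True[of w] assms by auto
  then show ?thesis using that[of N] True by simp
qed

lemma side_at_not_interior: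
  assumes "w \<in> side_at t"
  shows "w \<notin> interior (sector t)"
proof
  assume "w \<in> interior (sector t)"
  then obtain e where e: "0 < e" "ball w e \<subseteq> sector t" by (meson mem_interior)
  \<comment> \<open>A step of length \<open>d\<close> to the left, to the right or towards the
    centre 1 of the circle will leave the sector. Half of \<open>e\<close> stays in the ball, and
    the bound 1 keeps the step from running past the centre.\<close>
  define d where "d = min (e / 2) 1"
  have d: "0 < d" "d \<le> 1" "d < e" using e(1) by (auto simp: d_def)
  have H: "w \<in> HH" using assms side_at_HH by blast
  have in_sector: "w + of_real d * u \<in> sector t" if "cmod u = 1" for u
    using that d e(2) by (auto simp: dist_norm norm_mult)
  consider "\<not> t" "Re w = 0" | "t" "Re w = 1 / 2" | "t" "cmod (w - 1) = 1"
    using assms by (cases t) (auto simp: int_0_inf_def int_rho_0_def int_rho_inf_def)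
  then show False
  proof cases
    case 1
    then show ?thesis using in_sector[of "- 1"] d by simp
  next
    case 2
    then show ?thesis using in_sector[of 1] d by simp
  next
    case 3
    have "cmod (w + of_real d * (- (w - 1)) - 1) = cmod (of_real (1 - d) * (w - 1))"
      by (simp add: algebra_simps)
    also have "\<dots> = 1 - d" using d 3 by (simp only: norm_mult norm_of_real) simp
    finally show ?thesis using in_sector[of "- (w - 1)"] 3 d by (simp only: norm_minus_cancel) auto
  qed
qed

lemma not_branch_Triangle:
  assumes "x \<in> \<Gamma>" "\<not> branch t x"
  shows "act x ` Triangle \<subseteq> sector t"
proof (cases "x = one_psl")
  case True
  then show ?thesis by (simp add: act_image_one Triangle_subset_sector)
next
  case False
  then have "branch (\<not> t) x" using not_branch_cases assms by blast
  then show ?thesis using branch_Triangle letter_sector_subset by blast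
qed

lemma closedin_sector: "closedin (top_of_set HH) (sector t)"
proof -
  have F: "sector False = HH \<inter> {z. 0 \<le> Re z}"
    and T: "sector True = HH \<inter> {z. Re z \<le> 1 / 2 \<and> 1 \<le> cmod (z - 1)}" by auto
  have "closedin (top_of_set HH) (sector False)"
    unfolding F by (intro closedin_closed_Int closed_Collect_le continuous_intros)
  moreover have "closedin (top_of_set HH) (sector True)"
    unfolding T by (intro closedin_closed_Int closed_Collect_conj closed_Collect_le continuous_intros)
  ultimately show ?thesis by (cases t) simp_all
qed

lemma closedin_act_image:
  assumes "g \<in> \<Gamma>" "closedin (top_of_set HH) X"
  shows "closedin (top_of_set HH) (act g ` X)"
proof -
  have X: "X \<subseteq> HH" using assms(2) closedin_subset by fastforce
  have "act g ` X = HH \<inter> act (pinv g) -` X"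
    using act_image_iff[OF assms(1) X] act_image_subset[OF assms(1) X] by blast
  moreover have "act (pinv g) \<in> HH \<rightarrow> HH" using assms(1) by (auto intro: act_in_HH)
  ultimately show ?thesis
    using continuous_closedin_preimage_gen[OF continuous_on_act[of "pinv g"] _ assms(2)] assms(1)
    by auto
qed

lemma letters_finite: "finite (letters t)" by (cases t) auto

text \<open>A neighbourhood of \<open>z\<close> is covered by the triangles of finitely many edges
  \<open>h \<cdot> m\<close>. A triangle that meets the neighbourhood meets one of these, so its
  edge arises from \<open>h \<cdot> m\<close> by appending at most one letter.\<close>

lemma locally_finite_tessellation:
  assumes "z \<in> HH"
  obtains U where "open U" "z \<in> U" "finite {g \<in> \<Gamma>. act g ` Triangle \<inter> U \<noteq> {}}"
proof -
  obtain h w where h: "h \<in> \<Gamma>" "w \<in> Triangle" "z = act h w" using tessellation[OF assms] .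
  obtain N M where N: "open N" "w \<in> N" "N \<subseteq> HH" and M: "finite M" "M \<subseteq> \<Gamma>"
    "N \<subseteq> (\<Union>m\<in>M. act m ` Triangle)"
  proof (cases "w \<in> open_triangle")
    case True
    then show ?thesis using that[of open_triangle "{one_psl}"] open_triangle Triangle_subset_HH
      by (auto simp: act_image_one)
  next
    case False
    then obtain t where "w \<in> side_at t" using Triangle_cases h(2) by blast
    then obtain N where "open N" "w \<in> N" "N \<subseteq> HH" "N \<subseteq> Triangle \<union> (\<Union>l\<in>letters t. act l ` Triangle)"
      by (rule side_at_nbhd)
    moreover have "insert one_psl (letters t) \<subseteq> \<Gamma>" using letters_carrier by auto
    ultimately show ?thesis using letters_finite
      by (intro that[of N "insert one_psl (letters t)"]) (auto simp: act_image_one)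
  qed
  define L where "L = insert one_psl (letters False \<union> letters True)"
  have "{g \<in> \<Gamma>. act g ` Triangle \<inter> act h ` N \<noteq> {}} \<subseteq> (\<lambda>(m, l). h \<cdot> m \<cdot> l) ` (M \<times> L)"
  proof
    fix g assume "g \<in> {g \<in> \<Gamma>. act g ` Triangle \<inter> act h ` N \<noteq> {}}"
    then obtain a p where g: "g \<in> \<Gamma>" and a: "a \<in> Triangle" "p \<in> N" "act g a = act h p" by auto
    obtain m b where m: "m \<in> M" "b \<in> Triangle" "p = act m b" using M(3) a(2) by blast
    define k where "k = h \<cdot> m"
    have k: "k \<in> \<Gamma>" "k = h \<cdot> m" using h(1) m(1) M(2) by (auto simp: k_def)
    have ab: "a \<in> HH" "b \<in> HH" using a(1) m(2) Triangle_subset_HH by auto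
    have "act g a = act k b" using a(3) m M(2) h(1) ab by (simp add: k(2) act_mult subset_iff)
    then have "act (pinv k \<cdot> g) a = b" using g k(1) ab by (simp add: act_mult act_inv_act)
    then have "pinv k \<cdot> g = one_psl \<or> (\<exists>t. pinv k \<cdot> g \<in> letters t)"
      using Triangle_meets[of "pinv k \<cdot> g" b] g k(1) a(1) m(2) by blast
    moreover have "letters t \<subseteq> letters False \<union> letters True" for t by (cases t) auto
    ultimately have "pinv k \<cdot> g \<in> L" unfolding L_def by blast
    moreover have "g = k \<cdot> (pinv k \<cdot> g)"
      using g k(1) by (simp flip: PSL.m_assoc)
    ultimately show "g \<in> (\<lambda>(m, l). h \<cdot> m \<cdot> l) ` (M \<times> L)"
      using m(1) k(2) by (intro image_eqI[of _ _ "(m, pinv k \<cdot> g)"]) auto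
  qed
  moreover have "finite L" unfolding L_def by simp
  ultimately have "finite {g \<in> \<Gamma>. act g ` Triangle \<inter> act h ` N \<noteq> {}}"
    using M(1) by (meson finite_SigmaI finite_imageI finite_subset)
  then show ?thesis
    using that[of "act h ` N"] open_act_image[OF h(1) N(1,3)] N(2) h(3) by blast
qed

text \<open>The first argument says whether the vertex of type (0) is cut; vertices of type (1) are
  never cut.\<close>

fun base_sides :: "bool \<Rightarrow> bool \<Rightarrow> complex set set" where
  "base_sides c True = {int_rho_0, int_rho_inf}"
| "base_sides True False = {int_0_inf}"
| "base_sides False False = {int_i_0, int_i_inf}"

lemma Union_base_sides: "\<Union>(base_sides c t) = side_at t"
  by (cases c; cases t) (auto simp: int_0_inf_def int_i_0_def int_i_inf_def)

lemma base_sides_subset: "b \<in> base_sides c t \<Longrightarrow> b \<subseteq> side_at t"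
  using Union_base_sides by blast

lemma base_sides_geodesic: "b \<in> base_sides c t \<Longrightarrow> geodesic_interval b"
  by (cases c; cases t)
    (auto simp: int_i_0_props int_i_inf_props int_rho_0_props int_rho_inf_props geodesic_int_0_inf)

lemma base_sides_meet:
  assumes "b \<in> base_sides c t" "b' \<in> base_sides c t" "b \<noteq> b'"
  shows "b \<inter> b' \<subseteq> geodesic_endpoints b \<inter> geodesic_endpoints b'"
proof -
  have "x = \<i>" if "x \<in> int_i_0" "x \<in> int_i_inf" for x using that int_i_Int by blast
  moreover have "x = rho" if "x \<in> int_rho_0" "x \<in> int_rho_inf" for x using that int_rho_Int by blast
  moreover note int_i_0_props(2) int_i_inf_props(2) int_rho_0_props(2) int_rho_inf_props(2)
  ultimately show ?thesis using assms by (cases c; cases t) (simp_all, blast+)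
qed

text \<open>
  \<open>bd g t\<close>: the vertex of type \<open>t\<close> of the edge \<open>g\<close> is univalent; \<open>whole g\<close>: the vertex of type (0) of
  \<open>g\<close> is cut, so that it contributes one undivided side.
\<close>

locale tree_domain =
  fixes D :: "psl set" and bd :: "psl \<Rightarrow> bool \<Rightarrow> bool" and whole :: "psl \<Rightarrow> bool"
  assumes D_carrier: "D \<subseteq> \<Gamma>" and D_nonempty: "D \<noteq> {}"
    and bd_D: "bd g t \<Longrightarrow> g \<in> D"
    and bd_branch: "bd g t \<Longrightarrow> x \<in> D \<Longrightarrow> \<not> branch t (pinv g \<cdot> x)"
    and not_bd: "g \<in> D \<Longrightarrow> \<not> bd g t \<Longrightarrow> l \<in> letters t \<Longrightarrow> g \<cdot> l \<in> D"
begin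

section \<open>The polygon as an intersection of regions\<close>

definition P :: "complex set" where "P = (\<Union>g\<in>D. act g ` Triangle)"

definition sides_of :: "psl \<Rightarrow> bool \<Rightarrow> complex set set" where
  "sides_of g t = (\<lambda>b. act g ` b) ` base_sides (whole g) t"

definition E :: "complex set set" where "E = (\<Union>{sides_of g t |g t. bd g t})"

lemma bd_carrier: "bd g t \<Longrightarrow> g \<in> \<Gamma>"
  using bd_D D_carrier by blast

text \<open>On a path from an edge of \<open>D\<close> to \<open>h\<close>, a step out of
  \<open>D\<close> passes a boundary vertex and enters the branch beyond it; such a branch can only
  be left by returning to its edge \<open>g\<close>, which is again in \<open>D\<close>. So every
  edge of the path is in \<open>D\<close> or in such a branch.\<close>

lemma exit_branch:
  assumes "h \<in> \<Gamma>" "h \<notin> D"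
  obtains g t where "bd g t" "branch t (pinv g \<cdot> h)"
proof -
  obtain d where d: "d \<in> D" "d \<in> \<Gamma>" using D_nonempty D_carrier by blast
  let ?Q = "\<lambda>x. x \<in> D \<or> (\<exists>g t. bd g t \<and> branch t (pinv g \<cdot> x))"
  have step: "?Q (x \<cdot> l)" if x: "x \<in> \<Gamma>" and Q: "?Q x" and l: "l \<in> letters u" for x l u
  proof (cases "x \<in> D")
    case True
    show ?thesis
    proof (cases "bd x u")
      case bdx: True
      moreover have "pinv x \<cdot> (x \<cdot> l) = l"
        using x letters_carrier[OF l] by (simp flip: PSL.m_assoc)
      ultimately show ?thesis using branch.letter[OF l] by metis
    qed (use True not_bd l in blast)
  next
    case False
    then obtain g t where g: "bd g t" "branch t (pinv g \<cdot> x)" using Q by blast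
    note gc = bd_carrier[OF g(1)]
    have assoc: "pinv g \<cdot> x \<cdot> l = pinv g \<cdot> (x \<cdot> l)"
      using gc x letters_carrier[OF l] by (simp add: PSL.m_assoc)
    from branch_mult_letter[OF g(2) l] show ?thesis unfolding assoc
    proof (elim disjE conjE)
      assume "pinv g \<cdot> (x \<cdot> l) = one_psl"
      then have "x \<cdot> l = g"
        using gc x letters_carrier[OF l] by (metis PSL.inv_equality PSL.inv_inv PSL.inv_closed PSL.m_closed PSL.inv_comm)
      then show ?thesis using bd_D[OF g(1)] by simp
    qed (use g(1) in blast)
  qed
  have "?Q (d \<cdot> x)" if "x \<in> \<Gamma>" for x
    using that
  proof (induction rule: PSL_right_induct)
    case (S x)
    then show ?case using step[of "d \<cdot> x" Sg False] d by (simp add: PSL.m_assoc)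
  next
    case (R x)
    then show ?case using step[of "d \<cdot> x" Rg True] d by (simp add: PSL.m_assoc)
  qed (use d in simp)
  from this[of "pinv d \<cdot> h"] have "?Q h" using d assms(1) by (simp flip: PSL.m_assoc)
  then show ?thesis using that assms(2) by blast
qed

lemma P_subset_sector:
  assumes "bd g t" shows "P \<subseteq> act g ` sector t"
proof -
  note gc = bd_carrier[OF assms]
  have "act h ` Triangle \<subseteq> act g ` sector t" if h: "h \<in> D" for h
  proof -
    have hc: "h \<in> \<Gamma>" using h D_carrier by blast
    have "act h ` Triangle = act (g \<cdot> (pinv g \<cdot> h)) ` Triangle"
      using gc hc by (simp flip: PSL.m_assoc)
    also have "\<dots> = act g ` act (pinv g \<cdot> h) ` Triangle"
      using gc hc Triangle_subset_HH by (intro act_image_mult) auto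
    also have "\<dots> \<subseteq> act g ` sector t"
      using gc hc bd_branch[OF assms h] by (intro image_mono not_branch_Triangle) auto
    finally show ?thesis .
  qed
  then show ?thesis unfolding P_def by blast
qed

lemma P_subset_HH: "P \<subseteq> HH"
  unfolding P_def using act_image_subset[OF _ Triangle_subset_HH] D_carrier by blast

lemma P_eq: "P = HH \<inter> \<Inter>{act g ` sector t |g t. bd g t}"
proof
  show "P \<subseteq> HH \<inter> \<Inter>{act g ` sector t |g t. bd g t}"
    using P_subset_HH P_subset_sector by blast
  show "HH \<inter> \<Inter>{act g ` sector t |g t. bd g t} \<subseteq> P"
  proof
    fix z assume z: "z \<in> HH \<inter> \<Inter>{act g ` sector t |g t. bd g t}"
    then have zH: "z \<in> HH" by simp
    obtain h w where h: "h \<in> \<Gamma>" "w \<in> Triangle" "z = act h w"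
      using tessellation[OF zH] .
    show "z \<in> P"
    proof (cases "h \<in> D")
      case True
      then show ?thesis using h unfolding P_def by blast
    next
      case False
      \<comment> \<open>The edge \<open>h\<close> is beyond a vertex of \<open>g\<close>, while
        \<open>z\<close> is by assumption on the near side. Hence \<open>z\<close> lies on their
        common boundary and therefore in the triangle of \<open>g\<close>.\<close>
      then obtain g t where g: "bd g t" "branch t (pinv g \<cdot> h)"
        using exit_branch h(1) by blast
      note gc = bd_carrier[OF g(1)]
      obtain l where l: "l \<in> letters t" "act (pinv g \<cdot> h) ` Triangle \<subseteq> act l ` sector t"
        using branch_Triangle[OF g(2)] by blast
      have "act (pinv g) z = act (pinv g \<cdot> h) w"
        using h gc Triangle_subset_HH by (auto simp: act_mult)
      then have "act (pinv g) z \<in> act l ` sector t" using l(2) h(2) by blast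
      moreover have "z \<in> act g ` sector t" using z g(1) by blast
      then have "act (pinv g) z \<in> sector t"
        using act_image_iff[OF gc sector_subset_HH zH] by blast
      ultimately have "act (pinv g) z \<in> Triangle"
        using letter_sector_Int[OF l(1)] side_at_subset by blast
      then have "z \<in> act g ` Triangle" using act_image_iff[OF gc Triangle_subset_HH zH] by blast
      then show ?thesis using bd_D[OF g(1)] unfolding P_def by blast
    qed
  qed
qed

lemma hyp_convex_P: "hyp_convex P"
  unfolding P_eq using bd_carrier by (intro hyp_convex_Inter) (auto intro!: hyp_convex_act hyp_convex_sector)

lemma closedin_P: "closedin (top_of_set HH) P"
proof -
  have eq: "P = \<Inter>(insert HH {act g ` sector t |g t. bd g t})" unfolding P_eq by simp
  show ?thesis unfolding eq
  proof (rule closedin_Inter)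
    fix X assume "X \<in> insert HH {act g ` sector t |g t. bd g t}"
    then consider "X = HH" | g t where "bd g t" "X = act g ` sector t" by blast
    then show "closedin (top_of_set HH) X"
      by cases (simp_all add: bd_carrier closedin_act_image closedin_sector del: sector.simps)
  qed simp
qed

lemma open_triangle_interior: "g \<in> D \<Longrightarrow> act g ` open_triangle \<subseteq> interior P"
proof (rule interior_maximal)
  assume g: "g \<in> D"
  then show "act g ` open_triangle \<subseteq> P" using open_triangle(2) unfolding P_def by blast
  show "open (act g ` open_triangle)"
    using g D_carrier open_triangle Triangle_subset_HH by (intro open_act_image) auto
qed

lemma interior_P_nonempty: "interior P \<noteq> {}"
  using D_nonempty open_triangle_interior open_triangle(3) by blast

text \<open>At a side of a vertex that is not univalent, all triangles around the side belong to
  edges in \<open>D\<close>, so its points are interior. At a univalent vertex of \<open>g\<close>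
  the polygon stays in the sector of \<open>g\<close>, and the side consists of boundary points of
  this sector.\<close>

lemma frontier_P: "frontier P \<inter> HH = (\<Union>{act g ` side_at t |g t. bd g t})"
proof -
  \<comment> \<open>\<open>P\<close> is closed only relative to \<open>HH\<close>; boundary points
    on the real line are removed by the intersection with \<open>HH\<close>.\<close>
  obtain T where T: "closed T" "P = HH \<inter> T" using closedin_P by (auto simp: closedin_closed)
  then have "closure P \<subseteq> T" by (intro closure_minimal) auto
  then have fr: "frontier P \<inter> HH = P - interior P"
    using T P_subset_HH closure_subset[of P] by (auto simp: frontier_def)
  show ?thesis unfolding fr
  proof
    show "P - interior P \<subseteq> \<Union>{act g ` side_at t |g t. bd g t}"
    proof
      fix z assume z: "z \<in> P - interior P"
      then obtain g w where g: "g \<in> D" "w \<in> Triangle" "z = act g w" unfolding P_def by blast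
      have gc: "g \<in> \<Gamma>" using g(1) D_carrier by blast
      have "w \<notin> open_triangle" using open_triangle_interior[OF g(1)] z g(3) by blast
      then obtain t where t: "w \<in> side_at t" using Triangle_cases[OF g(2)] by blast
      have "bd g t"
      proof (rule ccontr)
        assume nb: "\<not> bd g t"
        obtain N where N: "open N" "w \<in> N" "N \<subseteq> HH" "N \<subseteq> Triangle \<union> (\<Union>l\<in>letters t. act l ` Triangle)"
          using side_at_nbhd[OF t] .
        have "act g ` N \<subseteq> P"
        proof
          fix y assume "y \<in> act g ` N"
          then obtain x where x: "x \<in> N" "y = act g x" by blast
          then consider "x \<in> Triangle" | l a where "l \<in> letters t" "a \<in> Triangle" "x = act l a"
            using N(4) by blast
          then show "y \<in> P"
          proof cases
            case 1
            then show ?thesis using g(1) x(2) unfolding P_def by blast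
          next
            case 2
            then have "y = act (g \<cdot> l) a"
              using x(2) gc letters_carrier Triangle_subset_HH by (auto simp: act_mult)
            then show ?thesis using not_bd[OF g(1) nb 2(1)] 2(2) unfolding P_def by blast
          qed
        qed
        then have "act g ` N \<subseteq> interior P" using open_act_image[OF gc N(1,3)] by (rule interior_maximal)
        then show False using N(2) g(3) z by blast
      qed
      then show "z \<in> \<Union>{act g ` side_at t |g t. bd g t}" using t g(3) by blast
    qed
    show "\<Union>{act g ` side_at t |g t. bd g t} \<subseteq> P - interior P"
    proof
      fix z assume "z \<in> \<Union>{act g ` side_at t |g t. bd g t}"
      then obtain g t w where g: "bd g t" "w \<in> side_at t" "z = act g w" by blast
      note gc = bd_carrier[OF g(1)]
      have wH: "w \<in> HH" using g(2) side_at_HH by blast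
      have "z \<in> P" using g side_at_subset[of t] bd_D[OF g(1)] unfolding P_def by blast
      moreover have "z \<notin> interior P"
      proof
        assume z: "z \<in> interior P"
        define U where "U = act (pinv g) ` interior P"
        have "interior P \<subseteq> HH" using interior_subset P_subset_HH by blast
        then have "open U" unfolding U_def using gc by (intro open_act_image) auto
        moreover have "w \<in> U" unfolding U_def
          using z act_inv_act(1)[OF gc wH] g(3) by (metis image_eqI)
        moreover have "U \<subseteq> sector t"
        proof
          fix x assume "x \<in> U"
          then obtain y where y: "y \<in> P" "x = act (pinv g) y" unfolding U_def using interior_subset by blast
          then show "x \<in> sector t"
            using act_image_iff[OF gc sector_subset_HH] P_subset_sector[OF g(1)] P_subset_HH by blast
        qed
        ultimately have "w \<in> interior (sector t)" using interior_maximal by blast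
        then show False using side_at_not_interior[OF g(2)] by blast
      qed
      ultimately show "z \<in> P - interior P" by blast
    qed
  qed
qed

lemma Union_E: "\<Union>E = frontier P \<inter> HH"
proof -
  have *: "\<Union>(sides_of g t) = act g ` side_at t" for g t
    unfolding sides_of_def Union_base_sides[of "whole g" t, symmetric] image_Union ..
  have "\<Union>E = \<Union>{\<Union>(sides_of g t) |g t. bd g t}" unfolding E_def by auto
  then show ?thesis by (simp only: * frontier_P)
qed

text \<open>A common point brings the triangles of \<open>g\<close> and \<open>h\<close> into
  contact, so \<open>pinv g \<cdot> h\<close> is trivial or a letter. A letter would be of type
  \<open>t\<close>, because the point lies on \<open>side_at t\<close>, and then \<open>h\<close>
  would lie beyond the vertex \<open>t\<close> of \<open>g\<close>.\<close>

lemma sides_meet: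
  assumes "bd g t" "bd h u" "w \<in> side_at t" "w' \<in> side_at u" "act g w = act h w'"
  shows "g = h \<and> t = u \<and> w = w'"
proof -
  note c = bd_carrier[OF assms(1)] bd_carrier[OF assms(2)]
  have w: "w \<in> HH" "w' \<in> HH" using assms side_at_HH by blast+
  let ?x = "pinv g \<cdot> h"
  have "act ?x w' = act (pinv g) (act g w)"
    using c w by (simp add: act_mult assms(5))
  then have x: "act ?x w' = w" using c w by (simp add: act_inv_act)
  have "?x \<notin> letters v" if "w \<in> side_at v" for v
    using bd_branch[OF assms(1) bd_D[OF assms(2)]] branch.letter side_at_disjoint[OF that assms(3)] by blast
  then have 1: "?x = one_psl"
    using Triangle_meets[of ?x w] x c side_at_subset assms(3,4) by blast
  then have "w' = w" using x by (simp add: act_one)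
  moreover have "g = h" using 1 c by (metis PSL.inv_equality PSL.inv_inv PSL.inv_closed PSL.inv_comm)
  ultimately show ?thesis using side_at_disjoint assms(3,4) by blast
qed

lemma E_cases:
  assumes "s \<in> E"
  obtains g t b where "bd g t" "b \<in> base_sides (whole g) t" "s = act g ` b"
  using assms unfolding E_def sides_of_def by blast

lemma E_intro: "bd g t \<Longrightarrow> b \<in> base_sides (whole g) t \<Longrightarrow> act g ` b \<in> E"
  unfolding E_def sides_of_def by blast

theorem convex_hyp_polygon_P: "convex_hyp_polygon P E"
  unfolding convex_hyp_polygon_def
proof (intro conjI ballI impI hyp_convex_P closedin_P interior_P_nonempty Union_E)
  show "geodesic_interval s" if "s \<in> E" for s
    using E_cases[OF that] geodesic_interval_act base_sides_geodesic bd_carrier by metis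
next
  fix s s' assume s: "s \<in> E" "s' \<in> E" "s \<noteq> s'"
  obtain g t b where g: "bd g t" "b \<in> base_sides (whole g) t" "s = act g ` b" using E_cases[OF s(1)] .
  obtain h u c where h: "bd h u" "c \<in> base_sides (whole h) u" "s' = act h ` c" using E_cases[OF s(2)] .
  show "s \<inter> s' \<subseteq> geodesic_endpoints s \<inter> geodesic_endpoints s'"
  proof
    fix z assume "z \<in> s \<inter> s'"
    then obtain w w' where w: "w \<in> b" "z = act g w" "w' \<in> c" "z = act h w'" using g h by blast
    then have eq: "g = h" "t = u" "w = w'"
      using sides_meet[OF g(1) h(1), of w w'] base_sides_subset[OF g(2)] base_sides_subset[OF h(2)]
      by auto
    then have "w \<in> geodesic_endpoints b" "w \<in> geodesic_endpoints c"
      using base_sides_meet[OF g(2), of c] h(2,3) g(3) s(3) w by auto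
    then show "z \<in> geodesic_endpoints s \<inter> geodesic_endpoints s'"
      using geodesic_endpoints_act[OF bd_carrier[OF g(1)]] base_sides_subset side_at_HH g h w eq
      by (metis IntI subset_trans)
  qed
next
  fix z assume "z \<in> HH"
  then obtain U where U: "open U" "z \<in> U" "finite {g \<in> \<Gamma>. act g ` Triangle \<inter> U \<noteq> {}}"
    (is "finite ?F") by (rule locally_finite_tessellation)
  let ?B = "{int_rho_0, int_rho_inf, int_0_inf, int_i_0, int_i_inf}"
  have "{s \<in> E. s \<inter> U \<noteq> {}} \<subseteq> (\<lambda>(g, b). act g ` b) ` (?F \<times> ?B)"
  proof
    fix s assume s: "s \<in> {s \<in> E. s \<inter> U \<noteq> {}}"
    then obtain g t b where g: "bd g t" "b \<in> base_sides (whole g) t" "s = act g ` b" using E_cases by blast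
    have "b \<subseteq> Triangle" using base_sides_subset[OF g(2)] side_at_subset by blast
    then have "g \<in> ?F" using s g bd_carrier[OF g(1)] by blast
    moreover have "b \<in> ?B" using g(2) by (cases "whole g"; cases t) auto
    ultimately show "s \<in> (\<lambda>(g, b). act g ` b) ` (?F \<times> ?B)"
      using g(3) by (intro image_eqI[of _ _ "(g, b)"]) auto
  qed
  moreover have "finite ((\<lambda>(g, b). act g ` b) ` (?F \<times> ?B))"
    by (rule finite_imageI, rule finite_cartesian_product, rule U(3)) simp
  ultimately have "finite {s \<in> E. s \<inter> U \<noteq> {}}" by (rule finite_subset)
  then show "\<exists>U. open U \<and> z \<in> U \<and> finite {s \<in> E. s \<inter> U \<noteq> {}}" using U by blast
qed

end


section \<open>Cut graphs and their lifts\<close>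

text \<open>The stabilizers of the two endpoints of the edge \<open>one_psl\<close>, indexed so that
  both types of vertices can be treated at once.\<close>

definition K :: "bool \<Rightarrow> psl set" where "K t = (if t then G1 else G0)"

lemma subgroup_K: "subgroup (K t) PSL2Z"
  unfolding K_def G0_def G1_def by (auto intro!: PSL.generate_is_subgroup)

lemma K_eq: "K t = insert one_psl (letters t)"
proof
  have *: "subgroup (insert one_psl (letters t)) PSL2Z"
  proof (rule PSL.subgroupI)
    show "insert one_psl (letters t) \<subseteq> \<Gamma>" using letters_carrier by auto
    show "pinv a \<in> insert one_psl (letters t)" if "a \<in> insert one_psl (letters t)" for a
      using that letters_inv by auto
    show "a \<cdot> b \<in> insert one_psl (letters t)"
      if "a \<in> insert one_psl (letters t)" "b \<in> insert one_psl (letters t)" for a b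
      using that letters_mult[of a t b] letters_carrier by auto
  qed simp
  then show "K t \<subseteq> insert one_psl (letters t)"
    unfolding K_def G0_def G1_def
    using PSL.generate_subgroup_incl[of "{Rg}" "insert one_psl (letters True)"]
      PSL.generate_subgroup_incl[of "{Sg}" "insert one_psl (letters False)"]
    by (cases t) auto
  have "Rg \<in> K True" "Sg \<in> K False" by (auto simp: K_def G0_def G1_def intro: generate.incl)
  moreover from this(1) have "R2g \<in> K True" using subgroup.m_closed[OF subgroup_K] by fastforce
  ultimately show "insert one_psl (letters t) \<subseteq> K t"
    using subgroup.one_closed[OF subgroup_K[of t]] by (cases t) auto
qed

lemma K_carrier: "k \<in> K t \<Longrightarrow> k \<in> \<Gamma>"
  using subgroup.mem_carrier[OF subgroup_K] .

definition vert_of :: "bool \<Rightarrow> psl set \<Rightarrow> comb_vertex" where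
  "vert_of t x = (if t then Inr (x <#>\<^bsub>PSL2Z\<^esub> G1) else Inl (x <#>\<^bsub>PSL2Z\<^esub> G0))"

lemma vert_of_eq_iff: "vert_of t x = vert_of u y \<longleftrightarrow> t = u \<and> x <#>\<^bsub>PSL2Z\<^esub> K t = y <#>\<^bsub>PSL2Z\<^esub> K t"
  by (auto simp: vert_of_def K_def)

lemma Y_comb_simps:
  "edges (Y_comb H) = rcosets\<^bsub>PSL2Z\<^esub> H"
  "ends (Y_comb H) x = {vert_of t x |t. True}"
  "verts (Y_comb H) = {vert_of t x |t x. x \<in> rcosets\<^bsub>PSL2Z\<^esub> H}"
proof -
  have ex: "(\<exists>t. Q t) \<longleftrightarrow> Q False \<or> Q True" for Q by (metis (full_types))
  show "edges (Y_comb H) = rcosets\<^bsub>PSL2Z\<^esub> H" by (simp add: Y_comb_def)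
  show "ends (Y_comb H) x = {vert_of t x |t. True}"
    unfolding set_eq_iff mem_Collect_eq ex by (simp add: Y_comb_def vert_of_def)
  show "verts (Y_comb H) = {vert_of t x |t x. x \<in> rcosets\<^bsub>PSL2Z\<^esub> H}"
    unfolding set_eq_iff mem_Collect_eq ex by (auto simp: Y_comb_def vert_of_def)
qed

text \<open>The vertices are double cosets. Since \<open>K t\<close> absorbs its own elements, their
  equality comes down to an equation between cosets, that is, between edges.\<close>

lemma coset_mult_K:
  assumes "subgroup H PSL2Z" "x \<in> \<Gamma>" "y \<in> \<Gamma>"
  shows "(H #>\<^bsub>PSL2Z\<^esub> x) <#>\<^bsub>PSL2Z\<^esub> K t = (H #>\<^bsub>PSL2Z\<^esub> y) <#>\<^bsub>PSL2Z\<^esub> K t \<longleftrightarrow>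
    (\<exists>k\<in>K t. H #>\<^bsub>PSL2Z\<^esub> y = H #>\<^bsub>PSL2Z\<^esub> (x \<cdot> k))"
proof -
  note H = subgroup.subset[OF assms(1)] and mem = subgroup.mem_carrier[OF assms(1)]
  have un: "(H #>\<^bsub>PSL2Z\<^esub> x) <#>\<^bsub>PSL2Z\<^esub> K t = (\<Union>k\<in>K t. H #>\<^bsub>PSL2Z\<^esub> (x \<cdot> k))"
    if "x \<in> \<Gamma>" for x
    unfolding set_mult_def r_coset_def using that
    by (auto simp: PSL.m_assoc mem K_carrier)
  show ?thesis
  proof
    assume "(H #>\<^bsub>PSL2Z\<^esub> x) <#>\<^bsub>PSL2Z\<^esub> K t = (H #>\<^bsub>PSL2Z\<^esub> y) <#>\<^bsub>PSL2Z\<^esub> K t"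
    moreover have "y \<in> (H #>\<^bsub>PSL2Z\<^esub> y) <#>\<^bsub>PSL2Z\<^esub> K t"
      unfolding un[OF assms(3)] using assms(3) PSL.rcos_self[OF assms(3,1)] K_eq by auto
    ultimately obtain k where k: "k \<in> K t" "y \<in> H #>\<^bsub>PSL2Z\<^esub> (x \<cdot> k)"
      unfolding un[OF assms(2)] by blast
    then show "\<exists>k\<in>K t. H #>\<^bsub>PSL2Z\<^esub> y = H #>\<^bsub>PSL2Z\<^esub> (x \<cdot> k)"
      using PSL.repr_independence[OF k(2) _ assms(1)] assms(2) K_carrier by fastforce
  next
    assume "\<exists>k\<in>K t. H #>\<^bsub>PSL2Z\<^esub> y = H #>\<^bsub>PSL2Z\<^esub> (x \<cdot> k)"
    then obtain k where k: "k \<in> K t" "H #>\<^bsub>PSL2Z\<^esub> y = H #>\<^bsub>PSL2Z\<^esub> (x \<cdot> k)" by blast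
    have kK: "{k} <#>\<^bsub>PSL2Z\<^esub> K t = K t"
      using PSL.coset_join3[OF K_carrier[OF k(1)] subgroup_K k(1)] by (simp add: l_coset_eq_set_mult)
    have "H #>\<^bsub>PSL2Z\<^esub> y = (H #>\<^bsub>PSL2Z\<^esub> x) <#>\<^bsub>PSL2Z\<^esub> {k}"
      using k(2) PSL.coset_mult_assoc[OF H assms(2) K_carrier[OF k(1)]] by (simp add: r_coset_eq_set_mult)
    moreover have "H #>\<^bsub>PSL2Z\<^esub> x \<subseteq> \<Gamma>" using H assms(2) by (rule PSL.r_coset_subset_G)
    ultimately show "(H #>\<^bsub>PSL2Z\<^esub> x) <#>\<^bsub>PSL2Z\<^esub> K t = (H #>\<^bsub>PSL2Z\<^esub> y) <#>\<^bsub>PSL2Z\<^esub> K t"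
      using PSL.set_mult_assoc[of "H #>\<^bsub>PSL2Z\<^esub> x" "{k}" "K t"] K_carrier[OF k(1)]
        subgroup.subset[OF subgroup_K] kK by simp
  qed
qed

locale cut_lift =
  fixes G :: "psl set" and C :: "comb_vertex set"
    and jv :: "(comb_vertex, psl set) cut_vertex \<Rightarrow> comb_vertex"
    and je :: "psl set \<Rightarrow> psl set"
  assumes subgroup_G: "subgroup G PSL2Z"
    and C_valency: "C \<subseteq> {W \<in> verts (Y_comb G). valency (Y_comb G) W = 2}"
    and tree: "is_tree (Y_cut G C)"
    and lift: "is_lift G C jv je"
begin

abbreviation cs :: "psl \<Rightarrow> psl set" where "cs x \<equiv> G #>\<^bsub>PSL2Z\<^esub> x"

section \<open>The lifted edges as a transversal\<close>

definition D :: "psl set" where "D = \<Union>(je ` edges (Y_cut G C))"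

text \<open>The endpoint of type \<open>t\<close> of the edge \<open>e\<close> in the cut graph.
  Every vertex of the cut graph has this form, which spares most distinctions between
  \<open>Cut\<close> and \<open>Uncut\<close>.\<close>

definition cv :: "bool \<Rightarrow> psl set \<Rightarrow> (comb_vertex, psl set) cut_vertex" where
  "cv t e = (if vert_of t e \<in> C then Cut (vert_of t e) e else Uncut (vert_of t e))"

definition bd :: "psl \<Rightarrow> bool \<Rightarrow> bool" where
  "bd g t \<longleftrightarrow> g \<in> D \<and> cv t (cs g) \<in> univalent_verts G C"

definition whole :: "psl \<Rightarrow> bool" where "whole g \<longleftrightarrow> vert_of False (cs g) \<in> C"

lemma G_carrier: "G \<subseteq> \<Gamma>" by (rule subgroup.subset[OF subgroup_G])

lemma edges_cut: "edges (Y_cut G C) = rcosets\<^bsub>PSL2Z\<^esub> G"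
  by (simp add: cut_graph_def Y_comb_simps)

lemma ends_cut: "ends (Y_cut G C) e = {cv t e |t. True}"
  by (auto simp: cut_graph_def Y_comb_simps cv_def)

lemma verts_cut: "verts (Y_cut G C) = {cv t e |t e. e \<in> rcosets\<^bsub>PSL2Z\<^esub> G}"
  by (auto simp: cut_graph_def Y_comb_simps cv_def intro!: imageI)

lemma cs_edge: "x \<in> \<Gamma> \<Longrightarrow> cs x \<in> rcosets\<^bsub>PSL2Z\<^esub> G"
  using G_carrier by (rule PSL.rcosetsI)

lemma edge_cs: "e \<in> rcosets\<^bsub>PSL2Z\<^esub> G \<Longrightarrow> \<exists>x\<in>\<Gamma>. e = cs x"
  by (auto simp: RCOSETS_def)

lemma rep_ex:
  assumes "e \<in> rcosets\<^bsub>PSL2Z\<^esub> G"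
  obtains g where "g \<in> \<Gamma>" "je e = {g}" "cs g = e"
proof -
  have "je e \<in> edges TT" using lift assms edges_cut by (auto simp: is_lift_def graph_map_def)
  then obtain g where g: "g \<in> \<Gamma>" "je e = {one_psl} #>\<^bsub>PSL2Z\<^esub> g"
    by (auto simp: TT_def Y_comb_simps RCOSETS_def)
  then have je: "je e = {g}" by (simp add: r_coset_def)
  moreover have "proj_edge G (je e) = e" using lift assms edges_cut by (auto simp: is_lift_def)
  ultimately have "cs g = e" by (simp add: proj_edge_def r_coset_eq_set_mult)
  then show ?thesis using that g(1) je by blast
qed

text \<open>The representative in \<open>D\<close> of the coset of \<open>x\<close>. The value of
  \<open>je\<close> is a singleton because the edges of \<open>TT\<close> are cosets of the trivial
  group.\<close>

definition rep :: "psl \<Rightarrow> psl" where "rep x = the_elem (je (cs x))"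

lemma rep:
  assumes "x \<in> \<Gamma>"
  shows "rep x \<in> D" "cs (rep x) = cs x" "je (cs x) = {rep x}" "rep x \<in> \<Gamma>"
proof -
  obtain g where g: "g \<in> \<Gamma>" "je (cs x) = {g}" "cs g = cs x"
    using rep_ex[OF cs_edge[OF assms]] .
  then have "rep x = g" by (simp add: rep_def)
  then show "rep x \<in> D" "cs (rep x) = cs x" "je (cs x) = {rep x}" "rep x \<in> \<Gamma>"
    using g cs_edge[OF assms] by (auto simp: D_def edges_cut)
qed

lemma D_props: assumes "g \<in> D" shows "g \<in> \<Gamma>" "je (cs g) = {g}"
proof -
  obtain e where e: "e \<in> rcosets\<^bsub>PSL2Z\<^esub> G" "g \<in> je e" using assms by (auto simp: D_def edges_cut)
  obtain h where "h \<in> \<Gamma>" "je e = {h}" "cs h = e" using rep_ex[OF e(1)] .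
  then show "g \<in> \<Gamma>" "je (cs g) = {g}" using e(2) by auto
qed

lemma D_inj: "g \<in> D \<Longrightarrow> h \<in> D \<Longrightarrow> cs g = cs h \<Longrightarrow> g = h"
  using D_props(2) by (metis singleton_inject)

lemma rep_D: "g \<in> D \<Longrightarrow> rep g = g"
  using D_props by (simp add: rep_def)

lemma edge_D: "e \<in> rcosets\<^bsub>PSL2Z\<^esub> G \<Longrightarrow> \<exists>g\<in>D. e = cs g"
  using edge_cs rep by metis

lemma subgroup_one: "subgroup {one_psl} PSL2Z"
  by (rule PSL.triv_subgroup)

lemma cv_eq_iff: "cv t e = cv u f \<longleftrightarrow> vert_of t e = vert_of u f \<and> (vert_of t e \<in> C \<longrightarrow> e = f)"
  by (auto simp: cv_def split: if_splits)

lemma vert_of_cs_iff: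
  assumes "x \<in> \<Gamma>" "y \<in> \<Gamma>"
  shows "vert_of t (cs x) = vert_of u (cs y) \<longleftrightarrow> t = u \<and> (\<exists>k\<in>K t. cs y = cs (x \<cdot> k))"
  unfolding vert_of_eq_iff coset_mult_K[OF subgroup_G assms] ..

lemma jv_cv:
  assumes "g \<in> D"
  shows "jv (cv t (cs g)) = vert_of t {g}"
proof -
  note g = D_props[OF assms]
  have e: "cs g \<in> edges (Y_cut G C)" using cs_edge[OF g(1)] edges_cut by simp
  have V: "cv t (cs g) \<in> verts (Y_cut G C)" using cs_edge[OF g(1)] verts_cut by blast
  have "ends TT (je (cs g)) = jv ` ends (Y_cut G C) (cs g)"
    using lift e by (auto simp: is_lift_def graph_map_def)
  then have "jv (cv t (cs g)) \<in> ends TT {g}" using g(2) ends_cut by auto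
  then obtain u where u: "jv (cv t (cs g)) = vert_of u {g}" by (auto simp: TT_def Y_comb_simps)
  have "proj_vert G (jv (cv t (cs g))) = vert_of t (cs g)"
    using lift V by (auto simp: is_lift_def cv_def)
  \<comment> \<open>The projection respects \<open>Inl\<close> and \<open>Inr\<close>, so the lift
    cannot exchange the types of the endpoints.\<close>
  then have "u = t" unfolding u proj_vert_def vert_of_def by (auto split: if_splits)
  then show ?thesis using u by simp
qed

text \<open>Edges that meet in the cut graph have lifts that meet in the tree, and there the edges
  at a vertex of type \<open>t\<close> form a left coset of \<open>K t\<close>. In this way steps in
  the cut graph become letters.\<close>

lemma cv_adjacent:
  assumes "g \<in> D" "h \<in> D" "cv t (cs g) = cv u (cs h)"
  shows "u = t \<and> (\<exists>k\<in>K t. h = g \<cdot> k)"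
proof -
  note c = D_props(1)[OF assms(1)] D_props(1)[OF assms(2)]
  have sing: "{x} = {one_psl} #>\<^bsub>PSL2Z\<^esub> x" if "x \<in> \<Gamma>" for x
    using that by (simp add: r_coset_def)
  have eq: "vert_of t {g} = vert_of u {h}" using jv_cv[OF assms(1), of t] jv_cv[OF assms(2), of u] assms(3) by simp
  then have "t = u" and "{g} <#>\<^bsub>PSL2Z\<^esub> K t = {h} <#>\<^bsub>PSL2Z\<^esub> K t" by (auto simp: vert_of_eq_iff)
  then have "({one_psl} #>\<^bsub>PSL2Z\<^esub> g) <#>\<^bsub>PSL2Z\<^esub> K t = ({one_psl} #>\<^bsub>PSL2Z\<^esub> h) <#>\<^bsub>PSL2Z\<^esub> K t"
    unfolding sing[OF c(1), symmetric] sing[OF c(2), symmetric] by blast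
  then have "\<exists>k\<in>K t. {one_psl} #>\<^bsub>PSL2Z\<^esub> h = {one_psl} #>\<^bsub>PSL2Z\<^esub> (g \<cdot> k)"
    by (rule coset_mult_K[OF subgroup_one c, THEN iffD1])
  then obtain k where k: "k \<in> K t"
    "{one_psl} #>\<^bsub>PSL2Z\<^esub> h = {one_psl} #>\<^bsub>PSL2Z\<^esub> (g \<cdot> k)" by blast
  have "{h} = {g \<cdot> k}"
    using k(2) sing[OF c(2)] sing[of "g \<cdot> k"] c(1) K_carrier[OF k(1)] by (metis PSL.m_closed)
  then show ?thesis using \<open>t = u\<close> k(1) by blast
qed

lemma cs_mult: "x \<in> \<Gamma> \<Longrightarrow> y \<in> \<Gamma> \<Longrightarrow> z \<in> \<Gamma> \<Longrightarrow> cs x = cs y \<Longrightarrow>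
    cs (x \<cdot> z) = cs (y \<cdot> z)"
  using PSL.coset_mult_assoc[OF G_carrier] by metis

text \<open>As the stabilizers of vertices have prime order, a coincidence of two of the cosets
  at a vertex makes all of them coincide.\<close>

lemma cs_coincide:
  assumes x: "x \<in> \<Gamma>" and k: "k \<in> K t" "l \<in> K t" "k \<noteq> l"
    and eq: "cs (x \<cdot> k) = cs (x \<cdot> l)" and m: "m \<in> K t"
  shows "cs (x \<cdot> m) = cs x"
proof -
  define n where "n = k \<cdot> pinv l"
  have c: "k \<in> \<Gamma>" "l \<in> \<Gamma>" using k K_carrier by auto
  have "cs (x \<cdot> k \<cdot> pinv l) = cs (x \<cdot> l \<cdot> pinv l)"
    using x c eq by (intro cs_mult) auto
  then have n1: "cs (x \<cdot> n) = cs x" using x c by (simp add: n_def PSL.m_assoc)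
  have "n \<cdot> l = k" using c by (simp add: n_def PSL.m_assoc)
  then have "n \<noteq> one_psl" using k(3) c by auto
  moreover have "n \<in> K t" unfolding n_def
    using k subgroup_K[of t] by (simp add: subgroup.m_closed subgroup.m_inv_closed)
  ultimately have n: "n \<in> letters t" unfolding K_eq by simp
  then have nc: "n \<in> \<Gamma>" by (rule letters_carrier)
  have n2: "cs (x \<cdot> (n \<cdot> n)) = cs x"
    using cs_mult[OF _ x nc n1] x nc n1 by (simp add: PSL.m_assoc)
  have "m = one_psl \<or> m = n \<or> m = n \<cdot> n"
    using m n unfolding K_eq by (cases t) auto
  then show ?thesis using n1 n2 x by auto
qed

section \<open>Valencies and univalent vertices\<close>

lemma edges_at:
  assumes "x \<in> \<Gamma>"
  shows "{f \<in> edges (Y_comb G). vert_of t (cs x) \<in> ends (Y_comb G) f} = (\<lambda>k. cs (x \<cdot> k)) ` K t"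
proof (intro equalityI subsetI)
  fix f assume "f \<in> {f \<in> edges (Y_comb G). vert_of t (cs x) \<in> ends (Y_comb G) f}"
  then have "f \<in> rcosets\<^bsub>PSL2Z\<^esub> G" "\<exists>u. vert_of t (cs x) = vert_of u f"
    by (auto simp: Y_comb_simps)
  then obtain y u where y: "y \<in> \<Gamma>" "f = cs y" "vert_of t (cs x) = vert_of u (cs y)"
    using edge_cs by blast
  then show "f \<in> (\<lambda>k. cs (x \<cdot> k)) ` K t"
    using vert_of_cs_iff[OF assms y(1), THEN iffD1] by blast
next
  fix f assume "f \<in> (\<lambda>k. cs (x \<cdot> k)) ` K t"
  then obtain k where k: "k \<in> K t" "f = cs (x \<cdot> k)" by blast
  then have "vert_of t (cs x) = vert_of t f"
    using vert_of_cs_iff[of x "x \<cdot> k" t t] assms K_carrier by auto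
  then show "f \<in> {f \<in> edges (Y_comb G). vert_of t (cs x) \<in> ends (Y_comb G) f}"
    using k assms K_carrier cs_edge by (auto simp: Y_comb_simps)
qed

text \<open>The edges at a vertex of type (1) are indexed by a group of order 3, and all of them
  coincide as soon as two do. So the valency is 3 or 1 and never 2.\<close>

lemma C_type: "vert_of t e \<in> C \<Longrightarrow> \<not> t"
proof
  assume C: "vert_of t e \<in> C" and t
  then have v: "vert_of True e \<in> verts (Y_comb G)" "valency (Y_comb G) (vert_of True e) = 2"
    using C_valency by auto
  then obtain u f where "vert_of True e = vert_of u f" "f \<in> rcosets\<^bsub>PSL2Z\<^esub> G" by (auto simp: Y_comb_simps)
  moreover from this(1) have u by (simp add: vert_of_eq_iff)
  ultimately obtain x where x: "x \<in> \<Gamma>" "vert_of True e = vert_of True (cs x)"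
    using edge_cs by (metis (full_types))
  have two: "card ((\<lambda>k. cs (x \<cdot> k)) ` K True) = 2"
    using v(2) unfolding x(2) valency_def edges_at[OF x(1)] .
  have "card (K True) = 3"
  proof -
    have "\<not> branch True one_psl" by (rule not_branch_one)
    then have "Rg \<noteq> one_psl" "R2g \<noteq> one_psl" using branch.letter[of Rg True] branch.letter[of R2g True] by auto
    moreover from this have "Rg \<noteq> R2g" using gens_mult(3) gens_mult(5) by metis
    ultimately show ?thesis by (simp add: K_eq)
  qed
  moreover have "finite (K True)" by (simp add: K_eq)
  ultimately have "\<not> inj_on (\<lambda>k. cs (x \<cdot> k)) (K True)" using two card_image by fastforce
  then obtain k l where "k \<in> K True" "l \<in> K True" "k \<noteq> l" "cs (x \<cdot> k) = cs (x \<cdot> l)"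
    by (auto simp: inj_on_def)
  then have "(\<lambda>k. cs (x \<cdot> k)) ` K True \<subseteq> {cs x}" using cs_coincide[OF x(1)] by blast
  then have "card ((\<lambda>k. cs (x \<cdot> k)) ` K True) \<le> 1" using card_mono[of "{cs x}"] by fastforce
  then show False using two by simp
qed

text \<open>A copy of a cut vertex carries just the edge in its name. At an uncut vertex the edges
  are the cosets \<open>cs (x \<cdot> k)\<close>, which must all coincide.\<close>

lemma univalent_iff:
  assumes "x \<in> \<Gamma>"
  shows "cv t (cs x) \<in> univalent_verts G C \<longleftrightarrow>
    vert_of t (cs x) \<in> C \<or> (\<forall>k\<in>K t. cs (x \<cdot> k) = cs x)"
proof -
  let ?V = "cv t (cs x)"
  define A where "A = {e \<in> edges (Y_cut G C). ?V \<in> ends (Y_cut G C) e}"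
  have Veq: "?V \<in> verts (Y_cut G C)" using cs_edge[OF assms] verts_cut by blast
  have xA: "cs x \<in> A" using cs_edge[OF assms] by (auto simp: A_def edges_cut ends_cut)
  have A: "A = {f \<in> rcosets\<^bsub>PSL2Z\<^esub> G. \<exists>u. cv t (cs x) = cv u f}" by (auto simp: A_def edges_cut ends_cut)
  have "?V \<in> univalent_verts G C \<longleftrightarrow> card A = 1"
    using Veq by (simp add: univalent_verts_def valency_def A_def)
  also have "\<dots> \<longleftrightarrow> (\<forall>e\<in>A. e = cs x)"
    using xA unfolding One_nat_def card_1_singleton_iff by blast
  also have "\<dots> \<longleftrightarrow> vert_of t (cs x) \<in> C \<or> (\<forall>k\<in>K t. cs (x \<cdot> k) = cs x)"
  proof (cases "vert_of t (cs x) \<in> C")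
    case True
    have "e = cs x" if "e \<in> A" for e using that True unfolding A cv_eq_iff by blast
    then show ?thesis using True by blast
  next
    case False
    have "A = (\<lambda>k. cs (x \<cdot> k)) ` K t"
    proof (intro equalityI subsetI)
      fix f assume "f \<in> A"
      then obtain u where f: "f \<in> rcosets\<^bsub>PSL2Z\<^esub> G" "vert_of t (cs x) = vert_of u f"
        unfolding A cv_eq_iff by blast
      obtain y where y: "y \<in> \<Gamma>" "f = cs y" using edge_cs[OF f(1)] by blast
      then have "\<exists>k\<in>K t. cs y = cs (x \<cdot> k)"
        using f(2) vert_of_cs_iff[OF assms y(1), THEN iffD1] by blast
      then show "f \<in> (\<lambda>k. cs (x \<cdot> k)) ` K t" using y(2) by blast
    next
      fix f assume "f \<in> (\<lambda>k. cs (x \<cdot> k)) ` K t"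
      then obtain k where k: "k \<in> K t" "f = cs (x \<cdot> k)" by blast
      then have "vert_of t (cs x) = vert_of t f"
        using vert_of_cs_iff[of x "x \<cdot> k" t t] assms K_carrier by auto
      moreover have "f \<in> rcosets\<^bsub>PSL2Z\<^esub> G" using k assms K_carrier cs_edge by simp
      ultimately show "f \<in> A" unfolding A cv_eq_iff using False by blast
    qed
    then show ?thesis using False by simp
  qed
  finally show ?thesis .
qed

text \<open>The lift of the edge \<open>cs (g \<cdot> l)\<close> meets \<open>g\<close> at the uncut
  vertex, so it is \<open>g \<cdot> k\<close> for some \<open>k\<close>. Were \<open>k\<close>
  different from \<open>l\<close>, all cosets at the vertex would coincide and the vertex would be
  univalent.\<close>

lemma not_bd:
  assumes g: "g \<in> D" "\<not> bd g t" and l: "l \<in> letters t"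
  shows "g \<cdot> l \<in> D"
proof -
  note gc = D_props(1)[OF g(1)]
  have lc: "l \<in> \<Gamma>" "l \<in> K t" using l letters_carrier by (auto simp: K_eq)
  have nb: "vert_of t (cs g) \<notin> C" "\<not> (\<forall>k\<in>K t. cs (g \<cdot> k) = cs g)"
    using g univalent_iff[OF gc, of t] by (auto simp: bd_def)
  define h where "h = rep (g \<cdot> l)"
  have h: "h \<in> D" "cs h = cs (g \<cdot> l)" using rep gc lc by (auto simp: h_def)
  have "vert_of t (cs g) = vert_of t (cs h)"
    using vert_of_cs_iff[OF gc D_props(1)[OF h(1)], of t t] h(2) lc(2) by blast
  then have "cv t (cs g) = cv t (cs h)" using nb(1) by (simp add: cv_eq_iff)
  then obtain k where k: "k \<in> K t" "h = g \<cdot> k" using cv_adjacent[OF g(1) h(1)] by blast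
  then have "k = l" using cs_coincide[OF gc k(1) lc(2)] h(2) nb(2) by blast
  then show ?thesis using h k by simp
qed

text \<open>That no edge at a vertex lies in the branch is a property that spreads along walks in
  the cut graph: the branch can be entered only from \<open>g\<close> through its vertex
  \<open>t\<close>, and at this univalent vertex there is no second edge to continue with. As the
  cut graph is connected, the walks reach all edges of \<open>D\<close>.\<close>

lemma bd_branch:
  assumes b: "bd g t" and x: "x \<in> D"
  shows "\<not> branch t (pinv g \<cdot> x)"
proof -
  have g: "g \<in> D" "cv t (cs g) \<in> univalent_verts G C" using b by (auto simp: bd_def)
  note gc = D_props(1)[OF g(1)]
  \<comment> \<open>Every edge at \<open>V\<close> is tested; the one along which a walk leaves
    \<open>V\<close> is among them.\<close>
  define good where "good V \<longleftrightarrow> (\<forall>h\<in>D. \<forall>u. V = cv u (cs h) \<longrightarrow> \<not> branch t (pinv g \<cdot> h))" for V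
  have uni: "h = g" if h: "h \<in> D" "cv t (cs g) = cv u (cs h)" for h u
  proof -
    have ut: "u = t" "vert_of t (cs g) = vert_of u (cs h)" using cv_adjacent[OF g(1) h(1)] h(2) cv_eq_iff by blast+
    have "cs h = cs g"
    proof (cases "vert_of t (cs g) \<in> C")
      case True
      then show ?thesis using h(2) cv_eq_iff by metis
    next
      case False
      then have "\<forall>k\<in>K t. cs (g \<cdot> k) = cs g" using univalent_iff[OF gc] g(2) by blast
      then show ?thesis using ut vert_of_cs_iff[OF gc D_props(1)[OF h(1)]] by metis
    qed
    then show ?thesis using D_inj g(1) h(1) by blast
  qed
  have start: "good (cv t (cs g))"
    unfolding good_def using uni gc not_branch_one by fastforce
  have step: "good W" if V: "good V" and e: "e \<in> edges (Y_cut G C)" "ends (Y_cut G C) e = {V, W}" for V W e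
    unfolding good_def
  proof (intro ballI allI impI notI)
    fix h' u assume h': "h' \<in> D" "W = cv u (cs h')" and br: "branch t (pinv g \<cdot> h')"
    obtain h where h: "h \<in> D" "e = cs h" using edge_D e(1) edges_cut by blast
    have "V \<in> {cv t (cs h) |t. True}" "W \<in> {cv t (cs h) |t. True}"
      using e(2) unfolding ends_cut h(2) by blast+
    then obtain v w where vw: "V = cv v (cs h)" "W = cv w (cs h)" by blast
    have nb: "\<not> branch t (pinv g \<cdot> h)" using V vw(1) h(1) unfolding good_def by blast
    have uw: "cv w (cs h) = cv u (cs h')" using vw h' by simp
    obtain k where k: "u = w" "k \<in> K w" "h' = h \<cdot> k" using cv_adjacent[OF h(1) h'(1) uw] by blast
    note hc = D_props(1)[OF h(1)]
    show False
    proof (cases "k = one_psl")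
      case True
      then show ?thesis using nb br k(3) hc by simp
    next
      case False
      then have kl: "k \<in> letters w" using k(2) by (simp add: K_eq)
      have "branch t (pinv g \<cdot> h \<cdot> k)"
        using br k(3) hc gc letters_carrier[OF kl] by (simp add: PSL.m_assoc)
      then have "pinv g \<cdot> h = one_psl" "w = t"
        using branch_enter[OF _ nb _ kl] gc hc by auto
      then have "h = g" using gc hc by (metis PSL.inv_closed PSL.inv_equality PSL.inv_inv PSL.inv_comm)
      then have "h' = g" using uni[OF h'(1)] uw \<open>w = t\<close> by blast
      then show False using br gc not_branch_one by simp
    qed
  qed
  have walk: "walk (Y_cut G C) V es W \<Longrightarrow> good V \<Longrightarrow> good W" for V es W
  proof (induction es arbitrary: V)
    case (Cons e es)
    then obtain V' where "e \<in> edges (Y_cut G C)" "ends (Y_cut G C) e = {V, V'}" "walk (Y_cut G C) V' es W"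
      by auto
    then show ?case using Cons.IH step[OF Cons.prems(2)] by blast
  qed simp
  have "cv t (cs g) \<in> verts (Y_cut G C)" "cv t (cs x) \<in> verts (Y_cut G C)"
    using verts_cut cs_edge gc D_props(1)[OF x] by blast+
  then have "good (cv t (cs x))" using tree walk start unfolding is_tree_def by blast
  then show ?thesis unfolding good_def using x by blast
qed

end

sublocale cut_lift \<subseteq> tree_domain D bd whole
proof
  show "D \<subseteq> \<Gamma>" using D_props by blast
  show "D \<noteq> {}" using rep(1)[of "one_psl"] by auto
  show "\<And>g t. bd g t \<Longrightarrow> g \<in> D" by (simp add: bd_def)
qed (simp_all add: bd_branch not_bd)

context cut_lift begin

section \<open>The sides at the univalent vertices\<close>

lemma polygon_eq: "polygon G C je = P"
  unfolding polygon_def P_def by (simp add: D_def)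

lemma univalent_cases:
  assumes "V \<in> univalent_verts G C"
  obtains g t where "bd g t" "V = cv t (cs g)"
proof -
  have "V \<in> verts (Y_cut G C)" using assms by (simp add: univalent_verts_def)
  then obtain t e where "V = cv t e" "e \<in> rcosets\<^bsub>PSL2Z\<^esub> G" unfolding verts_cut by blast
  moreover from this(2) obtain g where "g \<in> D" "e = cs g" using edge_D by blast
  ultimately show ?thesis using that[of g t] assms by (simp add: bd_def)
qed

lemma bd_cv_inj:
  assumes "bd g t" "h \<in> D" "cv t (cs g) = cv u (cs h)"
  shows "h = g \<and> u = t"
proof -
  have g: "g \<in> D" "cv t (cs g) \<in> univalent_verts G C" using assms by (auto simp: bd_def)
  note c = D_props(1)[OF g(1)] D_props(1)[OF assms(2)]
  have u: "u = t" using cv_adjacent[OF g(1) assms(2,3)] by blast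
  obtain k where k: "k \<in> K t" "h = g \<cdot> k" using cv_adjacent[OF g(1) assms(2,3)] by blast
  have "cs h = cs g"
  proof (cases "vert_of t (cs g) \<in> C")
    case True
    then have "cs g = cs h" using assms(3) unfolding cv_eq_iff by blast
    then show ?thesis by simp
  next
    case False
    then have "\<forall>k\<in>K t. cs (g \<cdot> k) = cs g" using univalent_iff[OF c(1)] g(2) by blast
    then show ?thesis using k by simp
  qed
  then show ?thesis using D_inj assms(2) g(1) u by blast
qed

lemma elt_at_cv:
  assumes "bd g t"
  shows "elt_at G C je (cv t (cs g)) = g"
proof -
  have g: "g \<in> D" using assms by (simp add: bd_def)
  have "(THE e. e \<in> edges (Y_cut G C) \<and> cv t (cs g) \<in> ends (Y_cut G C) e) = cs g"
  proof (rule the_equality)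
    show "cs g \<in> edges (Y_cut G C) \<and> cv t (cs g) \<in> ends (Y_cut G C) (cs g)"
      using cs_edge[OF D_props(1)[OF g]] by (auto simp: edges_cut ends_cut)
    fix e assume e: "e \<in> edges (Y_cut G C) \<and> cv t (cs g) \<in> ends (Y_cut G C) e"
    then obtain h where "h \<in> D" "e = cs h" using edge_D edges_cut by blast
    then show "e = cs g" using e bd_cv_inj[OF assms, of h] by (auto simp: ends_cut)
  qed
  then show ?thesis using D_props(2)[OF g] by (simp add: elt_at_def)
qed

lemma sides_cv:
  assumes "bd g t"
  shows "sides G C je (cv t (cs g)) = sides_of g t"
proof (cases t)
  case True
  then have "cv t (cs g) = Uncut (vert_of True (cs g))" using C_type by (auto simp: cv_def)
  then show ?thesis using elt_at_cv[OF assms] True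
    by (simp add: sides_def sides_of_def vert_of_def Let_def)
next
  case False
  then show ?thesis using elt_at_cv[OF assms]
    by (cases "whole g") (simp_all add: whole_def cv_def sides_def sides_of_def vert_of_def Let_def)
qed

lemma polygon_edges_eq: "polygon_edges G C je = E"
proof
  show "polygon_edges G C je \<subseteq> E"
  proof
    fix s assume "s \<in> polygon_edges G C je"
    then obtain V where V: "V \<in> univalent_verts G C" "s \<in> sides G C je V" by (auto simp: polygon_edges_def)
    obtain g t where "bd g t" "V = cv t (cs g)" using univalent_cases[OF V(1)] .
    then show "s \<in> E" using V(2) sides_cv unfolding E_def by blast
  qed
  show "E \<subseteq> polygon_edges G C je"
  proof
    fix s assume "s \<in> E"
    then obtain g t where "bd g t" "s \<in> sides_of g t" unfolding E_def by blast
    then show "s \<in> polygon_edges G C je" using sides_cv by (auto simp: polygon_edges_def bd_def)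
  qed
qed

end


section \<open>Tangent directions and rays\<close>

lemma int_rho_0_neq: "int_rho_0 \<noteq> int_rho_inf"
proof -
  have "Complex (1 / 2) 2 \<in> int_rho_inf"
    using real_sqrt_le_mono[of 3 16] by (simp add: int_rho_inf_def HH_def)
  moreover have "Complex (1 / 2) 2 \<notin> int_rho_0"
    by (auto simp: int_rho_0_def cmod_def power2_eq_square)
  ultimately show ?thesis by blast
qed

lemma int_i_neq: "int_i_0 \<noteq> int_i_inf" "int_0_inf \<noteq> int_i_0" "int_0_inf \<noteq> int_i_inf"
proof -
  have "Complex 0 2 \<in> int_i_inf" "Complex 0 2 \<notin> int_i_0" "Complex 0 2 \<in> int_0_inf"
    "Complex 0 (1 / 2) \<in> int_0_inf" "Complex 0 (1 / 2) \<notin> int_i_inf"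
    by (auto simp: int_i_inf_def int_i_0_def int_0_inf_def HH_def)
  then show "int_i_0 \<noteq> int_i_inf" "int_0_inf \<noteq> int_i_0" "int_0_inf \<noteq> int_i_inf" by blast+
qed

lemma base_sides_nonempty: "b \<in> base_sides c t \<Longrightarrow> b \<noteq> {}"
  using int_i_Int int_rho_Int by (cases c; cases t) (auto simp: int_0_inf_def HH_def intro: exI[of _ \<i>])

lemma base_sides_False: "b \<in> base_sides c False \<Longrightarrow> b = int_0_inf \<or> b = int_i_0 \<or> b = int_i_inf"
  by (cases c) auto

text \<open>An element taking a side to a side moves a point of the triangle into the triangle, so
  it is the identity or a letter whose type is that of both sides; it remains to follow the
  intervals under the letters. The uniqueness of the side pairings rests on this.\<close>

lemma base_image:
  assumes x: "x \<in> \<Gamma>" and b: "b \<in> base_sides c t" "b' \<in> base_sides c' t'"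
    and eq: "act x ` b = b'"
  shows "t = t' \<and> (x = one_psl \<and> b = b' \<or>
    x = Sg \<and> \<not> t \<and> (b = int_0_inf \<and> b' = int_0_inf \<or> b = int_i_0 \<and> b' = int_i_inf \<or> b = int_i_inf \<and> b' = int_i_0) \<or>
    x = Rg \<and> t \<and> b = int_rho_inf \<and> b' = int_rho_0 \<or>
    x = R2g \<and> t \<and> b = int_rho_0 \<and> b' = int_rho_inf)"
proof -
  obtain w where w: "w \<in> b" using base_sides_nonempty[OF b(1)] by blast
  have side: "w \<in> side_at t" "act x w \<in> side_at t'"
    using w base_sides_subset b eq by blast+
  then have tri: "w \<in> Triangle" "act x w \<in> Triangle" and wH: "w \<in> HH"
    using side_at_subset side_at_HH by blast+
  from Triangle_meets[OF x _ tri(2)] tri(1)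
  consider "x = one_psl" | u where "x \<in> letters u" "act x w \<in> side_at u" by blast
  then show ?thesis
  proof cases
    case 1
    then show ?thesis using side side_at_disjoint eq by (simp add: act_image_one act_one)
  next
    case 2
    then have u: "u = t'" using side side_at_disjoint by blast
    have "pinv x \<in> letters u" using letters_inv 2 by blast
    then have "w \<in> act (pinv x) ` sector u \<inter> sector u"
      using tri Triangle_subset_sector act_inv_act(1)[OF x wH] by (metis IntI image_eqI subsetD)
    then have "w \<in> side_at u" using letter_sector_Int[OF \<open>pinv x \<in> letters u\<close>] by blast
    then have t: "t = u" using side side_at_disjoint by blast
    show ?thesis
    proof (cases u)
      case False
      then have x: "x = Sg" using 2(1) by simp
      have "b \<in> base_sides c False" using b(1) t False by simp
      then have "b = int_0_inf \<or> b = int_i_0 \<or> b = int_i_inf" by (rule base_sides_False)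
      then have "b = int_0_inf \<and> b' = int_0_inf \<or> b = int_i_0 \<and> b' = int_i_inf \<or> b = int_i_inf \<and> b' = int_i_0"
        using eq unfolding x using act_Sg_int_0_inf act_Sg_int_i_0 act_Sg_int_i_inf by metis
      moreover have "t = t'" "\<not> t'" using t u False by simp_all
      ultimately show ?thesis using x by (elim disjE) simp_all
    next
      case True
      have sub: "int_rho_0 \<subseteq> HH" "int_rho_inf \<subseteq> HH" by (auto simp: int_subset_HH)
      have bb: "b = int_rho_0 \<or> b = int_rho_inf" "b' = int_rho_0 \<or> b' = int_rho_inf"
        using b t u True by auto
      have 1: "act R2g ` act Rg ` int_rho_0 = int_rho_0"
        using act_image_mult[OF gens_in_carrier(3,2) sub(1)] by (simp add: act_image_one)
      have 2: "act Rg ` act Rg ` int_rho_inf = act R2g ` int_rho_inf"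
        using act_image_mult[OF gens_in_carrier(2,2) sub(2)] by simp
      have 3: "act Rg ` act R2g ` int_rho_inf = int_rho_inf"
        using act_image_mult[OF gens_in_carrier(2,3) sub(2)] by (simp add: act_image_one)
      \<comment> \<open>\<open>Rg\<close> permutes the three geodesic rays from rho to 0, 1 and
        infinity cyclically, and the one to 1, the image of \<open>int_rho_0\<close>, is not a side
        of the triangle.\<close>
      have R0: "act Rg ` int_rho_0 \<noteq> int_rho_0"
        using 1 act_R2g_int_rho_0 int_rho_0_neq by metis
      have R1: "act Rg ` int_rho_0 \<noteq> int_rho_inf"
        using 1 2 act_Rg_int_rho_inf int_rho_0_neq by metis
      have R2: "act R2g ` int_rho_inf \<noteq> int_rho_0" "act R2g ` int_rho_inf \<noteq> int_rho_inf"
        using 2 3 act_Rg_int_rho_inf R0 R1 int_rho_0_neq by metis+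
      have "x = Rg \<or> x = R2g" using \<open>x \<in> letters u\<close> True by simp
      then have "x = Rg \<and> b = int_rho_inf \<and> b' = int_rho_0 \<or> x = R2g \<and> b = int_rho_0 \<and> b' = int_rho_inf"
        using bb eq R0 R1 R2 act_Rg_int_rho_inf act_R2g_int_rho_0 by metis
      moreover have "t = t'" t' using t u True by simp_all
      ultimately show ?thesis by (elim disjE) simp_all
    qed
  qed
qed

lemma act_deriv_inv:
  assumes g: "g \<in> \<Gamma>" and z: "z \<in> HH"
  obtains c where "c \<noteq> 0" "(act g has_field_derivative c) (at z)"
    "(act (pinv g) has_field_derivative 1 / c) (at (act g z))"
proof -
  obtain c where c: "c \<noteq> 0" "(act g has_field_derivative c) (at z)" using act_deriv[OF g z] .
  have "act g z \<in> HH" using g z by (rule act_in_HH)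
  with g obtain d where d: "(act (pinv g) has_field_derivative d) (at (act g z))"
    using act_deriv[OF PSL.inv_closed] by metis
  have "((act (pinv g) \<circ> act g) has_field_derivative d * c) (at z)"
    using DERIV_chain[OF d c(2)] .
  moreover have "((act (pinv g) \<circ> act g) has_field_derivative 1) (at z)"
    by (rule has_field_derivative_transform_within_open[OF DERIV_ident open_HH z])
      (simp add: act_inv_act(1) g)
  ultimately have "d * c = 1" by (rule DERIV_unique)
  then have "d = 1 / c" using c(1) by (simp add: field_simps)
  then show ?thesis using c d by (intro that[of c]) simp_all
qed

text \<open>A conformal map turns directions by the argument of its derivative. The inverse map is
  needed to transport the limit along \<open>s\<close> to a limit along the image of
  \<open>s\<close>.\<close>

lemma tangent_act:
  assumes g: "g \<in> \<Gamma>" and s: "s \<subseteq> HH" and c: "c \<noteq> 0" "(act g has_field_derivative c) (at v)"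
    and t: "tangent_direction s v \<alpha>"
  shows "tangent_direction (act g ` s) (act g v) (\<alpha> + Arg c)"
proof -
  have v: "v \<in> s" "at v within s \<noteq> bot" and lim: "((\<lambda>z. sgn (z - v)) \<longlongrightarrow> cis \<alpha>) (at v within s)"
    using t by (auto simp: tangent_direction_def trivial_limit_within)
  have vH: "v \<in> HH" using v s by blast
  have inj: "act g z \<noteq> act g v" if "z \<in> s" "z \<noteq> v" for z
    using that act_inj[OF g, of z v] vH s by blast
  have fl: "filterlim (act g) (at (act g v) within act g ` s) (at v within s)"
    unfolding filterlim_at
  proof
    show "((act g) \<longlongrightarrow> act g v) (at v within s)"
      using c(2) DERIV_isCont isCont_def tendsto_within_subset by blast
    show "\<forall>\<^sub>F z in at v within s. act g z \<in> act g ` s \<and> act g z \<noteq> act g v"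
      using inj by (auto simp: eventually_at_filter)
  qed
  let ?k = "act (pinv g)"
  have fk: "filterlim ?k (at v within s) (at (act g v) within act g ` s)"
    unfolding filterlim_at
  proof
    have "isCont ?k (act g v)"
      using continuous_on_act[of "pinv g"] g open_HH act_in_HH[OF g vH]
      by (simp add: continuous_on_eq_continuous_at)
    then have "(?k \<longlongrightarrow> ?k (act g v)) (at (act g v) within act g ` s)"
      using isCont_def tendsto_within_subset by blast
    then show "(?k \<longlongrightarrow> v) (at (act g v) within act g ` s)" using act_inv_act(1)[OF g vH] by simp
    have "?k y \<in> s \<and> ?k y \<noteq> v" if "y \<in> act g ` s" "y \<noteq> act g v" for y
      using that act_inv_act(1)[OF g] s by auto
    then show "\<forall>\<^sub>F y in at (act g v) within act g ` s. ?k y \<in> s \<and> ?k y \<noteq> v"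
      by (auto simp: eventually_at_filter)
  qed
  have "((\<lambda>z. (act g z - act g v) / (z - v)) \<longlongrightarrow> c) (at v within s)"
    using c(2) unfolding has_field_derivative_iff by (rule tendsto_within_subset) simp
  then have "((\<lambda>z. sgn ((act g z - act g v) / (z - v)) * sgn (z - v)) \<longlongrightarrow> sgn c * cis \<alpha>) (at v within s)"
    using c(1) lim by (intro tendsto_mult tendsto_sgn)
  moreover have "sgn c * cis \<alpha> = cis (\<alpha> + Arg c)" using c(1) cis_Arg[OF c(1)] by (simp add: cis_mult[symmetric])
  ultimately have L: "((\<lambda>z. sgn ((act g z - act g v) / (z - v)) * sgn (z - v)) \<longlongrightarrow> cis (\<alpha> + Arg c)) (at v within s)"
    by simp
  have "((\<lambda>z. sgn (act g z - act g v)) \<longlongrightarrow> cis (\<alpha> + Arg c)) (at v within s)"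
  proof (rule Lim_transform_eventually[OF L])
    have "sgn (a / d) * sgn d = sgn a" if "d \<noteq> 0" for a d :: complex
      unfolding sgn_mult[symmetric] using that by simp
    then show "\<forall>\<^sub>F z in at v within s.
        sgn ((act g z - act g v) / (z - v)) * sgn (z - v) = sgn (act g z - act g v)"
      unfolding eventually_at_filter by (intro always_eventually) simp
  qed
  from filterlim_compose[OF this fk]
  have L2: "((\<lambda>y. sgn (act g (?k y) - act g v)) \<longlongrightarrow> cis (\<alpha> + Arg c)) (at (act g v) within act g ` s)" .
  have "((\<lambda>y. sgn (y - act g v)) \<longlongrightarrow> cis (\<alpha> + Arg c)) (at (act g v) within act g ` s)"
  proof (rule Lim_transform_eventually[OF L2])
    have "act g (?k y) = y" if "y \<in> act g ` s" for y
      using that act_inv_act(2)[OF g] act_image_subset[OF g s] by blast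
    then show "\<forall>\<^sub>F y in at (act g v) within act g ` s. sgn (act g (?k y) - act g v) = sgn (y - act g v)"
      by (auto simp: eventually_at_filter)
  qed
  moreover have "at (act g v) within act g ` s \<noteq> bot"
    using fl v(2) unfolding filterlim_def by (metis bot.extremum_uniqueI filtermap_bot_iff)
  ultimately show ?thesis using v(1) by (auto simp: tangent_direction_def trivial_limit_within)
qed

lemma tangent_vertical:
  assumes "0 < y" "s = {z \<in> HH. Re z = x \<and> Im z \<ge> y}"
  shows "tangent_direction s (Complex x y) (pi / 2)"
  unfolding tangent_direction_def
proof (intro conjI)
  show "Complex x y \<in> s" using assms by (simp add: HH_def)
  show "Complex x y islimpt s"
    unfolding islimpt_approachable
  proof (intro allI impI)
    fix e :: real assume "0 < e"
    moreover have "cmod (Complex x (y + e / 2) - Complex x y) = \<bar>e / 2\<bar>" by (simp add: cmod_def)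
    ultimately show "\<exists>z\<in>s. z \<noteq> Complex x y \<and> dist z (Complex x y) < e"
      using assms by (intro bexI[of _ "Complex x (y + e / 2)"]) (auto simp: HH_def dist_norm)
  qed
  have "sgn (z - Complex x y) = cis (pi / 2)" if "z \<in> s" "z \<noteq> Complex x y" for z
  proof -
    have "z - Complex x y = of_real (Im z - y) * \<i>" "0 < Im z - y"
      using that assms by (auto simp: complex_eq_iff)
    moreover have "sgn (complex_of_real p * \<i>) = \<i>" if "0 < p" for p
      using that by (simp only: sgn_mult sgn_of_real) (simp add: sgn_eq)
    ultimately show ?thesis by (simp only: cis_pi_half)
  qed
  then show "((\<lambda>z. sgn (z - Complex x y)) \<longlongrightarrow> cis (pi / 2)) (at (Complex x y) within s)"
    by (intro Lim_transform_eventually[OF tendsto_const]) (auto simp: eventually_at_filter)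
qed

lemma tangent_shift: "tangent_direction s v \<alpha> \<Longrightarrow> cis \<alpha> = cis \<beta> \<Longrightarrow> tangent_direction s v \<beta>"
  by (simp add: tangent_direction_def)

lemma tangent_int_i_inf: "tangent_direction int_i_inf \<i> (pi / 2)"
proof -
  have "\<i> = Complex 0 1" by (simp add: complex_eq_iff)
  then show ?thesis using tangent_vertical[of 1 int_i_inf 0] by (simp add: int_i_inf_def)
qed

text \<open>\<open>Sg\<close> is the half turn about \<open>\<i>\<close>, with derivative -1 there,
  and exchanges the two halves of the imaginary axis.\<close>

lemma tangent_int_i_0: "tangent_direction int_i_0 \<i> (- (pi / 2))"
proof -
  have "(act Sg has_field_derivative - 1) (at \<i>)" using act_Sg_deriv[of \<i>] by simp
  from tangent_act[OF gens_in_carrier(1) int_subset_HH(3) _ this tangent_int_i_inf]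
  have "tangent_direction int_i_0 \<i> (pi / 2 + Arg (- 1))" by (simp add: act_Sg_int_i_inf act_Sg_i)
  moreover have "Arg (- 1) = pi" using Arg_cis[of pi] by simp
  ultimately have "tangent_direction int_i_0 \<i> (pi / 2 + pi)" by (simp only:)
  moreover have "cis (pi / 2 + pi) = cis (- (pi / 2))"
    unfolding cis_mult[symmetric] by (simp add: complex_eq_iff)
  ultimately show ?thesis by (rule tangent_shift)
qed

lemma rho_cis: "rho = cis (pi / 3)" "1 - rho = cis (- (pi / 3))"
  by (simp_all add: complex_eq_iff cos_60 sin_60)

lemma tangent_int_rho_inf: "tangent_direction int_rho_inf rho (pi / 2)"
  using tangent_vertical[of "sqrt 3 / 2" int_rho_inf "1 / 2"] by (simp add: int_rho_inf_def)

text \<open>\<open>Rg\<close> is the rotation about rho through the angle 2 pi / 3, which reappears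
  as the internal angle at vertices of type (1).\<close>

lemma act_Rg_deriv_rho: "(act Rg has_field_derivative cis (2 * pi / 3)) (at rho)"
proof -
  have "1 / (1 - rho)\<^sup>2 = cis (2 * pi / 3)"
  proof -
    have "(1 - rho)\<^sup>2 = cis (- (2 * pi / 3))"
      unfolding rho_cis(2) power2_eq_square cis_mult by simp
    then have "1 / (1 - rho)\<^sup>2 = cis 0 / cis (- (2 * pi / 3))" by (simp only: cis_zero)
    then show ?thesis unfolding cis_divide by simp
  qed
  then show ?thesis using act_Rg_deriv[of rho] by simp
qed

lemma act_R2g_deriv_rho: "(act R2g has_field_derivative cis (- (2 * pi / 3))) (at rho)"
proof -
  have c: "cis (2 * pi / 3) \<noteq> 0" by simp
  obtain d where d: "(act Rg has_field_derivative d) (at rho)"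
    "(act R2g has_field_derivative 1 / d) (at (act Rg rho))"
    using act_deriv_inv[of Rg rho] by auto
  have "d = cis (2 * pi / 3)" using DERIV_unique d(1) act_Rg_deriv_rho by blast
  then have "1 / d = cis (- (2 * pi / 3))" by (simp add: inverse_eq_divide[symmetric] cis_inverse)
  then show ?thesis using d(2) act_Rg_rho by simp
qed

lemma tangent_int_rho_0: "tangent_direction int_rho_0 rho (pi / 2 + 2 * pi / 3)"
proof -
  have "Arg (cis (2 * pi / 3)) = 2 * pi / 3" by (rule Arg_cis) (use pi_gt_zero in simp_all)
  moreover have "cis (2 * pi / 3) \<noteq> 0" by simp
  note tangent_act[OF gens_in_carrier(2) int_subset_HH(5) this act_Rg_deriv_rho tangent_int_rho_inf]
  ultimately show ?thesis by (simp only: act_Rg_int_rho_inf act_Rg_rho)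
qed

lemma ray_deriv:
  assumes "(f has_field_derivative c) (at v)"
  shows "((\<lambda>r. (f (v + of_real r * u) - f v) / of_real r) \<longlongrightarrow> c * u) (at_right (0 :: real))"
proof (cases "u = 0")
  case False
  have "((\<lambda>r. v + of_real r * u) \<longlongrightarrow> v) (at_right (0 :: real))"
    by (auto intro!: tendsto_eq_intros)
  moreover have "\<forall>\<^sub>F r in at_right (0 :: real). v + of_real r * u \<in> UNIV \<and> v + of_real r * u \<noteq> v"
    using False by (auto simp: eventually_at_filter)
  ultimately have "filterlim (\<lambda>r. v + of_real r * u) (at v) (at_right (0 :: real))"
    unfolding filterlim_at by blast
  from filterlim_compose[OF assms[unfolded has_field_derivative_iff] this]
  have "((\<lambda>r. (f (v + of_real r * u) - f v) / (of_real r * u) * u) \<longlongrightarrow> c * u) (at_right (0 :: real))"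
    by (intro tendsto_mult tendsto_const) simp
  then show ?thesis using False by simp
qed simp

text \<open>To first order the sign of the directional derivative decides on which side of a
  vertical geodesic a ray starts. The conditions on angles and orientations are reduced to this by
  choosing \<open>f\<close> as a group element that makes the boundary vertical.\<close>

lemma ray_Re:
  assumes "(f has_field_derivative c) (at v)"
  shows "0 < Re (c * u) \<Longrightarrow> \<forall>\<^sub>F r in at_right 0. Re (f v) < Re (f (v + of_real r * u))"
    "Re (c * u) < 0 \<Longrightarrow> \<forall>\<^sub>F r in at_right 0. Re (f (v + of_real r * u)) < Re (f v)"
proof -
  have lim: "((\<lambda>r. (Re (f (v + of_real r * u)) - Re (f v)) / r) \<longlongrightarrow> Re (c * u)) (at_right 0)"
    using tendsto_Re[OF ray_deriv[OF assms, of u]] by simp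
  have pos: "\<forall>\<^sub>F r in at_right (0 :: real). 0 < r" by (simp add: eventually_at_right_less)
  show "\<forall>\<^sub>F r in at_right 0. Re (f v) < Re (f (v + of_real r * u))" if "0 < Re (c * u)"
    using order_tendstoD(1)[OF lim that] pos by eventually_elim (simp add: zero_less_divide_iff)
  show "\<forall>\<^sub>F r in at_right 0. Re (f (v + of_real r * u)) < Re (f v)" if "Re (c * u) < 0"
    using order_tendstoD(2)[OF lim that] pos by eventually_elim (simp add: divide_less_0_iff)
qed

lemma ray_nbhd:
  fixes v :: complex
  assumes "isCont f v" "open N" "f v \<in> N"
  shows "\<forall>\<^sub>F r in at_right (0 :: real). f (v + of_real r * u) \<in> N"
proof -
  have "((\<lambda>r::real. v + of_real r * u) \<longlongrightarrow> v) (at_right 0)"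
    by (auto intro!: tendsto_eq_intros)
  from isCont_tendsto_compose[OF assms(1) this] show ?thesis
    using assms(2,3) by (rule topological_tendstoD)
qed


section \<open>Angles and orientations\<close>

text \<open>If \<open>c\<close> is the derivative of \<open>act g\<close> at a point, then 1 / c is
  that of the inverse at the image point, so the direction \<open>\<phi>\<close> there corresponds
  to the direction \<open>\<phi> - Arg c\<close> at the original point.\<close>

lemma Re_direction:
  assumes "c \<noteq> 0" shows "Re (1 / c * cis \<phi>) = cos (\<phi> - Arg c) / cmod c"
proof -
  have "1 / c * cis \<phi> = cis \<phi> / (of_real (cmod c) * cis (Arg c))"
    using rcis_cmod_Arg[of c] by (simp add: rcis_def)
  also have "\<dots> = (cis \<phi> / cis (Arg c)) / of_real (cmod c)" by simp
  finally show ?thesis unfolding cis_divide by (simp only: Re_divide_of_real cis.sel)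
qed

lemma cos_neg_between: "pi / 2 < x \<Longrightarrow> x < 3 * pi / 2 \<Longrightarrow> cos x < 0"
  using cos_gt_zero_pi[of "x - pi"] by (simp add: cos_diff)

lemma cos_pos_between: "3 * pi / 2 < x \<Longrightarrow> x < 5 * pi / 2 \<Longrightarrow> 0 < cos x"
  using cos_gt_zero_pi[of "x - 2 * pi"] by (simp add: cos_diff)

text \<open>\<open>R2g\<close> straightens the circular boundary of \<open>sector True\<close> to
  the line Re w = 1/2, so that \<open>ray_Re\<close> applies to it as well.\<close>

lemma Re_R2g_ge_iff: "w \<in> HH \<Longrightarrow> 1 / 2 \<le> Re (act R2g w) \<longleftrightarrow> 1 \<le> cmod (w - 1)"
  using HH_nonzero(3)[of w] by (simp add: Re_act_gens cmod_minus_1_ge_iff field_simps)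

lemma act_R2g_rho: "act R2g rho = rho"
  using act_inv_act(1)[OF gens_in_carrier(2) HH_points(2)] by (simp add: act_Rg_rho)

lemma act_inv_image:
  assumes "g \<in> \<Gamma>" "X \<subseteq> HH"
  shows "act (pinv g) ` act g ` X = X"
proof -
  have "act (pinv g) (act g x) = x" if "x \<in> X" for x
    using that assms act_inv_act(1) by blast
  then show ?thesis by (simp add: image_image)
qed

lemma internal_angle_commute: "internal_angle P v s s' \<theta> \<Longrightarrow> internal_angle P v s' s \<theta>"
  unfolding internal_angle_def by blast

context tree_domain begin

lemma ray_HH: "v \<in> HH \<Longrightarrow> \<forall>\<^sub>F r in at_right (0 :: real). v + of_real r * u \<in> HH"
  using ray_nbhd[where f = "\<lambda>z. z" and N = HH] open_HH by simp

lemma ray_interior: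
  assumes g: "g \<in> D" and w: "w \<in> int_0_inf"
    and d: "(act (pinv g) has_field_derivative d) (at (act g w))" and u: "0 < Re (d * u)"
  shows "\<forall>\<^sub>F r in at_right 0. act g w + of_real r * u \<in> interior P"
proof -
  have gc: "g \<in> \<Gamma>" using g D_carrier by blast
  have wH: "w \<in> HH" "Re w = 0" using w by (auto simp: int_0_inf_def)
  let ?k = "act (pinv g)" and ?v = "act g w"
  have kv: "?k ?v = w" using act_inv_act(1)[OF gc wH(1)] .
  define N where "N = HH \<inter> {z. Re z < 1 / 2} \<inter> {z. 1 < cmod (z - 1)}"
  have "open N" unfolding N_def by (intro open_Int open_HH open_Collect_less continuous_intros)
  moreover have "?k ?v \<in> N" using w unfolding kv by (auto simp: N_def int_0_inf_def cmod_def HH_def)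
  ultimately have "\<forall>\<^sub>F r in at_right 0. ?k (?v + of_real r * u) \<in> N"
    using d by (intro ray_nbhd) (auto intro: DERIV_isCont)
  moreover have "\<forall>\<^sub>F r in at_right 0. 0 < Re (?k (?v + of_real r * u))"
    using ray_Re(1)[OF d u] by (simp add: kv wH)
  moreover have "\<forall>\<^sub>F r in at_right (0::real). ?v + of_real r * u \<in> HH"
    by (rule ray_HH[OF act_in_HH[OF gc wH(1)]])
  ultimately show ?thesis
  proof eventually_elim
    case (elim r)
    then have "?k (?v + of_real r * u) \<in> open_triangle" by (simp add: open_triangle_def N_def)
    then have "act g (?k (?v + of_real r * u)) \<in> interior P" using open_triangle_interior[OF g] by blast
    then show ?case using act_inv_act(2)[OF gc elim(3)] by simp
  qed
qed

lemma P_sector: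
  assumes "bd g t" "y \<in> P" shows "act (pinv g) y \<in> sector t"
  using assms P_subset_sector P_subset_HH act_image_iff[OF bd_carrier[OF assms(1)] sector_subset_HH] by blast

lemma ray_not_P:
  assumes b: "bd g False" and w: "w \<in> int_0_inf"
    and d: "(act (pinv g) has_field_derivative d) (at (act g w))" and u: "Re (d * u) < 0"
  shows "\<forall>\<^sub>F r in at_right 0. act g w + of_real r * u \<notin> P"
proof -
  have "act (pinv g) (act g w) = w" "Re w = 0"
    using act_inv_act(1)[OF bd_carrier[OF b]] w by (auto simp: int_0_inf_def)
  then have "\<forall>\<^sub>F r in at_right 0. Re (act (pinv g) (act g w + of_real r * u)) < 0"
    using ray_Re(2)[OF d u] by simp
  then show ?thesis
  proof eventually_elim
    case (elim r)
    then show ?case using P_sector[OF b] by fastforce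
  qed
qed

lemma internal_angle_i:
  assumes b: "bd g False"
  shows "internal_angle P (act g \<i>) (act g ` int_i_0) (act g ` int_i_inf) pi"
proof -
  note gc = bd_carrier[OF b]
  obtain c where c: "c \<noteq> 0" "(act g has_field_derivative c) (at \<i>)"
    "(act (pinv g) has_field_derivative 1 / c) (at (act g \<i>))"
    using act_deriv_inv[OF gc HH_points(1)] .
  have i: "\<i> \<in> int_0_inf" by (simp add: int_0_inf_def)
  \<comment> \<open>The direction of \<open>int_i_0\<close>, turned by \<open>act g\<close>.
    Starting from this half, the half turn counterclockwise sweeps out the side Re > 0, on which the
    triangle lies.\<close>
  define \<alpha> where "\<alpha> = - (pi / 2) + Arg c"
  have "tangent_direction (act g ` int_i_0) (act g \<i>) \<alpha>"
    unfolding \<alpha>_def by (rule tangent_act[OF gc int_subset_HH(2) c(1,2) tangent_int_i_0])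
  moreover have "tangent_direction (act g ` int_i_inf) (act g \<i>) (\<alpha> + pi)"
    using tangent_act[OF gc int_subset_HH(3) c(1,2) tangent_int_i_inf]
    by (rule tangent_shift) (simp add: \<alpha>_def algebra_simps)
  moreover have "\<forall>\<^sub>F r in at_right 0. act g \<i> + of_real r * cis \<phi> \<in> P" if "\<alpha> < \<phi>" "\<phi> < \<alpha> + pi" for \<phi>
  proof -
    have "0 < cos (\<phi> - Arg c)" using that by (intro cos_gt_zero_pi) (auto simp: \<alpha>_def)
    then have "0 < Re (1 / c * cis \<phi>)" unfolding Re_direction[OF c(1)] using c(1) by simp
    from ray_interior[OF bd_D[OF b] i c(3) this] show ?thesis
      by (rule eventually_mono) (use interior_subset in blast)
  qed
  moreover have "\<forall>\<^sub>F r in at_right 0. act g \<i> + of_real r * cis \<phi> \<notin> P"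
    if "\<alpha> + pi < \<phi>" "\<phi> < \<alpha> + 2 * pi" for \<phi>
  proof -
    have "cos (\<phi> - Arg c) < 0" using that by (intro cos_neg_between) (auto simp: \<alpha>_def)
    then have "Re (1 / c * cis \<phi>) < 0" unfolding Re_direction[OF c(1)] using c(1) by (simp add: divide_less_0_iff)
    then show ?thesis by (rule ray_not_P[OF b i c(3)])
  qed
  ultimately show ?thesis unfolding internal_angle_def using pi_gt_zero by auto
qed

lemma internal_angle_rho:
  assumes b: "bd g True"
  shows "internal_angle P (act g rho) (act g ` int_rho_inf) (act g ` int_rho_0) (2 * pi / 3)"
proof -
  note gc = bd_carrier[OF b]
  obtain c where c: "c \<noteq> 0" "(act g has_field_derivative c) (at rho)"
    "(act (pinv g) has_field_derivative 1 / c) (at (act g rho))"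
    using act_deriv_inv[OF gc HH_points(2)] .
  let ?k = "act (pinv g)" and ?v = "act g rho"
  have kv: "?k ?v = rho" using act_inv_act(1)[OF gc HH_points(2)] .
  have vH: "?v \<in> HH" by (rule act_in_HH[OF gc HH_points(2)])
  have kc: "isCont ?k ?v" using c(3) by (rule DERIV_isCont)
  define k2 where "k2 = act R2g \<circ> ?k"
  have k2v: "k2 ?v = rho" by (simp add: k2_def kv act_R2g_rho)
  have "(act R2g has_field_derivative cis (- (2 * pi / 3))) (at (?k ?v))"
    unfolding kv by (rule act_R2g_deriv_rho)
  then have d2: "(k2 has_field_derivative cis (- (2 * pi / 3)) * (1 / c)) (at ?v)"
    unfolding k2_def using c(3) by (rule DERIV_chain)
  have dir2: "Re (cis (- (2 * pi / 3)) * (1 / c) * cis \<phi>) = cos (\<phi> - 2 * pi / 3 - Arg c) / cmod c" for \<phi>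
  proof -
    have "cis (- (2 * pi / 3)) * (1 / c) * cis \<phi> = 1 / c * (cis (- (2 * pi / 3)) * cis \<phi>)"
      by (simp only: mult_ac)
    also have "cis (- (2 * pi / 3)) * cis \<phi> = cis (\<phi> - 2 * pi / 3)" unfolding cis_mult by simp
    finally show ?thesis by (simp only: Re_direction[OF c(1)])
  qed
  \<comment> \<open>Here \<open>int_rho_inf\<close> has to come first: the triangle lies to the left
    of the vertical ray from rho, counterclockwise as far as \<open>int_rho_0\<close>.\<close>
  define \<alpha> where "\<alpha> = pi / 2 + Arg c"
  have "tangent_direction (act g ` int_rho_inf) ?v \<alpha>"
    unfolding \<alpha>_def by (rule tangent_act[OF gc int_subset_HH(5) c(1,2) tangent_int_rho_inf])
  moreover have "tangent_direction (act g ` int_rho_0) ?v (\<alpha> + 2 * pi / 3)"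
    using tangent_act[OF gc int_subset_HH(4) c(1,2) tangent_int_rho_0]
    by (rule tangent_shift) (simp add: \<alpha>_def algebra_simps)
  moreover have "\<forall>\<^sub>F r in at_right 0. ?v + of_real r * cis \<phi> \<in> P" if "\<alpha> < \<phi>" "\<phi> < \<alpha> + 2 * pi / 3" for \<phi>
  proof -
    have "cos (\<phi> - Arg c) < 0"
      using that pi_gt_zero by (intro cos_neg_between) (auto simp: \<alpha>_def)
    then have "Re (1 / c * cis \<phi>) < 0" unfolding Re_direction[OF c(1)] using c(1) by (simp add: divide_less_0_iff)
    from ray_Re(2)[OF c(3) this]
    have 1: "\<forall>\<^sub>F r in at_right 0. Re (?k (?v + of_real r * cis \<phi>)) < 1 / 2" by (simp add: kv)
    have "0 < cos (\<phi> - 2 * pi / 3 - Arg c)"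
      using that pi_gt_zero by (intro cos_gt_zero_pi) (auto simp: \<alpha>_def)
    then have "0 < Re (cis (- (2 * pi / 3)) * (1 / c) * cis \<phi>)" unfolding dir2 using c(1) by simp
    from ray_Re(1)[OF d2 this]
    have 2: "\<forall>\<^sub>F r in at_right 0. 1 / 2 < Re (k2 (?v + of_real r * cis \<phi>))" by (simp add: k2v)
    \<comment> \<open>The remaining side of the triangle, on the imaginary axis, stays away from
      rho, so continuity is enough.\<close>
    have "open (HH \<inter> {z. 0 < Re z})" by (intro open_Int open_HH open_Collect_less continuous_intros)
    then have 3: "\<forall>\<^sub>F r in at_right 0. ?k (?v + of_real r * cis \<phi>) \<in> HH \<inter> {z. 0 < Re z}"
      by (intro ray_nbhd[OF kc]) (simp_all add: kv HH_def)
    from 1 2 3 ray_HH[OF vH, of "cis \<phi>"] show ?thesis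
    proof eventually_elim
      case (elim r)
      then have "?k (?v + of_real r * cis \<phi>) \<in> Triangle"
        using Re_R2g_ge_iff[of "?k (?v + of_real r * cis \<phi>)"] by (simp add: Triangle_def k2_def)
      then have "act g (?k (?v + of_real r * cis \<phi>)) \<in> P" using bd_D[OF b] unfolding P_def by blast
      then show ?case using act_inv_act(2)[OF gc elim(4)] by simp
    qed
  qed
  \<comment> \<open>The outer angle 4 pi / 3 does not fit into one half-plane. Relative to
    \<open>Arg c\<close>, directions past 3 pi / 2, which points straight down, cross the vertical
    line to the right; the others enter the disc around 1.\<close>
  moreover have "\<forall>\<^sub>F r in at_right 0. ?v + of_real r * cis \<phi> \<notin> P"
    if \<phi>: "\<alpha> + 2 * pi / 3 < \<phi>" "\<phi> < \<alpha> + 2 * pi" for \<phi>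
  proof (cases "3 * pi / 2 < \<phi> - Arg c")
    case True
    have "0 < cos (\<phi> - Arg c)" using \<phi> True by (intro cos_pos_between) (auto simp: \<alpha>_def)
    then have "0 < Re (1 / c * cis \<phi>)" unfolding Re_direction[OF c(1)] using c(1) by simp
    from ray_Re(1)[OF c(3) this] show ?thesis
    proof eventually_elim
      case (elim r)
      then show ?case using P_sector[OF b, of "?v + of_real r * cis \<phi>"] by (auto simp: kv)
    qed
  next
    case False
    have "cos (\<phi> - 2 * pi / 3 - Arg c) < 0"
      using \<phi> False pi_gt_zero by (intro cos_neg_between) (auto simp: \<alpha>_def)
    then have "Re (cis (- (2 * pi / 3)) * (1 / c) * cis \<phi>) < 0"
      unfolding dir2 using c(1) by (simp add: divide_less_0_iff)
    from ray_Re(2)[OF d2 this]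
    have "\<forall>\<^sub>F r in at_right 0. Re (k2 (?v + of_real r * cis \<phi>)) < 1 / 2" by (simp add: k2v)
    then show ?thesis
    proof eventually_elim
      case (elim r)
      then show ?case
        using P_sector[OF b, of "?v + of_real r * cis \<phi>"] Re_R2g_ge_iff[of "?k (?v + of_real r * cis \<phi>)"]
        by (auto simp: k2_def)
    qed
  qed
  ultimately show ?thesis unfolding internal_angle_def using pi_gt_zero by auto
qed

text \<open>Seen from \<open>g\<close>, the polygon lies near the side in Re > 0, which is to the
  left of a curve running down the imaginary axis. The induced orientation thus becomes the
  condition that the pulled back velocity points down.\<close>

lemma induced_orientation_iff:
  assumes b: "bd g False"
  shows "induced_orientation P (act g ` int_0_inf) \<gamma> \<longleftrightarrow> inj \<gamma> \<and> range \<gamma> = act g ` int_0_inf \<and>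
    (\<forall>t. \<exists>v. ((\<lambda>t. act (pinv g) (\<gamma> t)) has_vector_derivative v) (at t) \<and> Re v = 0 \<and> Im v < 0)"
proof -
  note gc = bd_carrier[OF b]
  let ?k = "act (pinv g)"
  have "(\<exists>v. (\<gamma> has_vector_derivative v) (at t) \<and> v \<noteq> 0 \<and>
          (\<forall>\<^sub>F r in at_right 0. \<gamma> t + of_real r * (\<i> * v) \<in> interior P)) \<longleftrightarrow>
    (\<exists>v. ((\<lambda>t. ?k (\<gamma> t)) has_vector_derivative v) (at t) \<and> Re v = 0 \<and> Im v < 0)" (is "?L \<longleftrightarrow> ?R")
    if range: "range \<gamma> = act g ` int_0_inf" for t
  proof -
    have k\<gamma>: "?k (\<gamma> s) \<in> int_0_inf" "act g (?k (\<gamma> s)) = \<gamma> s" for s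
    proof -
      have "\<gamma> s \<in> act g ` int_0_inf" using range by blast
      then show "?k (\<gamma> s) \<in> int_0_inf" "act g (?k (\<gamma> s)) = \<gamma> s"
        using act_image_iff[OF gc int_subset_HH(1), of "\<gamma> s"] act_inv_act(2)[OF gc, of "\<gamma> s"]
          act_image_subset[OF gc int_subset_HH(1)] by blast+
    qed
    have kH: "?k (\<gamma> t) \<in> HH" using k\<gamma>(1)[of t] int_subset_HH by blast
    obtain c where c: "c \<noteq> 0" "(act g has_field_derivative c) (at (?k (\<gamma> t)))"
      "(?k has_field_derivative 1 / c) (at (\<gamma> t))"
      using act_deriv_inv[OF gc kH] k\<gamma>(2)[of t] by metis
    show ?thesis
    proof
      assume ?L
      then obtain v where v: "(\<gamma> has_vector_derivative v) (at t)" "v \<noteq> 0"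
        "\<forall>\<^sub>F r in at_right 0. \<gamma> t + of_real r * (\<i> * v) \<in> interior P" by blast
      let ?v0 = "v * (1 / c)"
      have d: "((\<lambda>t. ?k (\<gamma> t)) has_vector_derivative ?v0) (at t)"
        using field_vector_diff_chain_at[OF v(1) c(3)] by (simp add: o_def)
      have "((\<lambda>t. Re (?k (\<gamma> t))) has_vector_derivative Re ?v0) (at t)"
        using bounded_linear.has_vector_derivative[OF bounded_linear_Re d] .
      moreover have "(\<lambda>t. Re (?k (\<gamma> t))) = (\<lambda>t. 0)" using k\<gamma>(1) by (auto simp: int_0_inf_def)
      ultimately have "((\<lambda>t. 0) has_vector_derivative Re ?v0) (at t)" by simp
      then have Re0: "Re ?v0 = 0" using has_vector_derivative_const vector_derivative_unique_at by blast
      \<comment> \<open>If the velocity pointed up, its product with \<open>\<i>\<close> would point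
        to Re < 0, out of \<open>P\<close>.\<close>
      have "\<not> 0 < Im ?v0"
      proof
        assume "0 < Im ?v0"
        moreover have "1 / c * (\<i> * v) = \<i> * ?v0" by (simp only: mult_ac)
        ultimately have "Re (1 / c * (\<i> * v)) < 0" by (simp only: Re_i_times neg_less_0_iff_less)
        then have "\<forall>\<^sub>F r in at_right 0. \<gamma> t + of_real r * (\<i> * v) \<notin> P"
          using ray_not_P[OF b k\<gamma>(1)[of t]] c(3) by (simp only: k\<gamma>(2))
        with v(3) have "\<forall>\<^sub>F r in at_right (0::real). False"
          by eventually_elim (use interior_subset in blast)
        then show False by simp
      qed
      moreover have "?v0 \<noteq> 0" using v(2) c(1) by simp
      then have "Im ?v0 \<noteq> 0" using Re0 complex_eq_iff[of ?v0 0] by simp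
      ultimately have "Im ?v0 < 0" by linarith
      then show ?R using d Re0 by blast
    next
      assume ?R
      then obtain v0 where v0: "((\<lambda>t. ?k (\<gamma> t)) has_vector_derivative v0) (at t)" "Re v0 = 0" "Im v0 < 0"
        by blast
      have "((act g \<circ> (\<lambda>t. ?k (\<gamma> t))) has_vector_derivative v0 * c) (at t)"
        by (rule field_vector_diff_chain_at[OF v0(1) c(2)])
      then have d: "(\<gamma> has_vector_derivative v0 * c) (at t)" by (simp add: o_def k\<gamma>(2))
      have "1 / c * (\<i> * (v0 * c)) = \<i> * v0" using c(1) by simp
      then have "0 < Re (1 / c * (\<i> * (v0 * c)))" using v0(3) by simp
      then have "\<forall>\<^sub>F r in at_right 0. \<gamma> t + of_real r * (\<i> * (v0 * c)) \<in> interior P"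
        using ray_interior[OF bd_D[OF b] k\<gamma>(1)[of t]] c(3) by (simp only: k\<gamma>(2))
      moreover have "v0 * c \<noteq> 0" using v0(3) c(1) by auto
      ultimately show ?L using d by blast
    qed
  qed
  then show ?thesis unfolding induced_orientation_def by blast
qed

text \<open>The alternative to equality is that \<open>pinv h \<cdot> g\<close> is a letter of type
  \<open>u\<close>; then \<open>g\<close> would lie beyond a univalent vertex of
  \<open>h\<close>.\<close>

lemma side_unique:
  assumes "bd g t" "b \<in> base_sides (whole g) t" "bd h u" "c \<in> base_sides (whole h) u"
    and eq: "act g ` b = act h ` c"
  shows "g = h \<and> t = u \<and> b = c"
proof -
  note gh = bd_carrier[OF assms(1)] bd_carrier[OF assms(3)]
  have sub: "b \<subseteq> HH" "c \<subseteq> HH" using assms(2,4) base_sides_subset side_at_HH by blast+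
  let ?x = "pinv h \<cdot> g"
  have "act ?x ` b = act (pinv h) ` act g ` b"
    using gh sub by (intro act_image_mult) auto
  then have "act ?x ` b = c" unfolding eq act_inv_image[OF gh(2) sub(2)] .
  moreover have "?x \<in> \<Gamma>" using gh by simp
  ultimately have "t = u" and alt: "?x = one_psl \<and> b = c \<or> ?x \<in> letters u"
    using base_image[OF _ assms(2,4)] by (fastforce)+
  then have tu: "t = u" by simp
  have "?x \<notin> letters u" using bd_branch[OF assms(3) bd_D[OF assms(1)]] branch.letter by blast
  with alt have "?x = one_psl" "b = c" by auto
  moreover from this(1) have "g = h" using gh by (metis PSL.inv_equality PSL.inv_inv PSL.inv_closed PSL.inv_comm)
  ultimately show ?thesis using tu by blast
qed

end

lemma is_copy_base:
  assumes "g \<in> \<Gamma>" "b \<in> base_sides c t"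
  shows "is_copy int_0_inf (act g ` b) \<longleftrightarrow> b = int_0_inf"
    "is_copy int_i_inf (act g ` b) \<longleftrightarrow> b = int_i_0 \<or> b = int_i_inf"
    "is_copy int_rho_inf (act g ` b) \<longleftrightarrow> b = int_rho_0 \<or> b = int_rho_inf"
proof -
  have sub: "b \<subseteq> HH" using assms(2) base_sides_subset side_at_HH by blast
  have copy: "is_copy I (act g ` b) \<longleftrightarrow> (\<exists>x\<in>\<Gamma>. act x ` I = b)" if I: "I \<subseteq> HH" for I
  proof
    assume "is_copy I (act g ` b)"
    then obtain h where h: "h \<in> \<Gamma>" "act g ` b = act h ` I" by (auto simp: is_copy_def)
    have "act (pinv g \<cdot> h) ` I = act (pinv g) ` act h ` I"
      using assms(1) h(1) I by (intro act_image_mult) auto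
    also have "\<dots> = b" unfolding h(2)[symmetric] by (rule act_inv_image[OF assms(1) sub])
    finally have "act (pinv g \<cdot> h) ` I = b" .
    then show "\<exists>x\<in>\<Gamma>. act x ` I = b" using assms(1) h(1) by blast
  next
    assume "\<exists>x\<in>\<Gamma>. act x ` I = b"
    then obtain x where x: "x \<in> \<Gamma>" "act x ` I = b" by blast
    then have "act g ` b = act (g \<cdot> x) ` I" using assms(1) I by (simp add: act_image_mult)
    then show "is_copy I (act g ` b)" using assms(1) x(1) unfolding is_copy_def by blast
  qed
  show "is_copy int_0_inf (act g ` b) \<longleftrightarrow> b = int_0_inf"
  proof -
    have "b = int_0_inf" if "x \<in> \<Gamma>" "act x ` int_0_inf = b" for x
      using base_image[OF that(1) _ assms(2) that(2), of True False] int_i_neq by auto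
    moreover have "act one_psl ` int_0_inf = int_0_inf" by (rule act_image_one)
    ultimately show ?thesis unfolding copy[OF int_subset_HH(1)] using PSL.one_closed by blast
  qed
  show "is_copy int_i_inf (act g ` b) \<longleftrightarrow> b = int_i_0 \<or> b = int_i_inf"
  proof -
    have "b = int_i_0 \<or> b = int_i_inf" if "x \<in> \<Gamma>" "act x ` int_i_inf = b" for x
      using base_image[OF that(1) _ assms(2) that(2), of False False] by auto
    moreover have "act one_psl ` int_i_inf = int_i_inf" by (rule act_image_one)
    ultimately show ?thesis unfolding copy[OF int_subset_HH(3)]
      using PSL.one_closed gens_in_carrier act_Sg_int_i_inf by blast
  qed
  show "is_copy int_rho_inf (act g ` b) \<longleftrightarrow> b = int_rho_0 \<or> b = int_rho_inf"
  proof -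
    have "b = int_rho_0 \<or> b = int_rho_inf" if "x \<in> \<Gamma>" "act x ` int_rho_inf = b" for x
      using base_image[OF that(1) _ assms(2) that(2), of False True] by auto
    moreover have "act one_psl ` int_rho_inf = int_rho_inf" by (rule act_image_one)
    ultimately show ?thesis unfolding copy[OF int_subset_HH(5)]
      using PSL.one_closed gens_in_carrier act_Rg_int_rho_inf by blast
  qed
qed


section \<open>The involution on the sides\<close>

text \<open>The form of all side pairings: go from the edge \<open>g\<close> back to the edge
  \<open>one_psl\<close>, apply \<open>x\<close> there, and move on to the edge
  \<open>h\<close>.\<close>

abbreviation carry :: "psl \<Rightarrow> psl \<Rightarrow> psl \<Rightarrow> psl" where
  "carry h x g \<equiv> h \<cdot> x \<cdot> pinv g"

lemma carry_cancel:
  assumes "g \<in> \<Gamma>" "h \<in> \<Gamma>" "y \<in> \<Gamma>"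
  shows "carry h (pinv h \<cdot> y \<cdot> g) g = y"
proof -
  have "carry h (pinv h \<cdot> y \<cdot> g) g
      = (h \<cdot> pinv h) \<cdot> y \<cdot> (g \<cdot> pinv g)"
    using assms by (simp only: PSL.m_assoc PSL.m_closed PSL.inv_closed)
  then show ?thesis using assms by simp
qed

lemma carry_apply:
  assumes "g \<in> \<Gamma>" "h \<in> \<Gamma>" "x \<in> \<Gamma>" "p \<in> \<Gamma>"
  shows "pinv h \<cdot> (carry h x g \<cdot> p) = x \<cdot> (pinv g \<cdot> p)"
proof -
  have "pinv h \<cdot> (carry h x g \<cdot> p)
      = (pinv h \<cdot> h) \<cdot> (x \<cdot> (pinv g \<cdot> p))"
    using assms by (simp only: PSL.m_assoc PSL.m_closed PSL.inv_closed)
  then show ?thesis using assms by simp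
qed

lemma inv_carry:
  assumes "g \<in> \<Gamma>" "h \<in> \<Gamma>" "x \<in> \<Gamma>"
  shows "pinv (carry h x g) = carry g (pinv x) h"
  using assms by (simp add: PSL.inv_mult_group PSL.m_assoc)

lemma carry_mult:
  assumes "g \<in> \<Gamma>" "x \<in> \<Gamma>" "y \<in> \<Gamma>"
  shows "carry g x g \<cdot> carry g y g = carry g (x \<cdot> y) g"
proof -
  have "carry g x g \<cdot> carry g y g
      = g \<cdot> x \<cdot> (pinv g \<cdot> g) \<cdot> y \<cdot> pinv g"
    using assms by (simp only: PSL.m_assoc PSL.m_closed PSL.inv_closed)
  then show ?thesis using assms by (simp add: PSL.m_assoc)
qed

lemma carry_image:
  assumes "g \<in> \<Gamma>" "h \<in> \<Gamma>" "x \<in> \<Gamma>" "b \<subseteq> HH"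
  shows "act (carry h x g) ` act g ` b = act h ` act x ` b"
proof -
  have "act (carry h x g) ` act g ` b = act (carry h x g \<cdot> g) ` b"
    using assms by (simp add: act_image_mult)
  also have "carry h x g \<cdot> g = h \<cdot> x" using assms by (simp add: PSL.m_assoc)
  finally show ?thesis using assms by (simp add: act_image_mult)
qed

lemma branch_letter_mult:
  assumes "q \<in> \<Gamma>" "\<not> branch t q" "l \<in> letters t"
  shows "branch t (l \<cdot> q)"
  using assms not_branch_cases[of q t] branch.intros letters_carrier by auto

lemma maps_side:
  assumes g: "g \<in> \<Gamma>" and h: "h \<in> \<Gamma>" and y: "y \<in> \<Gamma>"
    and b: "b \<in> base_sides c t" "b' \<in> base_sides c' t'" and eq: "act y ` act g ` b = act h ` b'"
  obtains x where "x \<in> \<Gamma>" "y = carry h x g" "act x ` b = b'"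
proof -
  have sub: "b \<subseteq> HH" "b' \<subseteq> HH" using b base_sides_subset side_at_HH by blast+
  let ?x = "pinv h \<cdot> y \<cdot> g"
  have "act ?x ` b = act (pinv h) ` act y ` act g ` b"
    using g h y sub by (simp add: act_image_mult act_image_subset)
  also have "\<dots> = b'" unfolding eq by (rule act_inv_image[OF h sub(2)])
  finally show ?thesis using that[of ?x] carry_cancel[OF g h y] g h y by simp
qed

lemma paired_sides_cutI:
  "e \<noteq> e' \<Longrightarrow> Cut W e \<in> univalent_verts G C \<Longrightarrow> Cut W e' \<in> univalent_verts G C \<Longrightarrow>
    s \<in> sides G C je (Cut W e) \<Longrightarrow> s' \<in> sides G C je (Cut W e') \<Longrightarrow> paired_sides G C je s s'"
  unfolding paired_sides_def by (intro disjI1 exI conjI)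

lemma paired_sides_uncutI:
  "Uncut v \<in> univalent_verts G C \<Longrightarrow> s \<noteq> s' \<Longrightarrow> s \<in> sides G C je (Uncut v) \<Longrightarrow>
    s' \<in> sides G C je (Uncut v) \<Longrightarrow> paired_sides G C je s s'"
  unfolding paired_sides_def by (intro disjI2 exI conjI)

lemma paired_sides_cases [consumes 1, case_names cut uncut]:
  assumes "paired_sides G C je s s'"
  obtains W e e' where "e \<noteq> e'" "Cut W e \<in> univalent_verts G C" "Cut W e' \<in> univalent_verts G C"
      "s \<in> sides G C je (Cut W e)" "s' \<in> sides G C je (Cut W e')"
    | v where "Uncut v \<in> univalent_verts G C" "s \<noteq> s'" "s \<in> sides G C je (Uncut v)"
      "s' \<in> sides G C je (Uncut v)"
  using assms[unfolded paired_sides_def]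
proof (elim disjE exE conjE)
  fix W e e' assume "e \<noteq> e'" "Cut W e \<in> univalent_verts G C" "Cut W e' \<in> univalent_verts G C"
    "s \<in> sides G C je (Cut W e)" "s' \<in> sides G C je (Cut W e')"
  then show thesis by (rule that(1))
next
  fix v assume "Uncut v \<in> univalent_verts G C" "s \<noteq> s'" "s \<in> sides G C je (Uncut v)"
    "s' \<in> sides G C je (Uncut v)"
  then show thesis by (rule that(2))
qed

context cut_lift begin

lemma base_sides_vert: "bd g t \<Longrightarrow> t \<or> \<not> whole g \<Longrightarrow> vert_of t (cs g) \<notin> C"
  using C_type by (cases t) (auto simp: whole_def)

lemma univalent_vertex_of_side:
  assumes b: "bd g t" "b \<in> base_sides (whole g) t"
    and V: "V \<in> univalent_verts G C" "act g ` b \<in> sides G C je V"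
  shows "V = cv t (cs g)"
proof -
  obtain h u where h: "bd h u" "V = cv u (cs h)" using univalent_cases[OF V(1)] .
  then have "act g ` b \<in> sides_of h u" using V(2) sides_cv by simp
  then obtain c where c: "c \<in> base_sides (whole h) u" "act g ` b = act h ` c" by (auto simp: sides_of_def)
  then show ?thesis using side_unique[OF b h(1)] h(2) by blast
qed

lemma side_neq:
  "bd g t \<Longrightarrow> b \<in> base_sides (whole g) t \<Longrightarrow> b' \<in> base_sides (whole g) t \<Longrightarrow> b \<noteq> b' \<Longrightarrow> act g ` b \<noteq> act g ` b'"
  using side_unique by metis

lemma bd_univalent: "bd g t \<Longrightarrow> cv t (cs g) \<in> univalent_verts G C"
  by (simp add: bd_def)

lemma side_inv_pair:
  assumes b: "bd g t" "t \<or> \<not> whole g" and bb: "base_sides (whole g) t = {b, b'}" "b \<noteq> b'"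
  shows "side_inv G C je (act g ` b) = act g ` b'"
proof -
  have cv: "cv t (cs g) = Uncut (vert_of t (cs g))" using base_sides_vert[OF b] by (simp add: cv_def)
  have sd: "sides G C je (Uncut (vert_of t (cs g))) = {act g ` b, act g ` b'}"
    using sides_cv[OF b(1)] cv bb(1) by (simp add: sides_of_def)
  have uni: "Uncut (vert_of t (cs g)) \<in> univalent_verts G C" using bd_univalent[OF b(1)] cv by simp
  have ne: "act g ` b \<noteq> act g ` b'" using side_unique[OF b(1) _ b(1), of b b'] bb by auto
  have bin: "b \<in> base_sides (whole g) t" using bb(1) by simp
  show ?thesis unfolding side_inv_def
  proof (rule the_equality)
    show "paired_sides G C je (act g ` b) (act g ` b')"
      using uni ne by (intro paired_sides_uncutI[of "vert_of t (cs g)"]) (simp_all add: sd)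
    fix s assume "paired_sides G C je (act g ` b) s"
    then show "s = act g ` b'"
    proof (cases rule: paired_sides_cases)
      case (cut W e e')
      then show ?thesis using univalent_vertex_of_side[OF b(1) bin cut(2,4)] cv by simp
    next
      case (uncut v)
      have "Uncut v = Uncut (vert_of t (cs g))" using univalent_vertex_of_side[OF b(1) bin uncut(1,3)] cv by simp
      then have "s \<in> {act g ` b, act g ` b'}" using uncut(4) sd by simp
      then show ?thesis using uncut(2) by blast
    qed
  qed
qed

text \<open>The cut separates the edges \<open>cs g\<close> and \<open>cs (g \<cdot> Sg)\<close> at
  their common vertex of type (0); \<open>mate g\<close> is the edge of \<open>D\<close> over the
  second one.\<close>

definition mate :: "psl \<Rightarrow> psl" where "mate g = rep (g \<cdot> Sg)"

lemma mate:
  assumes b: "bd g False" and w: "whole g"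
  shows "bd (mate g) False" "whole (mate g)" "mate g \<noteq> g" "mate (mate g) = g"
    "vert_of False (cs (mate g)) = vert_of False (cs g)" "cs (mate g) = cs (g \<cdot> Sg)"
proof -
  note gc = bd_carrier[OF b]
  have Sk: "Sg \<in> K False" by (simp add: K_eq)
  have r: "mate g \<in> D" "cs (mate g) = cs (g \<cdot> Sg)" "mate g \<in> \<Gamma>"
    unfolding mate_def using rep[of "g \<cdot> Sg"] gc by simp_all
  have v: "vert_of False (cs g) = vert_of False (cs (mate g))"
    using vert_of_cs_iff[OF gc r(3), of False False] r(2) Sk by blast
  show "vert_of False (cs (mate g)) = vert_of False (cs g)" using v by simp
  show "cs (mate g) = cs (g \<cdot> Sg)" by (rule r(2))
  show w': "whole (mate g)" using w v by (simp add: whole_def)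
  then show "bd (mate g) False"
    using r univalent_iff[OF r(3), of False] by (simp add: bd_def whole_def)
  \<comment> \<open>Valency 2 means that the two cosets at the vertex differ, so the two copies of
    the vertex belong to different edges.\<close>
  have "valency (Y_comb G) (vert_of False (cs g)) = 2" using w C_valency by (auto simp: whole_def)
  then have "card ((\<lambda>k. cs (g \<cdot> k)) ` K False) = 2"
    unfolding valency_def edges_at[OF gc] .
  then have "cs (g \<cdot> Sg) \<noteq> cs g" using gc by (auto simp: K_eq)
  then show "mate g \<noteq> g" using r(2) by auto
  have "cs (mate g \<cdot> Sg) = cs (g \<cdot> Sg \<cdot> Sg)"
    using cs_mult[OF r(3) _ _ r(2)] gc by simp
  then have "cs (mate g \<cdot> Sg) = cs g" using gc by (simp add: PSL.m_assoc)
  then show "mate (mate g) = g" using rep_D[OF bd_D[OF b]] by (simp add: mate_def[of "mate g"] rep_def)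
qed

lemma side_inv_whole:
  assumes b: "bd g False" and w: "whole g"
  shows "side_inv G C je (act g ` int_0_inf) = act (mate g) ` int_0_inf"
proof -
  note m = mate[OF b w]
  have cut: "cv False (cs h) = Cut (vert_of False (cs h)) (cs h)" if "whole h" for h
    using that by (simp add: cv_def whole_def)
  have sd: "sides G C je (Cut (vert_of False (cs h)) (cs h)) = {act h ` int_0_inf}" if "bd h False" "whole h" for h
    using sides_cv[OF that(1)] cut[OF that(2)] that(2) by (simp add: sides_of_def)
  have bin: "int_0_inf \<in> base_sides (whole g) False" using w by simp
  show ?thesis unfolding side_inv_def
  proof (rule the_equality)
    let ?W = "vert_of False (cs g)"
    have "cs g \<noteq> cs (mate g)" using D_inj[OF bd_D[OF b] bd_D[OF m(1)]] m(3) by metis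
    moreover have "Cut ?W (cs g) \<in> univalent_verts G C" using bd_univalent[OF b] cut[OF w] by simp
    moreover have "Cut ?W (cs (mate g)) \<in> univalent_verts G C"
      using bd_univalent[OF m(1)] cut[OF m(2)] m(5) by simp
    moreover have "act g ` int_0_inf \<in> sides G C je (Cut ?W (cs g))" using sd[OF b w] by simp
    moreover have "act (mate g) ` int_0_inf \<in> sides G C je (Cut ?W (cs (mate g)))"
      using sd[OF m(1,2)] m(5) by simp
    ultimately show "paired_sides G C je (act g ` int_0_inf) (act (mate g) ` int_0_inf)"
      by (rule paired_sides_cutI)
    fix s assume "paired_sides G C je (act g ` int_0_inf) s"
    then show "s = act (mate g) ` int_0_inf"
    proof (cases rule: paired_sides_cases)
      case 1: (cut W e e')
      have We: "W = vert_of False (cs g)" "e = cs g" using univalent_vertex_of_side[OF b bin 1(2,4)] cut[OF w] by simp_all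
      obtain h u where h: "bd h u" "Cut W e' = cv u (cs h)" using univalent_cases[OF 1(3)] .
      have h2: "vert_of u (cs h) \<in> C" "W = vert_of u (cs h)" "e' = cs h"
        using h(2) by (simp_all add: cv_def split: if_splits)
      have u: "u = False" using C_type[OF h2(1)] by simp
      then have wh: "whole h" using h2 by (simp add: whole_def)
      \<comment> \<open>A partner comes from another copy of the same vertex. As
        \<open>K False\<close> contains only \<open>Sg\<close> besides the identity, its edge can
        only be \<open>mate g\<close>.\<close>
      have "vert_of False (cs g) = vert_of False (cs h)"
        by (rule trans[OF We(1)[symmetric] h2(2)[unfolded u]])
      then obtain k where k: "k \<in> K False" "cs h = cs (g \<cdot> k)"
        using vert_of_cs_iff[OF bd_carrier[OF b] bd_carrier[OF h(1)], THEN iffD1] by blast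
      have "cs h \<noteq> cs g" using 1(1) We(2) h2(3) by metis
      then have "k \<noteq> one_psl" using k(2) PSL.r_one[OF bd_carrier[OF b]] by metis
      then have "k = Sg" using k(1) by (simp add: K_eq)
      then have "cs h = cs (mate g)" using k(2) m(6) by simp
      then have hm: "h = mate g" by (rule D_inj[OF bd_D[OF h(1)] bd_D[OF m(1)]])
      have "Cut W e' = Cut (vert_of False (cs (mate g))) (cs (mate g))"
        using We(1) h2(3) m(5) hm by metis
      then show ?thesis using 1(5) sd[OF m(1,2)] by (metis singletonD)
    next
      case (uncut v)
      then show ?thesis using univalent_vertex_of_side[OF b bin uncut(1,3)] cut[OF w] by simp
    qed
  qed
qed

lemma edge_cases:
  assumes "s \<in> E"
  obtains (whole) g where "bd g False" "whole g" "s = act g ` int_0_inf"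
      "side_inv G C je s = act (mate g) ` int_0_inf"
    | (half) g b b' where "bd g False" "\<not> whole g" "s = act g ` b" "{b, b'} = {int_i_0, int_i_inf}"
      "b \<noteq> b'" "side_inv G C je s = act g ` b'"
    | (rho) g b b' where "bd g True" "s = act g ` b" "{b, b'} = {int_rho_0, int_rho_inf}"
      "b \<noteq> b'" "side_inv G C je s = act g ` b'"
proof -
  obtain g t b where g: "bd g t" "b \<in> base_sides (whole g) t" "s = act g ` b" using E_cases[OF assms] .
  show ?thesis
  proof (cases t)
    case True
    define b' where "b' = (if b = int_rho_0 then int_rho_inf else int_rho_0)"
    have bb: "base_sides (whole g) t = {b, b'}" "b \<noteq> b'" "{b, b'} = {int_rho_0, int_rho_inf}"
      using g(2) True int_rho_0_neq by (auto simp: b'_def)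
    show ?thesis
      using side_inv_pair[OF g(1) _ bb(1,2)] g True bb(2,3) by (intro rho[of g b b']) auto
  next
    case False
    show ?thesis
    proof (cases "whole g")
      case w: True
      then have "b = int_0_inf" using g(2) False by simp
      then show ?thesis using g False w side_inv_whole[of g] by (intro whole[of g]) auto
    next
      case w: False
      define b' where "b' = (if b = int_i_0 then int_i_inf else int_i_0)"
      have bb: "base_sides (whole g) t = {b, b'}" "b \<noteq> b'" "{b, b'} = {int_i_0, int_i_inf}"
        using g(2) False w int_i_neq by (auto simp: b'_def)
      show ?thesis
        using side_inv_pair[OF g(1) _ bb(1,2)] g False w bb(2,3) by (intro half[of g b b']) auto
    qed
  qed
qed

lemma side_inv_props:
  assumes "s \<in> E"
  shows "side_inv G C je s \<in> E" "side_inv G C je (side_inv G C je s) = s" "side_inv G C je s \<noteq> s"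
proof -
  let ?\<sigma> = "side_inv G C je"
  have "?\<sigma> s \<in> E \<and> ?\<sigma> (?\<sigma> s) = s \<and> ?\<sigma> s \<noteq> s"
    using assms
  proof (cases rule: edge_cases)
    case (whole g)
    note m = mate[OF whole(1,2)]
    have w: "int_0_inf \<in> base_sides (local.whole (mate g)) False" "int_0_inf \<in> base_sides (local.whole g) False"
      using m(2) whole(2) by simp_all
    have "?\<sigma> s \<noteq> s"
    proof
      assume "?\<sigma> s = s"
      then have "act (mate g) ` int_0_inf = act g ` int_0_inf" using whole(3,4) by metis
      then show False using side_unique[OF m(1) w(1) whole(1) w(2)] m(3) by blast
    qed
    moreover have "?\<sigma> s \<in> E" unfolding whole(4) by (rule E_intro[OF m(1) w(1)])
    moreover have "?\<sigma> (?\<sigma> s) = s" using side_inv_whole[OF m(1,2)] m(4) whole(3,4) by metis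
    ultimately show ?thesis by blast
  next
    case (half g b b')
    have bs: "base_sides (whole g) False = {b', b}" using half by auto
    have "?\<sigma> s \<in> E" unfolding half(6) by (rule E_intro[OF half(1)]) (simp add: bs)
    have "?\<sigma> (act g ` b') = act g ` b"
      by (rule side_inv_pair[OF half(1) _ bs]) (use half(2,5) in simp_all)
    then have "?\<sigma> (?\<sigma> s) = s" using half(3,6) by metis
    moreover note \<open>?\<sigma> s \<in> E\<close>
    moreover have "?\<sigma> s \<noteq> s"
      using side_neq[OF half(1), of b' b] bs half(3,5,6) by (metis insertCI)
    ultimately show ?thesis by blast
  next
    case (rho g b b')
    have bs: "base_sides (whole g) True = {b', b}" using rho by auto
    have "?\<sigma> s \<in> E" unfolding rho(5) by (rule E_intro[OF rho(1)]) (simp only: bs insertI1)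
    have "?\<sigma> (act g ` b') = act g ` b"
      by (rule side_inv_pair[OF rho(1) _ bs]) (use rho(4) in simp_all)
    then have "?\<sigma> (?\<sigma> s) = s" using rho(2,5) by metis
    moreover note \<open>?\<sigma> s \<in> E\<close>
    moreover have "?\<sigma> s \<noteq> s"
      using side_neq[OF rho(1), of b' b] bs rho(2,4,5) by (metis insertCI)
    ultimately show ?thesis by blast
  qed
  then show "?\<sigma> s \<in> E" "?\<sigma> (?\<sigma> s) = s" "?\<sigma> s \<noteq> s" by blast+
qed

lemma copies:
  assumes "bd g t" "b \<in> base_sides (whole g) t"
  shows "is_copy int_0_inf (act g ` b) \<longleftrightarrow> b = int_0_inf"
    "is_copy int_i_inf (act g ` b) \<longleftrightarrow> b = int_i_0 \<or> b = int_i_inf"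
    "is_copy int_rho_inf (act g ` b) \<longleftrightarrow> b = int_rho_0 \<or> b = int_rho_inf"
  using is_copy_base[OF bd_carrier[OF assms(1)] assms(2)] .

text \<open>The sides at the two vertices of an edge are disjoint, so a nonempty interval cannot
  belong to both types.\<close>

lemma base_sides_types:
  "int_0_inf \<notin> base_sides c True" "int_i_0 \<notin> base_sides c True" "int_i_inf \<notin> base_sides c True"
  "int_rho_0 \<notin> base_sides c False" "int_rho_inf \<notin> base_sides c False"
proof -
  have *: "\<not> (b \<in> base_sides c t \<and> b \<in> base_sides c' (\<not> t))" for b c c' t
    using base_sides_nonempty[of b c t] base_sides_subset[of b c t] base_sides_subset[of b c' "\<not> t"]
      side_at_disjoint by blast
  show "int_0_inf \<notin> base_sides c True" using *[of int_0_inf c True True] by simp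
  show "int_i_0 \<notin> base_sides c True" using *[of int_i_0 c True False] by simp
  show "int_i_inf \<notin> base_sides c True" using *[of int_i_inf c True False] by simp
  show "int_rho_0 \<notin> base_sides c False" using *[of int_rho_0 c False c] by simp
  show "int_rho_inf \<notin> base_sides c False" using *[of int_rho_inf c False c] by simp
qed

theorem special_polygon_P: "special_polygon P E (side_inv G C je)"
  unfolding special_polygon_def
proof (intro conjI ballI impI convex_hyp_polygon_P)
  let ?\<sigma> = "side_inv G C je"
  fix s assume s: "s \<in> E"
  show "?\<sigma> s \<in> E" "?\<sigma> (?\<sigma> s) = s" by (fact side_inv_props[OF s])+
  obtain g t b where g: "bd g t" "b \<in> base_sides (whole g) t" "s = act g ` b" using E_cases[OF s] .
  show "is_copy int_0_inf s \<or> is_copy int_i_inf s \<or> is_copy int_rho_inf s"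
    unfolding g(3) copies[OF g(1,2)] using g(2) by (cases t; cases "whole g") auto
next
  let ?\<sigma> = "side_inv G C je"
  fix s assume s: "s \<in> E" and c: "is_copy int_0_inf s"
  show "?\<sigma> s \<noteq> s" by (fact side_inv_props(3)[OF s])
  from s show "is_copy int_0_inf (?\<sigma> s)"
  proof (cases rule: edge_cases)
    case (whole g)
    note m = mate[OF whole(1,2)]
    show ?thesis unfolding whole(4) using copies(1)[OF m(1), of int_0_inf] m(2) by simp
  next
    case (half g b b')
    then have "b \<in> base_sides (whole g) False" "b = int_i_0 \<or> b = int_i_inf" by auto
    then show ?thesis using copies(1)[OF half(1)] half(3) c int_i_neq by auto
  next
    case (rho g b b')
    then have "b \<in> base_sides (whole g) True" by auto
    then show ?thesis using copies(1)[OF rho(1)] rho(2) c base_sides_types by metis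
  qed
next
  let ?\<sigma> = "side_inv G C je"
  fix s assume s: "s \<in> E" and c: "is_copy int_i_inf s"
  from s show "\<exists>s'\<in>E. s' \<noteq> s \<and> is_copy int_i_inf s' \<and> ?\<sigma> s = s' \<and> ?\<sigma> s' = s \<and>
           (\<exists>v \<in> s \<inter> s'. internal_angle P v s s' pi)"
  proof (cases rule: edge_cases)
    case (whole g)
    then show ?thesis using copies(2)[OF whole(1), of int_0_inf] c int_i_neq by simp
  next
    case (half g b b')
    have bs: "b' \<in> base_sides (whole g) False" using half by auto
    have alt: "b = int_i_0 \<and> b' = int_i_inf \<or> b = int_i_inf \<and> b' = int_i_0"
      using half(4,5) by (auto simp: doubleton_eq_iff)
    have copy: "is_copy int_i_inf (?\<sigma> s)" using copies(2)[OF half(1) bs] alt half(6) by metis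
    have "act g \<i> \<in> act g ` int_i_0" "act g \<i> \<in> act g ` int_i_inf" using int_i_Int by blast+
    then have v: "act g \<i> \<in> s \<inter> ?\<sigma> s" using alt half(3,6) by (metis IntI)
    have angle: "internal_angle P (act g \<i>) s (?\<sigma> s) pi"
      using alt half(3,6) internal_angle_i[OF half(1)] internal_angle_commute by metis
    from side_inv_props[OF s] copy v angle show ?thesis
      by (intro bexI[of _ "?\<sigma> s"] conjI bexI[of _ "act g \<i>"] refl)
  next
    case (rho g b b')
    then have "b \<in> base_sides (whole g) True" by auto
    then show ?thesis using copies(2)[OF rho(1)] rho(2) c base_sides_types by metis
  qed
next
  let ?\<sigma> = "side_inv G C je"
  fix s assume s: "s \<in> E" and c: "is_copy int_rho_inf s"
  from s show "\<exists>s'\<in>E. s' \<noteq> s \<and> is_copy int_rho_inf s' \<and> ?\<sigma> s = s' \<and> ?\<sigma> s' = s \<and>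
           (\<exists>v \<in> s \<inter> s'. internal_angle P v s s' (2 * pi / 3))"
  proof (cases rule: edge_cases)
    case (whole g)
    then have "int_0_inf \<in> base_sides (whole g) False" by simp
    then show ?thesis using copies(3)[OF whole(1)] whole(3) c base_sides_types by metis
  next
    case (half g b b')
    then have "b \<in> base_sides (whole g) False" by auto
    then show ?thesis using copies(3)[OF half(1)] half(3) c base_sides_types by metis
  next
    case (rho g b b')
    have bs: "b' \<in> base_sides (whole g) True" using rho by auto
    have alt: "b = int_rho_0 \<and> b' = int_rho_inf \<or> b = int_rho_inf \<and> b' = int_rho_0"
      using rho(3,4) by (auto simp: doubleton_eq_iff)
    have copy: "is_copy int_rho_inf (?\<sigma> s)" using copies(3)[OF rho(1) bs] alt rho(5) by metis
    have "act g rho \<in> act g ` int_rho_0" "act g rho \<in> act g ` int_rho_inf" using int_rho_Int by blast+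
    then have v: "act g rho \<in> s \<inter> ?\<sigma> s" using alt rho(2,5) by (metis IntI)
    have angle: "internal_angle P (act g rho) s (?\<sigma> s) (2 * pi / 3)"
      using alt rho(2,5) internal_angle_rho[OF rho(1)] internal_angle_commute by metis
    from side_inv_props[OF s] copy v angle show ?thesis
      by (intro bexI[of _ "?\<sigma> s"] conjI bexI[of _ "act g rho"] refl)
  qed
qed

end


section \<open>The side pairings\<close>

context tree_domain begin

lemma carry_curve:
  assumes g: "bd g False" and m: "m \<in> \<Gamma>" and x: "x \<in> \<Gamma>"
    and \<gamma>: "range \<gamma> = act g ` int_0_inf"
  shows "act (pinv m) (act (carry m x g) (\<gamma> t)) = act x (act (pinv g) (\<gamma> t))"
    "act (pinv g) (\<gamma> t) \<in> int_0_inf" "\<gamma> t \<in> HH"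
proof -
  note gc = bd_carrier[OF g]
  have "\<gamma> t \<in> act g ` int_0_inf" using \<gamma> by blast
  then show H: "\<gamma> t \<in> HH" and "act (pinv g) (\<gamma> t) \<in> int_0_inf"
    using act_image_iff[OF gc int_subset_HH(1)] act_image_subset[OF gc int_subset_HH(1)] by blast+
  have "act (carry m x g) (\<gamma> t) = act m (act x (act (pinv g) (\<gamma> t)))"
    using gc m x H by (simp add: act_mult act_in_HH)
  then show "act (pinv m) (act (carry m x g) (\<gamma> t)) = act x (act (pinv g) (\<gamma> t))"
    using gc m x H by (simp add: act_inv_act(1) act_in_HH)
qed

text \<open>\<open>Sg\<close> takes i y to i / y and so reverses the imaginary axis. Combined with
  the reversed parameter, the velocity again points down, as it has to at the side of
  \<open>m\<close>.\<close>

lemma reverses_orientation_Sg: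
  assumes g: "bd g False" and m: "bd m False"
  shows "reverses_orientation P (act g ` int_0_inf) (act m ` int_0_inf) (carry m Sg g)"
  unfolding reverses_orientation_def
proof (intro allI impI)
  fix \<gamma> assume "induced_orientation P (act g ` int_0_inf) \<gamma>"
  then have \<gamma>: "inj \<gamma>" "range \<gamma> = act g ` int_0_inf"
    "\<And>t. \<exists>v. ((\<lambda>t. act (pinv g) (\<gamma> t)) has_vector_derivative v) (at t) \<and> Re v = 0 \<and> Im v < 0"
    unfolding induced_orientation_iff[OF g] by blast+
  note gc = bd_carrier[OF g] and mc = bd_carrier[OF m]
  note curve = carry_curve[OF g mc gens_in_carrier(1) \<gamma>(2)]
  have hc: "carry m Sg g \<in> \<Gamma>" using gc mc by simp
  show "induced_orientation P (act m ` int_0_inf) (\<lambda>t. act (carry m Sg g) (\<gamma> (- t)))"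
    unfolding induced_orientation_iff[OF m]
  proof (intro conjI allI)
    show "inj (\<lambda>t. act (carry m Sg g) (\<gamma> (- t)))"
    proof (rule injI)
      fix s t assume "act (carry m Sg g) (\<gamma> (- s)) = act (carry m Sg g) (\<gamma> (- t))"
      then have "\<gamma> (- s) = \<gamma> (- t)" using act_inj[OF hc curve(3) curve(3)] by blast
      then show "s = t" using injD[OF \<gamma>(1), of "- s" "- t"] by simp
    qed
    have "range (\<lambda>t. act (carry m Sg g) (\<gamma> (- t))) = act (carry m Sg g) ` \<gamma> ` range uminus"
      by (simp only: image_image)
    also have "\<dots> = act (carry m Sg g) ` act g ` int_0_inf" by (simp add: \<gamma>(2))
    also have "\<dots> = act m ` int_0_inf"
      using carry_image[OF gc mc gens_in_carrier(1) int_subset_HH(1)] by (simp only: act_Sg_int_0_inf)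
    finally show "range (\<lambda>t. act (carry m Sg g) (\<gamma> (- t))) = act m ` int_0_inf" .
    fix t :: real
    let ?w = "\<lambda>t. act (pinv g) (\<gamma> t)"
    obtain v where v: "(?w has_vector_derivative v) (at (- t))" "Re v = 0" "Im v < 0"
      using \<gamma>(3)[of "- t"] by blast
    have w: "?w (- t) \<in> HH" "Re (?w (- t)) = 0" using curve(2)[of "- t"] by (auto simp: int_0_inf_def)
    have "(uminus has_vector_derivative - 1) (at t)" by (auto intro!: derivative_eq_intros)
    from vector_diff_chain_at[OF this v(1)]
    have "((\<lambda>t. ?w (- t)) has_vector_derivative - v) (at t)" by (simp add: o_def)
    from field_vector_diff_chain_at[OF this act_Sg_deriv[OF w(1)]]
    have d: "((\<lambda>t. act Sg (?w (- t))) has_vector_derivative (- v) * (1 / (?w (- t))\<^sup>2)) (at t)"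
      by (simp add: o_def)
    have y: "?w (- t) = \<i> * of_real (Im (?w (- t)))" using w(2) by (simp add: complex_eq_iff)
    have "(?w (- t))\<^sup>2 = - of_real ((Im (?w (- t)))\<^sup>2)" by (subst y) (simp add: power_mult_distrib)
    then have "(- v) * (1 / (?w (- t))\<^sup>2) = v / of_real ((Im (?w (- t)))\<^sup>2)" by simp
    then have "Re ((- v) * (1 / (?w (- t))\<^sup>2)) = 0" "Im ((- v) * (1 / (?w (- t))\<^sup>2)) < 0"
      using v(2,3) w(1) by (simp_all only: Re_divide_of_real Im_divide_of_real)
        (simp_all add: HH_def divide_less_0_iff)
    then show "\<exists>v. ((\<lambda>t. act (pinv m) (act (carry m Sg g) (\<gamma> (- t)))) has_vector_derivative v) (at t) \<and>
        Re v = 0 \<and> Im v < 0"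
      unfolding curve(1) using d by blast
  qed
qed

text \<open>To refute a statement about all parametrisations, one that does induce the orientation
  is needed: the curve running down the axis at unit speed. The identity keeps its track, so
  reversing the parameter makes it run up.\<close>

lemma not_reverses_orientation_one:
  assumes g: "bd g False" and m: "bd m False"
  shows "\<not> reverses_orientation P (act g ` int_0_inf) (act m ` int_0_inf) (carry m one_psl g)"
proof
  assume rev: "reverses_orientation P (act g ` int_0_inf) (act m ` int_0_inf) (carry m one_psl g)"
  note gc = bd_carrier[OF g] and mc = bd_carrier[OF m]
  define w :: "real \<Rightarrow> complex" where "w t = \<i> * of_real (exp t)" for t
  have wH: "w t \<in> HH" for t by (simp add: w_def HH_def)
  have d: "((\<lambda>t. w (c * t)) has_vector_derivative \<i> * of_real (c * exp (c * t))) (at t)" for c t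
    unfolding w_def has_vector_derivative_complex_iff by (auto intro!: derivative_eq_intros)
  define \<gamma> where "\<gamma> t = act g (w (- t))" for t
  have kw: "act (pinv g) (\<gamma> t) = w (- t)" for t
    unfolding \<gamma>_def by (rule act_inv_act(1)[OF gc wH])
  have rw: "range (\<lambda>t. w (- t)) = int_0_inf"
  proof
    show "range (\<lambda>t. w (- t)) \<subseteq> int_0_inf" by (auto simp: w_def int_0_inf_def HH_def)
    show "int_0_inf \<subseteq> range (\<lambda>t. w (- t))"
    proof
      fix z assume "z \<in> int_0_inf"
      then have "z = w (- (- ln (Im z)))" by (simp add: w_def int_0_inf_def HH_def complex_eq_iff)
      then show "z \<in> range (\<lambda>t. w (- t))" by blast
    qed
  qed
  have r: "range \<gamma> = act g ` int_0_inf"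
    unfolding rw[symmetric] image_image \<gamma>_def ..
  have "induced_orientation P (act g ` int_0_inf) \<gamma>"
    unfolding induced_orientation_iff[OF g]
  proof (intro conjI allI r)
    show "inj \<gamma>"
    proof (rule injI)
      fix s t assume "\<gamma> s = \<gamma> t"
      then have "w (- s) = w (- t)" unfolding \<gamma>_def using act_inj[OF gc wH wH] by blast
      then show "s = t" by (simp add: w_def)
    qed
    fix t :: real
    show "\<exists>v. ((\<lambda>t. act (pinv g) (\<gamma> t)) has_vector_derivative v) (at t) \<and> Re v = 0 \<and> Im v < 0"
      unfolding kw using d[of "- 1" t] by (intro exI[of _ "\<i> * of_real (- 1 * exp (- 1 * t))"]) simp
  qed
  then have "induced_orientation P (act m ` int_0_inf) (\<lambda>t. act (carry m one_psl g) (\<gamma> (- t)))"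
    using rev unfolding reverses_orientation_def by blast
  then obtain v where v: "((\<lambda>t. act (pinv m) (act (carry m one_psl g) (\<gamma> (- t)))) has_vector_derivative v) (at 0)"
    "Im v < 0"
    unfolding induced_orientation_iff[OF m] by blast
  have "act (pinv m) (act (carry m one_psl g) (\<gamma> (- t))) = w t" for t
    using carry_curve(1)[OF g mc PSL.one_closed r, of "- t"] by (simp only: kw act_one minus_minus)
  then have "(w has_vector_derivative v) (at 0)" using v(1) by simp
  moreover have "(w has_vector_derivative \<i>) (at 0)" using d[of 1 0] by simp
  ultimately have "v = \<i>" by (rule vector_derivative_unique_at)
  then show False using v(2) by simp
qed

end

context cut_lift begin

abbreviation elt :: "complex set \<Rightarrow> psl" where "elt \<equiv> side_elt G C je"
abbreviation inv_side :: "complex set \<Rightarrow> complex set" where "inv_side \<equiv> side_inv G C je"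

text \<open>Taking the side to its partner, a condition common to all alternatives of the
  definition, already determines the element: by \<open>base_image\<close> only one element of the
  group takes \<open>b\<close> to \<open>b'\<close>.\<close>

lemma side_elt_uncut:
  assumes b: "bd g t" "t \<or> \<not> whole g" and bb: "base_sides (whole g) t = {b, b'}" "b \<noteq> b'"
    and l: "l \<in> letters t" "act l ` b = b'"
  shows "elt (act g ` b) = carry g l g"
proof -
  note gc = bd_carrier[OF b(1)] and lc = letters_carrier[OF l(1)]
  have cv: "cv t (cs g) = Uncut (vert_of t (cs g))" using base_sides_vert[OF b] by (simp add: cv_def)
  have bin: "b \<in> base_sides (whole g) t" "b' \<in> base_sides (whole g) t" using bb(1) by simp_all
  have sub: "b \<subseteq> HH" "b' \<subseteq> HH" using base_sides_subset[OF bin(1)] base_sides_subset[OF bin(2)] side_at_HH by blast+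
  have \<sigma>: "inv_side (act g ` b) = act g ` b'" by (rule side_inv_pair[OF b bb])
  have uni: "Uncut (vert_of t (cs g)) \<in> univalent_verts G C" using bd_univalent[OF b(1)] cv by simp
  have sd: "act g ` b \<in> sides G C je (Uncut (vert_of t (cs g)))"
    using sides_cv[OF b(1)] cv bb(1) by (simp add: sides_of_def)
  have im: "act (carry g l g) ` act g ` b = act g ` b'"
    using carry_image[OF gc gc lc sub(1)] l(2) by simp
  have im': "act (carry g l g) ` act g ` b' = act g ` b" if "\<not> t"
  proof -
    have "l = Sg" using l(1) that by simp
    then have "act l ` b' = act (Sg \<cdot> Sg) ` b"
      unfolding l(2)[symmetric] using act_image_mult[OF gens_in_carrier(1,1) sub(1)] by simp
    then have "act l ` b' = b" by (simp add: act_image_one)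
    then show ?thesis using carry_image[OF gc gc lc sub(2)] by simp
  qed
  have unique: "h = carry g l g" if h: "h \<in> \<Gamma>" "act h ` act g ` b = act g ` b'" for h
  proof -
    obtain x where x: "x \<in> \<Gamma>" "h = carry g x g" "act x ` b = b'"
      using maps_side[OF gc gc h(1) bin h(2)] .
    have "x = l"
      using base_image[OF x(1) bin x(3)] base_image[OF lc bin l(2)] bb(2) int_rho_0_neq by (elim conjE disjE) simp_all
    then show ?thesis using x(2) by simp
  qed
  have V: "V = Uncut (vert_of t (cs g))" if "V \<in> univalent_verts G C" "act g ` b \<in> sides G C je V" for V
    using univalent_vertex_of_side[OF b(1) bin(1) that] cv by simp
  show ?thesis
    unfolding side_elt_def \<sigma>
  proof (rule the_equality)
    have carr: "carry g l g \<in> \<Gamma>" using gc lc by simp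
    have ex: "(\<exists>D. Uncut (Inl D) \<in> univalent_verts G C \<and> act g ` b \<in> sides G C je (Uncut (Inl D)) \<and>
         act (carry g l g) ` act g ` b = act g ` b' \<and> act (carry g l g) ` act g ` b' = act g ` b) \<or>
       (\<exists>D. Uncut (Inr D) \<in> univalent_verts G C \<and> act g ` b \<in> sides G C je (Uncut (Inr D)) \<and>
         act (carry g l g) ` act g ` b = act g ` b')"
    proof (cases t)
      case True
      then obtain X where X: "vert_of t (cs g) = Inr X" by (simp add: vert_of_def)
      show ?thesis by (rule disjI2, rule exI[of _ X]) (use uni sd im X in simp)
    next
      case False
      then obtain X where X: "vert_of t (cs g) = Inl X" by (simp add: vert_of_def)
      show ?thesis by (rule disjI1, rule exI[of _ X]) (use uni sd im im' False X in simp)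
    qed
    show "carry g l g \<in> \<Gamma> \<and>
     ((\<exists>W e. Cut W e \<in> univalent_verts G C \<and> act g ` b \<in> sides G C je (Cut W e) \<and>
         act (carry g l g) ` act g ` b = act g ` b' \<and>
         reverses_orientation (polygon G C je) (act g ` b) (act g ` b') (carry g l g)) \<or>
      (\<exists>D. Uncut (Inl D) \<in> univalent_verts G C \<and> act g ` b \<in> sides G C je (Uncut (Inl D)) \<and>
         act (carry g l g) ` act g ` b = act g ` b' \<and> act (carry g l g) ` act g ` b' = act g ` b) \<or>
      (\<exists>D. Uncut (Inr D) \<in> univalent_verts G C \<and> act g ` b \<in> sides G C je (Uncut (Inr D)) \<and>
         act (carry g l g) ` act g ` b = act g ` b'))"
      by (rule conjI[OF carr disjI2[OF ex]])
  qed (elim conjE disjE exE, rule unique, assumption+, rule unique, assumption+, rule unique, assumption+)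
qed

text \<open>Both the identity and \<open>Sg\<close> preserve \<open>int_0_inf\<close>, so two
  elements take the side to its partner; the orientation excludes the one built from the
  identity.\<close>

lemma side_elt_whole:
  assumes b: "bd g False" and w: "whole g"
  shows "elt (act g ` int_0_inf) = carry (mate g) Sg g"
proof -
  note m = mate[OF b w]
  note gc = bd_carrier[OF b] and mc = bd_carrier[OF m(1)]
  have \<sigma>: "inv_side (act g ` int_0_inf) = act (mate g) ` int_0_inf" by (rule side_inv_whole[OF b w])
  have cv: "cv False (cs g) = Cut (vert_of False (cs g)) (cs g)" using w by (simp add: cv_def whole_def)
  have bin: "int_0_inf \<in> base_sides (whole g) False" "int_0_inf \<in> base_sides True False" using w by simp_all
  have uni: "Cut (vert_of False (cs g)) (cs g) \<in> univalent_verts G C" using bd_univalent[OF b] cv by simp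
  have sd: "act g ` int_0_inf \<in> sides G C je (Cut (vert_of False (cs g)) (cs g))"
    using sides_cv[OF b] cv w by (simp add: sides_of_def)
  let ?h = "carry (mate g) Sg g"
  have im: "act ?h ` act g ` int_0_inf = act (mate g) ` int_0_inf"
    using carry_image[OF gc mc gens_in_carrier(1) int_subset_HH(1)] by (simp only: act_Sg_int_0_inf)
  have V: "V = Cut (vert_of False (cs g)) (cs g)"
    if "V \<in> univalent_verts G C" "act g ` int_0_inf \<in> sides G C je V" for V
    using univalent_vertex_of_side[OF b bin(1) that] cv by simp
  show ?thesis
    unfolding side_elt_def \<sigma> polygon_eq
  proof (rule the_equality)
    have "?h \<in> \<Gamma>" using gc mc by simp
    moreover note uni sd im reverses_orientation_Sg[OF b m(1)]
    ultimately show "?h \<in> \<Gamma> \<and>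
     ((\<exists>W e. Cut W e \<in> univalent_verts G C \<and> act g ` int_0_inf \<in> sides G C je (Cut W e) \<and>
         act ?h ` act g ` int_0_inf = act (mate g) ` int_0_inf \<and>
         reverses_orientation P (act g ` int_0_inf) (act (mate g) ` int_0_inf) ?h) \<or>
      (\<exists>D. Uncut (Inl D) \<in> univalent_verts G C \<and> act g ` int_0_inf \<in> sides G C je (Uncut (Inl D)) \<and>
         act ?h ` act g ` int_0_inf = act (mate g) ` int_0_inf \<and>
         act ?h ` act (mate g) ` int_0_inf = act g ` int_0_inf) \<or>
      (\<exists>D. Uncut (Inr D) \<in> univalent_verts G C \<and> act g ` int_0_inf \<in> sides G C je (Uncut (Inr D)) \<and>
         act ?h ` act g ` int_0_inf = act (mate g) ` int_0_inf))"
      by (intro conjI disjI1 exI)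
    fix h
    assume "h \<in> \<Gamma> \<and>
     ((\<exists>W e. Cut W e \<in> univalent_verts G C \<and> act g ` int_0_inf \<in> sides G C je (Cut W e) \<and>
         act h ` act g ` int_0_inf = act (mate g) ` int_0_inf \<and>
         reverses_orientation P (act g ` int_0_inf) (act (mate g) ` int_0_inf) h) \<or>
      (\<exists>D. Uncut (Inl D) \<in> univalent_verts G C \<and> act g ` int_0_inf \<in> sides G C je (Uncut (Inl D)) \<and>
         act h ` act g ` int_0_inf = act (mate g) ` int_0_inf \<and>
         act h ` act (mate g) ` int_0_inf = act g ` int_0_inf) \<or>
      (\<exists>D. Uncut (Inr D) \<in> univalent_verts G C \<and> act g ` int_0_inf \<in> sides G C je (Uncut (Inr D)) \<and>
         act h ` act g ` int_0_inf = act (mate g) ` int_0_inf))"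
    then show "h = ?h"
    proof (elim conjE disjE exE)
      assume h: "h \<in> \<Gamma>" "act h ` act g ` int_0_inf = act (mate g) ` int_0_inf"
        "reverses_orientation P (act g ` int_0_inf) (act (mate g) ` int_0_inf) h"
      obtain x where x: "x \<in> \<Gamma>" "h = carry (mate g) x g" "act x ` int_0_inf = int_0_inf"
        using maps_side[OF gc mc h(1) bin(2,2) h(2)] .
      from base_image[OF x(1) bin(2,2) x(3)] have "x = one_psl \<or> x = Sg" by auto
      moreover have "x \<noteq> one_psl"
        using not_reverses_orientation_one[OF b m(1)] h(3) x(2) by metis
      ultimately show "h = ?h" using x(2) by blast
    next
      fix X assume "Uncut (Inl X) \<in> univalent_verts G C" "act g ` int_0_inf \<in> sides G C je (Uncut (Inl X))"
      from V[OF this] show "h = ?h" by simp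
    next
      fix X assume "Uncut (Inr X) \<in> univalent_verts G C" "act g ` int_0_inf \<in> sides G C je (Uncut (Inr X))"
      from V[OF this] show "h = ?h" by simp
    qed
  qed
qed

lemma side_data:
  assumes "s \<in> E"
  obtains (whole) g where "bd g False" "whole g" "s = act g ` int_0_inf" "inv_side s = act (mate g) ` int_0_inf"
      "elt s = carry (mate g) Sg g" "elt (inv_side s) = carry g Sg (mate g)"
    | (uncut) g t b b' l where "bd g t" "b \<in> base_sides (whole g) t" "b' \<in> base_sides (whole g) t"
      "s = act g ` b" "inv_side s = act g ` b'" "l \<in> letters t" "elt s = carry g l g"
      "elt (inv_side s) = carry g (pinv l) g" "t \<or> \<not> whole g"
  using assms
proof (cases rule: edge_cases)
  case c: (whole g)
  note m = mate[OF c(1,2)]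
  have "elt s = carry (mate g) Sg g" using side_elt_whole[OF c(1,2)] c(3) by metis
  moreover have "elt (inv_side s) = carry g Sg (mate g)" using side_elt_whole[OF m(1,2)] m(4) c(4) by metis
  ultimately show ?thesis using c by (intro whole[of g])
next
  case c: (half g b b')
  have bs: "base_sides (whole g) False = {b, b'}" "base_sides (whole g) False = {b', b}" using c(2,4) by auto
  have "b = int_i_0 \<and> b' = int_i_inf \<or> b = int_i_inf \<and> b' = int_i_0"
    using c(4,5) by (auto simp: doubleton_eq_iff)
  then have im: "act Sg ` b = b'" "act Sg ` b' = b" using act_Sg_int_i_inf act_Sg_int_i_0 by metis+
  have S: "Sg \<in> letters False" "pinv Sg = Sg" by simp_all
  have bi: "b \<in> base_sides (local.whole g) False" "b' \<in> base_sides (local.whole g) False"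
    by (simp_all add: bs(1))
  have e1: "elt s = carry g Sg g"
    unfolding c(3) using c(2) by (intro side_elt_uncut[OF c(1) _ bs(1) c(5) S(1) im(1)]) simp
  have e2: "elt (inv_side s) = carry g (pinv Sg) g"
    unfolding c(6) S(2) using c(2) by (intro side_elt_uncut[OF c(1) _ bs(2) c(5)[symmetric] S(1) im(2)]) simp
  show ?thesis by (rule uncut[OF c(1) bi c(3,6) S(1) e1 e2 disjI2[OF c(2)]])
next
  case c: (rho g b b')
  have bs: "base_sides (whole g) True = {b, b'}" "base_sides (whole g) True = {b', b}" using c(3) by auto
  have "b = int_rho_0 \<and> b' = int_rho_inf \<or> b = int_rho_inf \<and> b' = int_rho_0"
    using c(3,4) by (auto simp: doubleton_eq_iff)
  then have "\<exists>l. (l = Rg \<or> l = R2g) \<and> act l ` b = b' \<and> act (pinv l) ` b' = b"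
    using act_Rg_int_rho_inf act_R2g_int_rho_0 gens_inv by metis
  then obtain l where l: "l \<in> letters True" "act l ` b = b'" "act (pinv l) ` b' = b" by auto
  have bi: "b \<in> base_sides (local.whole g) True" "b' \<in> base_sides (local.whole g) True"
    by (simp_all only: bs(1)) simp_all
  have e1: "elt s = carry g l g"
    unfolding c(2) by (rule side_elt_uncut[OF c(1) _ bs(1) c(4) l(1,2)]) simp
  have e2: "elt (inv_side s) = carry g (pinv l) g"
    unfolding c(5) by (rule side_elt_uncut[OF c(1) _ bs(2) c(4)[symmetric] letters_inv[OF l(1)] l(3)]) simp
  show ?thesis by (rule uncut[OF c(1) bi c(2,5) l(1) e1 e2]) simp
qed

end


section \<open>Independence of the side pairings\<close>

lemma (in cut_lift) cs_eq_imp_G: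
  assumes "x \<in> \<Gamma>" "y \<in> \<Gamma>" "cs x = cs y"
  shows "y \<cdot> pinv x \<in> G"
proof -
  have "y \<in> cs x" using PSL.rcos_self[OF assms(2) subgroup_G] assms(3) by simp
  then obtain a where a: "a \<in> G" "y = a \<cdot> x" by (auto simp: r_coset_def)
  then have "y \<cdot> pinv x = a"
    using assms(1) subgroup.mem_carrier[OF subgroup_G a(1)] by (simp add: PSL.m_assoc)
  then show ?thesis using a(1) by simp
qed

context cut_lift begin

lemma side_elt_inv:
  assumes "s \<in> E" shows "elt (inv_side s) = pinv (elt s)"
  using assms
proof (cases rule: side_data)
  case (whole g)
  have "pinv (carry (mate g) Sg g) = carry g Sg (mate g)"
    using inv_carry[OF bd_carrier[OF whole(1)] bd_carrier[OF mate(1)[OF whole(1,2)]] gens_in_carrier(1)]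
    by (simp only: gens_inv)
  then show ?thesis using whole(5,6) by simp
next
  case (uncut g t b b' l)
  note c = bd_carrier[OF uncut(1)]
  show ?thesis unfolding uncut(7,8) by (rule inv_carry[OF c c letters_carrier[OF uncut(6)], symmetric])
qed

lemma carry_G:
  assumes "bd g t" "t \<or> \<not> whole g" "l \<in> letters t"
  shows "carry g l g \<in> G"
proof -
  note gc = bd_carrier[OF assms(1)] and lc = letters_carrier[OF assms(3)]
  have "vert_of t (cs g) \<notin> C" by (rule base_sides_vert[OF assms(1,2)])
  then have "\<forall>k\<in>K t. cs (g \<cdot> k) = cs g"
    using bd_univalent[OF assms(1)] univalent_iff[OF gc] by blast
  then have "cs g = cs (g \<cdot> l)" using assms(3) by (simp add: K_eq)
  then show ?thesis using cs_eq_imp_G[OF gc PSL.m_closed[OF gc lc]] by simp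
qed

lemma side_elt_G:
  assumes "s \<in> E" shows "elt s \<in> G"
  using assms
proof (cases rule: side_data)
  case (whole g)
  note gc = bd_carrier[OF whole(1)]
  note m = mate[OF whole(1,2)]
  have "mate g \<cdot> pinv (g \<cdot> Sg) \<in> G"
    using cs_eq_imp_G[OF _ bd_carrier[OF m(1)] m(6)[symmetric]] gc by simp
  moreover have "mate g \<cdot> pinv (g \<cdot> Sg) = carry (mate g) Sg g"
    using gc bd_carrier[OF m(1)] by (simp add: PSL.inv_mult_group PSL.m_assoc)
  ultimately show ?thesis using whole(5) by simp
next
  case (uncut g t b b' l)
  show ?thesis unfolding uncut(7) by (rule carry_G[OF uncut(1,9,6)])
qed

text \<open>The translates of \<open>D\<close> under the generated group exhaust the modular group,
  since each step out of \<open>D\<close> can be absorbed by a pairing on the left. As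
  \<open>D\<close> contains only one edge of each coset of \<open>G\<close>, no element of
  \<open>G\<close> is left over.\<close>

lemma side_elts_generate:
  assumes S: "S \<subseteq> E" "\<And>s. s \<in> E \<Longrightarrow> s \<in> S \<or> inv_side s \<in> S"
  shows "generate PSL2Z (elt ` S) = G"
proof -
  let ?G' = "generate PSL2Z (elt ` S)"
  have sub: "elt ` S \<subseteq> G" using S(1) side_elt_G by blast
  have G': "subgroup ?G' PSL2Z" using sub G_carrier by (intro PSL.generate_is_subgroup) blast
  have G'G: "?G' \<subseteq> G" by (rule PSL.generate_subgroup_incl[OF sub subgroup_G])
  have elt: "elt s \<in> ?G'" if s: "s \<in> E" for s
  proof (cases "s \<in> S")
    case True
    then show ?thesis by (intro generate.incl imageI)
  next
    case False
    then have "elt (inv_side s) \<in> ?G'" using S(2)[OF s] by (intro generate.incl imageI) blast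
    then have "pinv (pinv (elt s)) \<in> ?G'"
      unfolding side_elt_inv[OF s] by (rule subgroup.m_inv_closed[OF G'])
    moreover have "elt s \<in> \<Gamma>" using side_elt_G[OF s] G_carrier by blast
    ultimately show ?thesis by simp
  qed
  have step: "\<exists>a\<in>?G'. \<exists>h\<in>D. g \<cdot> l = a \<cdot> h" if g: "g \<in> D" and l: "l = Sg \<and> \<not> t \<or> l = Rg \<and> t" for g l t
  proof (cases "bd g t")
    case False
    moreover have "l \<in> letters t" using l by auto
    ultimately have "g \<cdot> l \<in> D" using not_bd[OF g] by blast
    moreover from this have "g \<cdot> l = one_psl \<cdot> (g \<cdot> l)" using D_carrier by auto
    ultimately show ?thesis using generate.one by blast
  next
    case b: True
    note gc = bd_carrier[OF b]
    have lt: "l \<in> letters t" using l by auto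
    show ?thesis
    proof (cases "t \<or> \<not> whole g")
      case True
      have "carry g l g \<in> ?G'"
      proof (cases t)
        case t: True
        have "int_rho_inf \<in> base_sides (whole g) True" by simp
        then have "act g ` int_rho_inf \<in> E" using E_intro b t by simp
        moreover have "elt (act g ` int_rho_inf) = carry g l g"
          using b t l int_rho_0_neq by (intro side_elt_uncut[of g True int_rho_inf int_rho_0]) (auto simp: act_Rg_int_rho_inf)
        ultimately show ?thesis using elt by metis
      next
        case t: False
        then have w: "\<not> whole g" using True by simp
        then have "int_i_inf \<in> base_sides (whole g) False" by simp
        then have "act g ` int_i_inf \<in> E" using E_intro b t by simp
        moreover have "elt (act g ` int_i_inf) = carry g l g"
          using b t l w int_i_neq by (intro side_elt_uncut[of g False int_i_inf int_i_0]) (auto simp: act_Sg_int_i_inf)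
        ultimately show ?thesis using elt by metis
      qed
      moreover have "g \<cdot> l = carry g l g \<cdot> g"
        using gc letters_carrier[OF lt] by (simp add: PSL.m_assoc)
      ultimately show ?thesis using g by blast
    next
      case False
      \<comment> \<open>Beyond the cut vertex lies \<open>g \<cdot> Sg\<close>, which is the
        translate of \<open>mate g\<close> by the pairing of the side of
        \<open>mate g\<close>.\<close>
      then have t: "\<not> t" and w: "whole g" by simp_all
      then have lS: "l = Sg" and b': "bd g False" using l b by simp_all
      note m = mate[OF b' w]
      have "int_0_inf \<in> base_sides (whole (mate g)) False" using m(2) by simp
      then have "act (mate g) ` int_0_inf \<in> E" by (rule E_intro[OF m(1)])
      then have "carry g Sg (mate g) \<in> ?G'"
        using elt side_elt_whole[OF m(1,2)] m(4) by metis
      moreover have "g \<cdot> l = carry g Sg (mate g) \<cdot> mate g"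
        using gc bd_carrier[OF m(1)] by (simp add: PSL.m_assoc lS)
      ultimately show ?thesis using bd_D[OF m(1)] by blast
    qed
  qed
  have cover: "\<exists>a\<in>?G'. \<exists>h\<in>D. d \<cdot> x = a \<cdot> h" if d: "d \<in> D" and x: "x \<in> \<Gamma>" for d x
  proof -
    have dc: "d \<in> \<Gamma>" using d D_carrier by blast
    have gen: "\<exists>a\<in>?G'. \<exists>h\<in>D. d \<cdot> (x \<cdot> l) = a \<cdot> h"
      if x: "x \<in> \<Gamma>" and IH: "\<exists>a\<in>?G'. \<exists>h\<in>D. d \<cdot> x = a \<cdot> h"
        and l: "l = Sg \<and> \<not> t \<or> l = Rg \<and> t" for x l t
    proof -
      have lc: "l \<in> \<Gamma>" using l by auto
      obtain a h where ah: "a \<in> ?G'" "h \<in> D" "d \<cdot> x = a \<cdot> h" using IH by blast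
      obtain a' h' where ah': "a' \<in> ?G'" "h' \<in> D" "h \<cdot> l = a' \<cdot> h'"
        using step[OF ah(2) l] by blast
      have c: "a \<in> \<Gamma>" "a' \<in> \<Gamma>" "h \<in> \<Gamma>" "h' \<in> \<Gamma>"
        using ah ah' D_carrier subgroup.mem_carrier[OF G'] by blast+
      have "d \<cdot> (x \<cdot> l) = a \<cdot> h \<cdot> l"
        unfolding ah(3)[symmetric] using dc x lc by (simp add: PSL.m_assoc)
      also have "\<dots> = a \<cdot> a' \<cdot> h'" using c lc ah'(3) by (simp add: PSL.m_assoc)
      finally show ?thesis using subgroup.m_closed[OF G' ah(1) ah'(1)] ah'(2) by blast
    qed
    from x show ?thesis
    proof (induction rule: PSL_right_induct)
      case one
      have "d \<cdot> one_psl = one_psl \<cdot> d" using dc by simp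
      then show ?case using d generate.one by blast
    next
      case (S x)
      then show ?case using gen[of x Sg False] by simp
    next
      case (R x)
      then show ?case using gen[of x Rg True] by simp
    qed
  qed
  have "G \<subseteq> ?G'"
  proof
    fix x assume x: "x \<in> G"
    then have xc: "x \<in> \<Gamma>" using G_carrier by blast
    obtain d where d: "d \<in> D" using D_nonempty by blast
    then have dc: "d \<in> \<Gamma>" using D_carrier by blast
    have "pinv d \<cdot> (x \<cdot> d) \<in> \<Gamma>" using xc dc by simp
    from cover[OF d this] obtain a h where
      ah: "a \<in> ?G'" "h \<in> D" "d \<cdot> (pinv d \<cdot> (x \<cdot> d)) = a \<cdot> h" by blast
    then have eq: "x \<cdot> d = a \<cdot> h" using xc dc by (simp flip: PSL.m_assoc)
    have c: "a \<in> G" "h \<in> \<Gamma>" using ah G'G D_carrier by blast+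
    then have ac: "a \<in> \<Gamma>" using G_carrier by blast
    have "cs (y \<cdot> z) = cs z" if "y \<in> G" "z \<in> \<Gamma>" for y z
    proof -
      have yc: "y \<in> \<Gamma>" using that(1) G_carrier by blast
      have "cs (y \<cdot> z) = cs y #>\<^bsub>PSL2Z\<^esub> z"
        using PSL.coset_mult_assoc[OF G_carrier yc that(2)] by simp
      also have "cs y = G" by (rule PSL.coset_join2[OF yc subgroup_G that(1)])
      finally show ?thesis .
    qed
    \<comment> \<open>Multiplication by elements of \<open>G\<close> on the left does not change the
      coset, and \<open>D\<close> meets each coset once.\<close>
    then have "cs d = cs h" using eq x c dc by metis
    then have "d = h" using D_inj d ah(2) by blast
    then have "x = a" using eq PSL.right_cancel[OF c(2) xc ac] by simp
    then show "x \<in> ?G'" using ah(1) by simp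
  qed
  then show ?thesis using G'G by blast
qed

text \<open>Both sides at an uncut vertex have the same set \<open>beyond\<close>.\<close>

definition beyond :: "complex set \<Rightarrow> psl set" where
  "beyond s = {p \<in> \<Gamma>. \<exists>g t b. bd g t \<and> b \<in> base_sides (whole g) t \<and> s = act g ` b \<and>
     branch t (pinv g \<cdot> p)}"

lemma beyond_eq:
  assumes "bd g t" "b \<in> base_sides (whole g) t"
  shows "beyond (act g ` b) = {p \<in> \<Gamma>. branch t (pinv g \<cdot> p)}"
  unfolding beyond_def using assms side_unique[OF assms] by blast

text \<open>By \<open>bd_branch\<close> neither of two edges of \<open>D\<close> lies beyond a
  univalent vertex of the other, which is the situation of \<open>branch_mult\<close>.\<close>

lemma branches_disjoint:
  assumes "bd g t" "bd h u" "p \<in> \<Gamma>"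
    "branch t (pinv g \<cdot> p)" "branch u (pinv h \<cdot> p)"
  shows "g = h \<and> t = u"
proof (rule ccontr)
  assume ne: "\<not> (g = h \<and> t = u)"
  note gc = bd_carrier[OF assms(1)] and hc = bd_carrier[OF assms(2)]
  let ?x = "pinv g \<cdot> h"
  have xc: "?x \<in> \<Gamma>" using gc hc by simp
  have inv: "pinv ?x = pinv h \<cdot> g" using gc hc by (simp add: PSL.inv_mult_group)
  have "?x \<noteq> one_psl \<or> t \<noteq> u"
  proof (rule ccontr)
    assume "\<not> (?x \<noteq> one_psl \<or> t \<noteq> u)"
    then have "?x = one_psl" "t = u" by auto
    moreover have "g \<cdot> ?x = h" using gc hc by (simp flip: PSL.m_assoc)
    ultimately show False using ne gc by simp
  qed
  moreover have "\<not> branch t ?x" by (rule bd_branch[OF assms(1) bd_D[OF assms(2)]])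
  moreover have "\<not> branch u (pinv ?x)" unfolding inv by (rule bd_branch[OF assms(2) bd_D[OF assms(1)]])
  ultimately have "\<not> branch t (?x \<cdot> (pinv h \<cdot> p))"
    using branch_mult[OF xc _ _ _ assms(5)] by blast
  moreover have "?x \<cdot> (pinv h \<cdot> p)
      = pinv g \<cdot> (h \<cdot> pinv h) \<cdot> p"
    using gc hc assms(3) by (simp only: PSL.m_assoc PSL.m_closed PSL.inv_closed)
  ultimately show False using assms(4) gc hc by simp
qed

lemma beyond_meet:
  assumes s: "s \<in> E" "s' \<in> E" and p: "p \<in> beyond s" "p \<in> beyond s'"
  shows "s' = s \<or> s' = inv_side s"
proof -
  obtain g t b where g: "bd g t" "b \<in> base_sides (whole g) t" "s = act g ` b"
    "branch t (pinv g \<cdot> p)" "p \<in> \<Gamma>"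
    using p(1) unfolding beyond_def by blast
  obtain h u c where h: "bd h u" "c \<in> base_sides (whole h) u" "s' = act h ` c"
    "branch u (pinv h \<cdot> p)"
    using p(2) unfolding beyond_def by blast
  have gh: "g = h" "t = u" using branches_disjoint[OF g(1) h(1) g(5,4) h(4)] by simp_all
  show ?thesis
  proof (cases "b = c")
    case True
    then show ?thesis using g(3) h(3) gh by simp
  next
    case False
    have c: "c \<in> base_sides (whole g) t" using h(2) gh by simp
    have "t \<or> \<not> whole g" "base_sides (whole g) t = {b, c}"
      using g(2) c False by (cases t; cases "whole g"; auto)+
    then have "inv_side s = act g ` c" unfolding g(3) using False by (intro side_inv_pair[OF g(1)])
    then show ?thesis using h(3) gh by simp
  qed
qed

lemma generate_carry:
  assumes g: "g \<in> \<Gamma>" and l: "l \<in> letters t" and x: "x \<in> generate PSL2Z {carry g l g}"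
  shows "\<exists>m\<in>K t. x = carry g m g"
  using x
proof (induction rule: generate.induct)
  case one
  then show ?case using g by (intro bexI[of _ "one_psl"]) (auto simp: K_eq)
next
  case (incl h)
  then show ?case using l by (auto simp: K_eq)
next
  case (inv h)
  then show ?case using inv_carry[OF g g letters_carrier[OF l]] letters_inv[OF l] by (auto simp: K_eq)
next
  case (eng h1 h2)
  then obtain m1 m2 where m: "m1 \<in> K t" "h1 = carry g m1 g" "m2 \<in> K t" "h2 = carry g m2 g" by blast
  then have "h1 \<cdot> h2 = carry g (m1 \<cdot> m2) g" using carry_mult[OF g] K_carrier by blast
  then show ?case using subgroup.m_closed[OF subgroup_K m(1,3)] by blast
qed

text \<open>One application takes everything that is not beyond \<open>g\<close> to the part beyond
  \<open>h\<close>. This part is disjoint from the one beyond \<open>g\<close>, so the step can be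
  repeated indefinitely.\<close>

lemma carry_pow_branch:
  assumes g: "bd g False" and h: "bd h False" and ne: "g \<noteq> h" and p: "p \<in> \<Gamma>"
    and br: "\<not> branch False (pinv g \<cdot> p)"
  shows "branch False (pinv h \<cdot> (carry h Sg g [^]\<^bsub>PSL2Z\<^esub> Suc n \<cdot> p))"
proof -
  note gc = bd_carrier[OF g] and hc = bd_carrier[OF h]
  let ?k = "carry h Sg g"
  have kc: "?k \<in> \<Gamma>" using gc hc by simp
  have one: "branch False (pinv h \<cdot> (?k \<cdot> q))"
    if q: "q \<in> \<Gamma>" "\<not> branch False (pinv g \<cdot> q)" for q
  proof -
    have "branch False (Sg \<cdot> (pinv g \<cdot> q))"
      using q gc by (intro branch_letter_mult) auto
    then show ?thesis unfolding carry_apply[OF gc hc gens_in_carrier(1) q(1)] .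
  qed
  show ?thesis
  proof (induction n)
    case 0
    then show ?case using one[OF p br] kc by simp
  next
    case (Suc n)
    define q where "q = ?k [^]\<^bsub>PSL2Z\<^esub> Suc n \<cdot> p"
    have qc: "q \<in> \<Gamma>" using kc p by (simp add: q_def)
    have "\<not> branch False (pinv g \<cdot> q)"
      using branches_disjoint[OF g h qc] Suc ne unfolding q_def[symmetric] by blast
    from one[OF qc this] have "branch False (pinv h \<cdot> (?k \<cdot> q))" .
    moreover have "?k \<cdot> q = ?k [^]\<^bsub>PSL2Z\<^esub> Suc (Suc n) \<cdot> p"
      unfolding q_def PSL.nat_pow_Suc2[OF kc, of "Suc n"] using kc p
      by (simp add: PSL.m_assoc PSL.nat_pow_closed del: PSL.nat_pow_Suc)
    ultimately show ?case by simp
  qed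
qed

text \<open>At an uncut vertex the cyclic group lies in a conjugate of \<open>K t\<close>, and its
  nontrivial elements act like letters seen from \<open>g\<close>. At a cut vertex the positive
  powers lead beyond the partner of \<open>s\<close> and the negative powers beyond \<open>s\<close>
  itself.\<close>

lemma beyond_pong:
  assumes s: "s \<in> E" and x: "x \<in> generate PSL2Z {elt s}" "x \<noteq> one_psl"
    and p: "p \<in> \<Gamma>" "p \<notin> beyond s \<union> beyond (inv_side s)"
  shows "x \<cdot> p \<in> beyond s \<union> beyond (inv_side s)"
proof -
  have ec: "elt s \<in> \<Gamma>" using side_elt_G[OF s] G_carrier by blast
  then have xc: "x \<in> \<Gamma>" using PSL.generate_in_carrier[of "{elt s}" x] x(1) by simp
  from s show ?thesis
  proof (cases rule: side_data)
    case (uncut g t b b' l)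
    note gc = bd_carrier[OF uncut(1)]
    obtain m where m: "m \<in> K t" "x = carry g m g"
      using generate_carry[OF gc uncut(6), of x] x(1) uncut(7) by auto
    have "m \<noteq> one_psl" using x(2) m(2) gc by auto
    then have ml: "m \<in> letters t" using m(1) by (simp add: K_eq)
    have "\<not> branch t (pinv g \<cdot> p)"
      using p unfolding uncut(4) beyond_eq[OF uncut(1,2)] by blast
    then have "branch t (m \<cdot> (pinv g \<cdot> p))"
      using ml gc p(1) by (intro branch_letter_mult) auto
    then have "branch t (pinv g \<cdot> (x \<cdot> p))"
      unfolding m(2) carry_apply[OF gc gc letters_carrier[OF ml] p(1)] .
    then show ?thesis unfolding uncut(4) beyond_eq[OF uncut(1,2)] using xc p(1) by simp
  next
    case (whole g)
    note m = mate[OF whole(1,2)]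
    note gc = bd_carrier[OF whole(1)] and mc = bd_carrier[OF m(1)]
    have bin: "int_0_inf \<in> base_sides (local.whole g) False" "int_0_inf \<in> base_sides (local.whole (mate g)) False"
      using whole(2) m(2) by simp_all
    have out: "beyond s = {p \<in> \<Gamma>. branch False (pinv g \<cdot> p)}"
      "beyond (inv_side s) = {p \<in> \<Gamma>. branch False (pinv (mate g) \<cdot> p)}"
      using beyond_eq[OF whole(1) bin(1)] beyond_eq[OF m(1) bin(2)] whole(3,4) by metis+
    have np: "\<not> branch False (pinv g \<cdot> p)" "\<not> branch False (pinv (mate g) \<cdot> p)"
      using p unfolding out by simp_all
    obtain k :: int where k: "x = elt s [^]\<^bsub>PSL2Z\<^esub> k" using PSL.generate_pow[OF ec] x(1) by blast
    have inv: "pinv (elt s) = carry g Sg (mate g)" using side_elt_inv[OF s] whole(6) by simp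
    have "k \<noteq> 0" using k x(2) by auto
    then consider n where "k = int (Suc n)" | n where "k = - int (Suc n)"
      by (metis int_cases not0_implies_Suc of_nat_0 minus_zero)
    then have "branch False (pinv (mate g) \<cdot> (x \<cdot> p)) \<or>
      branch False (pinv g \<cdot> (x \<cdot> p))"
    proof cases
      case (1 n)
      have "x = carry (mate g) Sg g [^]\<^bsub>PSL2Z\<^esub> Suc n" unfolding k 1 int_pow_int whole(5) ..
      then show ?thesis using carry_pow_branch[OF whole(1) m(1) m(3)[symmetric] p(1) np(1)] by metis
    next
      case (2 n)
      have "x = pinv (elt s [^]\<^bsub>PSL2Z\<^esub> Suc n)" unfolding k 2 by (rule PSL.int_pow_neg_int[OF ec])
      also have "\<dots> = carry g Sg (mate g) [^]\<^bsub>PSL2Z\<^esub> Suc n"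
        unfolding inv[symmetric] by (rule PSL.nat_pow_inv[OF ec, symmetric])
      finally show ?thesis using carry_pow_branch[OF m(1) whole(1) m(3) p(1) np(2)] by metis
    qed
    moreover have "x \<cdot> p \<in> \<Gamma>" using xc p(1) by simp
    ultimately show ?thesis unfolding out by auto
  qed
qed

theorem independent_side_elts:
  assumes S: "S \<subseteq> E" "\<forall>s\<in>E. \<exists>!t. t \<in> S \<inter> {s, inv_side s}"
  shows "independent_generators (PSL2Z\<lparr>carrier := G\<rparr>) (elt ` S)"
proof -
  let ?H = "PSL2Z\<lparr>carrier := G\<rparr>"
  \<comment> \<open>The factors of the free product are indexed by group elements, so one side is
    chosen for each generator.\<close>
  define side where "side = inv_into S elt"
  have side: "side k \<in> S" "elt (side k) = k" if "k \<in> elt ` S" for k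
    using that by (simp_all add: side_def inv_into_into f_inv_into_f)
  have sideE: "side k \<in> E" if "k \<in> elt ` S" for k using side(1)[OF that] S(1) by blast
  have sub: "elt ` S \<subseteq> G" using S(1) side_elt_G by blast
  obtain d where d: "d \<in> D" using D_nonempty by blast
  have dc: "d \<in> \<Gamma>" using d D_carrier by blast
  have d_out: "d \<notin> beyond s" for s
  proof
    assume "d \<in> beyond s"
    then obtain g t where "bd g t" "branch t (pinv g \<cdot> d)" by (auto simp: beyond_def)
    then show False using bd_branch[OF _ d] by metis
  qed
  \<comment> \<open>\<open>S\<close> contains only one member of each orbit, so the sides chosen for
    different generators lie in different orbits and their sets are disjoint.\<close>
  have same: "s = s'" if s: "s \<in> S" "s' \<in> S" "s' = s \<or> s' = inv_side s" for s s'
  proof -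
    have "\<exists>!t. t \<in> S \<inter> {s, inv_side s}" using S(2) subsetD[OF S(1) s(1)] by (rule bspec)
    then obtain t where t: "\<And>u. u \<in> S \<inter> {s, inv_side s} \<Longrightarrow> u = t" by (elim ex1E) metis
    have "s = t" "s' = t" using s by (auto intro!: t)
    then show ?thesis by simp
  qed
  have meets: "s \<in> S \<or> inv_side s \<in> S" if s: "s \<in> E" for s
  proof -
    have "\<exists>!t. t \<in> S \<inter> {s, inv_side s}" using S(2) s by (rule bspec)
    then show ?thesis by (elim ex1E) auto
  qed
  interpret ping_pong ?H "elt ` S" "\<Gamma>" "\<lambda>x p. x \<cdot> p"
    "\<lambda>k. beyond (side k) \<union> beyond (inv_side (side k))" d
  proof (intro ping_pong.intro ping_pong_axioms.intro)
    show "group ?H" by (rule PSL.subgroup_imp_group[OF subgroup_G])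
    show "elt ` S \<subseteq> carrier ?H" using sub by simp
    have "generate ?H (elt ` S) = generate PSL2Z (elt ` S)"
      by (rule PSL.generate_consistent[OF sub subgroup_G])
    also have "\<dots> = G" using S(1) meets by (rule side_elts_generate)
    finally show "generate ?H (elt ` S) = carrier ?H" by simp
    show "x \<otimes>\<^bsub>?H\<^esub> y \<cdot> p = x \<cdot> (y \<cdot> p)"
      if "x \<in> carrier ?H" "y \<in> carrier ?H" "p \<in> \<Gamma>" for x y p
      using that G_carrier by (simp add: PSL.m_assoc subset_iff)
    show "\<one>\<^bsub>?H\<^esub> \<cdot> p = p" if "p \<in> \<Gamma>" for p using that by simp
    show "x \<cdot> p \<in> \<Gamma>" if "x \<in> carrier ?H" "p \<in> \<Gamma>" for x p
      using that G_carrier by auto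
    show "d \<in> \<Gamma>" by (rule dc)
    show "d \<notin> beyond (side k) \<union> beyond (inv_side (side k))" if "k \<in> elt ` S" for k
      using d_out by blast
    show "(beyond (side k) \<union> beyond (inv_side (side k))) \<inter> (beyond (side k') \<union> beyond (inv_side (side k'))) = {}"
      if k: "k \<in> elt ` S" "k' \<in> elt ` S" "k \<noteq> k'" for k k'
    proof (rule ccontr)
      assume "\<not> ?thesis"
      then obtain p u v where uv: "u \<in> {side k, inv_side (side k)}" "v \<in> {side k', inv_side (side k')}"
        "p \<in> beyond u" "p \<in> beyond v" by blast
      note E = sideE[OF k(1)] sideE[OF k(2)]
      note inv = side_inv_props(1,2)[OF E(1)] side_inv_props(1,2)[OF E(2)]
      have "u \<in> E" "v \<in> E" using uv(1,2) E inv by auto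
      then have "v = u \<or> v = inv_side u" using beyond_meet uv(3,4) by blast
      then have "side k' = side k \<or> side k' = inv_side (side k)" using uv(1,2) inv by (metis insertE singletonD)
      then have "side k = side k'" using same side(1) k by blast
      then show False using side(2) k by metis
    qed
    show "x \<cdot> p \<in> beyond (side k) \<union> beyond (inv_side (side k))"
      if k: "k \<in> elt ` S" and x: "x \<in> generate ?H {k}" "x \<noteq> \<one>\<^bsub>?H\<^esub>" and p: "p \<in> \<Gamma>"
        "p \<notin> beyond (side k) \<union> beyond (inv_side (side k))" for k x p
    proof (rule beyond_pong[OF sideE[OF k] _ _ p])
      have "generate ?H {k} = generate PSL2Z {k}"
        using k sub by (intro PSL.generate_consistent[OF _ subgroup_G]) blast
      then show "x \<in> generate PSL2Z {elt (side k)}" using x(1) side(2)[OF k] by simp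
      show "x \<noteq> one_psl" using x(2) by simp
    qed
  qed
  show ?thesis by (rule independent)
qed

end

theorem theorem3p1:
  fixes G :: "psl set" and C :: "comb_vertex set"
    and jv :: "(comb_vertex, psl set) cut_vertex \<Rightarrow> comb_vertex"
    and je :: "psl set \<Rightarrow> psl set"
  assumes "subgroup G PSL2Z"
    and "C \<subseteq> {W \<in> verts (Y_comb G). valency (Y_comb G) W = 2}"
    and "is_tree (Y_cut G C)"
    and "is_lift G C jv je"
  shows "special_polygon (polygon G C je) (polygon_edges G C je) (side_inv G C je) \<and>
    (\<forall>S. S \<subseteq> polygon_edges G C je \<and>
         (\<forall>s \<in> polygon_edges G C je. \<exists>!t. t \<in> S \<inter> {s, side_inv G C je s}) \<longrightarrow>
         independent_generators (PSL2Z\<lparr>carrier := G\<rparr>) (side_elt G C je ` S))"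
proof -
  interpret cut_lift G C jv je using assms by (rule cut_lift.intro)
  show ?thesis
    unfolding polygon_eq polygon_edges_eq using special_polygon_P independent_side_elts by blast
qed

end
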